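(* Let $\Omega\subseteq\mathbb R^N$ be a bounded connected open set with Lipschitz continuous boundary, let $f:\Omega\times\mathbb R^N\to\overline{\mathbb R}$ be a Borel function and let $F:W^{1,\infty}(\Omega)\to\overline{\mathbb R}$ be the supremal functional $F(u)=\operatorname{ess\,sup}_{x\in\Omega} f(x,Du(x))$. Assume that for every real $\lambda>\inf_{W^{1,\infty}(\Omega)}F$ there exist $\alpha(\lambda),\beta(\lambda)>0$ such that $$\alpha(\lambda)|x-y|\le d^\lambda_F(x,y)\le \beta(\lambda)|x-y|_\Omega\qquad\forall x,y\in\Omega .$$ Then $\Gamma_{\tau_\infty}(F)=\Gamma_{w^*}(F)=\Gamma_{w^*_{seq}}(F)$ and, for every real $\lambda>\inf_{W^{1,\infty}(\Omega)}F$ and every $\tau\in\{\tau_\infty,w^*,w^*_{seq}\}$, $$\{u\in W^{1,\infty}(\Omega):\Gamma_\tau(F)(u)\le\lambda\}=\{u\in W^{1,\infty}(\Omega): R_{d^\lambda_{\Gamma_\tau(F)}}(u)\le1\}=\bigcap_{\lambda'>\lambda}\{u\in W^{1,\infty}(\Omega): R_{d^{\lambda'}_F}(u)\le 1\}.$$ In particular, $\Gamma_\tau(F)$ is a level convex functional.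
   Context: $\overline{\mathbb R}=[-\infty,+\infty]$. Functions in $W^{1,\infty}(\Omega)$ are identified with their continuous representatives. For $x,y\in\Omega$, $|x-y|_\Omega$ is the geodetic distance: the infimum of the Euclidean lengths of Lipschitz curves contained in $\Omega$ with end-points $x$ and $y$. For a functional $G:W^{1,\infty}(\Omega)\to\overline{\mathbb R}$ and real $\lambda>\inf_{W^{1,\infty}(\Omega)}G$, the (possibly non-symmetric) pseudo-distance is $d^\lambda_G(x,y):=\sup\{u(x)-u(y): u\in W^{1,\infty}(\Omega),\ G(u)\le\lambda\}$ for $x,y\in\Omega$, and the associated difference quotient is $R_{d^\lambda_G}(u):=\sup\left\{\frac{u(x)-u(y)}{d^\lambda_G(x,y)}: x,y\in\Omega,\ d^\lambda_G(x,y)\ne0\right\}$. Topologies on $W^{1,\infty}(\Omega)$: $\tau_\infty$ is the topology induced by the $L^\infty(\Omega)$ norm (uniform convergence); $w^*$ is the topology induced by the embedding $u\mapsto(u,Du)$ into $L^\infty(\Omega)\times L^\infty(\Omega;\mathbb R^N)$ with its weak* topology; $w^*_{seq}$ is the topology whose closed sets are the sequentially $w^*$-closed sets. For a topology $\tau$, $\Gamma_\tau(F)$ is the $\tau$-lower semicontinuous envelope of $F$, i.e. the pointwise supremum of all $\tau$-lower semicontinuous $G:W^{1,\infty}(\Omega)\to\overline{\mathbb R}$ with $G\le F$ ($G$ is $\tau$-lower semicontinuous if $\{G\le\lambda\}$ is $\tau$-closed for every $\lambda\in\mathbb R$). A functional is level convex if all its sublevel sets $\{\cdot\le\lambda\}$,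 $\lambda\in\mathbb R$, are convex. *)

theory Defs
  imports "HOL-Probability.Essential_Supremum"
begin

text \<open>Throughout, \<open>\<real>\<^sup>N\<close> is an arbitrary type of class \<open>euclidean_space\<close>, and \<open>\<Omega>\<close> carries the
  Lebesgue measure \<open>lebesgue_on \<Omega>\<close>.\<close>

text \<open>\<open>\<Omega>\<close> has Lipschitz boundary: near each boundary point and in a suitable orthonormal frame
  with last vector \<open>\<nu>\<close>, \<open>\<Omega>\<close> is the open epigraph of a Lipschitz function \<open>\<gamma>\<close> of the
  coordinates \<open>x - (x \<bullet> \<nu>) \<nu>\<close> orthogonal to \<open>\<nu>\<close>.\<close>

definition lipschitz_boundary :: "'a::euclidean_space set \<Rightarrow> bool" where
  "lipschitz_boundary \<Omega> \<longleftrightarrow>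
     (\<forall>p\<in>frontier \<Omega>. \<exists>\<nu> (\<gamma> :: 'a \<Rightarrow> real) L r.
        norm \<nu> = 1 \<and> r > 0 \<and> L-lipschitz_on {y. y \<bullet> \<nu> = 0} \<gamma> \<and>
        \<Omega> \<inter> ball p r = {x \<in> ball p r. \<gamma> (x - (x \<bullet> \<nu>) *\<^sub>R \<nu>) < x \<bullet> \<nu>})"

definition curve_length :: "(real \<Rightarrow> 'a::euclidean_space) \<Rightarrow> ereal" where
  "curve_length c =
     (SUP (n, t) \<in> {(n :: nat, t). mono_on {..n} t \<and> t ` {..n} \<subseteq> {0..1}}.
        ereal (\<Sum>i<n. norm (c (t (Suc i)) - c (t i))))"

definition geodetic_dist :: "'a::euclidean_space set \<Rightarrow> 'a \<Rightarrow> 'a \<Rightarrow> ereal" where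
  "geodetic_dist \<Omega> x y =
     (INF c \<in> {c. (\<exists>L. L-lipschitz_on {0..1} c) \<and> c ` {0..1} \<subseteq> \<Omega> \<and> c 0 = x \<and> c 1 = y}.
        curve_length c)"


subsection \<open>The space \<open>W\<^sup>1\<^sup>,\<^sup>\<infinity>(\<Omega>)\<close>\<close>

text \<open>\<open>C_k k\<close> is the class \<open>C\<^sup>k\<close> on the whole space, defined through iterated partial derivatives.\<close>

primrec C_k :: "nat \<Rightarrow> ('a::euclidean_space \<Rightarrow> real) \<Rightarrow> bool" where
  "C_k 0 \<phi> \<longleftrightarrow> continuous_on UNIV \<phi>"
| "C_k (Suc k) \<phi> \<longleftrightarrow>
     (\<forall>x. \<phi> differentiable (at x)) \<and> (\<forall>b\<in>Basis. C_k k (\<lambda>x. frechet_derivative \<phi> (at x) b))"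

definition test_function :: "'a::euclidean_space set \<Rightarrow> ('a \<Rightarrow> real) \<Rightarrow> bool" where
  "test_function \<Omega> \<phi> \<longleftrightarrow>
     (\<forall>k. C_k k \<phi>) \<and> compact (closure {x. \<phi> x \<noteq> 0}) \<and> closure {x. \<phi> x \<noteq> 0} \<subseteq> \<Omega>"

text \<open>The elements of \<open>Linf\<close> are functions, not classes modulo equality almost everywhere.\<close>

definition Linf :: "'a::euclidean_space set \<Rightarrow> ('a \<Rightarrow> 'b::euclidean_space) set" where
  "Linf \<Omega> = {g \<in> borel_measurable (lebesgue_on \<Omega>). \<exists>C. AE x in lebesgue_on \<Omega>. norm (g x) \<le> C}"

definition is_weak_gradient ::
    "'a::euclidean_space set \<Rightarrow> ('a \<Rightarrow> real) \<Rightarrow> ('a \<Rightarrow> 'a) \<Rightarrow> bool" where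
  "is_weak_gradient \<Omega> u g \<longleftrightarrow>
     (\<forall>\<phi>. test_function \<Omega> \<phi> \<longrightarrow>
        (\<forall>b\<in>Basis. (LINT x|lebesgue_on \<Omega>. u x * frechet_derivative \<phi> (at x) b)
                   = - (LINT x|lebesgue_on \<Omega>. (g x \<bullet> b) * \<phi> x)))"

text \<open>Elements are the continuous representatives. Since the ambient type consists of functions on
  the whole space, they are normalised to vanish off \<open>\<Omega>\<close>, so that functions on \<open>\<Omega>\<close> correspond
  to exactly one element and pointwise linear operations are inherited.\<close>

definition W1inf :: "'a::euclidean_space set \<Rightarrow> ('a \<Rightarrow> real) set" where
  "W1inf \<Omega> = {u \<in> Linf \<Omega>. continuous_on \<Omega> u \<and> (\<forall>x. x \<notin> \<Omega> \<longrightarrow> u x = 0) \<and>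
                        (\<exists>g\<in>Linf \<Omega>. is_weak_gradient \<Omega> u g)}"

text \<open>\<open>weak_gradient \<Omega> u\<close> is one representative of the almost everywhere class of \<open>Du\<close>.\<close>

definition weak_gradient :: "'a::euclidean_space set \<Rightarrow> ('a \<Rightarrow> real) \<Rightarrow> 'a \<Rightarrow> 'a" where
  "weak_gradient \<Omega> u = (SOME g. g \<in> Linf \<Omega> \<and> is_weak_gradient \<Omega> u g)"


subsection \<open>Topologies on \<open>W\<^sup>1\<^sup>,\<^sup>\<infinity>(\<Omega>)\<close>\<close>

definition Linf_dist :: "'a::euclidean_space set \<Rightarrow> ('a \<Rightarrow> real) \<Rightarrow> ('a \<Rightarrow> real) \<Rightarrow> real" where
  "Linf_dist \<Omega> u v = real_of_ereal (esssup (lebesgue_on \<Omega>) (\<lambda>x. ereal \<bar>u x - v x\<bar>))"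

definition tau_inf :: "'a::euclidean_space set \<Rightarrow> ('a \<Rightarrow> real) topology" where
  "tau_inf \<Omega> = Metric_space.mtopology (W1inf \<Omega>) (Linf_dist \<Omega>)"

text \<open>The weak* topology of \<open>L\<^sup>\<infinity>\<close> as the dual of \<open>L\<^sup>1\<close>: the coarsest topology for which
  all pairings with \<open>L\<^sup>1\<close> functions are continuous.\<close>

definition weak_star_Linf ::
    "'a::euclidean_space set \<Rightarrow> ('a \<Rightarrow> 'b::euclidean_space) topology" where
  "weak_star_Linf \<Omega> = topology_generated_by
     {{g \<in> Linf \<Omega>. (LINT x|lebesgue_on \<Omega>. g x \<bullet> h x) \<in> V} | h V.
        integrable (lebesgue_on \<Omega>) h \<and> open V}"

definition wstar :: "'a::euclidean_space set \<Rightarrow> ('a \<Rightarrow> real) topology" where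
  "wstar \<Omega> = pullback_topology (W1inf \<Omega>) (\<lambda>u. (u, weak_gradient \<Omega> u))
               (prod_topology (weak_star_Linf \<Omega>) (weak_star_Linf \<Omega>))"

definition seq_closedin :: "'x topology \<Rightarrow> 'x set \<Rightarrow> bool" where
  "seq_closedin T C \<longleftrightarrow> C \<subseteq> topspace T \<and>
     (\<forall>s l. (\<forall>n :: nat. s n \<in> C) \<and> limitin T s l sequentially \<longrightarrow> l \<in> C)"

definition seq_topology :: "'x topology \<Rightarrow> 'x topology" where
  "seq_topology T = topology (\<lambda>U. U \<subseteq> topspace T \<and> seq_closedin T (topspace T - U))"

definition wstar_seq :: "'a::euclidean_space set \<Rightarrow> ('a \<Rightarrow> real) topology" where
  "wstar_seq \<Omega> = seq_topology (wstar \<Omega>)"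


subsection \<open>Functionals on \<open>W\<^sup>1\<^sup>,\<^sup>\<infinity>(\<Omega>)\<close>\<close>

definition lsc_wrt :: "'x topology \<Rightarrow> ('x \<Rightarrow> ereal) \<Rightarrow> bool" where
  "lsc_wrt T G \<longleftrightarrow> (\<forall>l::real. closedin T {u \<in> topspace T. G u \<le> ereal l})"

definition lsc_envelope :: "'x topology \<Rightarrow> ('x \<Rightarrow> ereal) \<Rightarrow> 'x \<Rightarrow> ereal" where
  "lsc_envelope T F u = (SUP G \<in> {G. lsc_wrt T G \<and> (\<forall>v\<in>topspace T. G v \<le> F v)}. G u)"

definition pseudo_dist ::
    "'a::euclidean_space set \<Rightarrow> (('a \<Rightarrow> real) \<Rightarrow> ereal) \<Rightarrow> real \<Rightarrow> 'a \<Rightarrow> 'a \<Rightarrow> ereal" where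
  "pseudo_dist \<Omega> G l x y = (SUP u \<in> {u \<in> W1inf \<Omega>. G u \<le> ereal l}. ereal (u x - u y))"

definition diff_quotient ::
    "'a set \<Rightarrow> ('a \<Rightarrow> 'a \<Rightarrow> ereal) \<Rightarrow> ('a \<Rightarrow> real) \<Rightarrow> ereal" where
  "diff_quotient \<Omega> d u =
     (SUP (x, y) \<in> {(x, y). x \<in> \<Omega> \<and> y \<in> \<Omega> \<and> d x y \<noteq> 0}. ereal (u x - u y) / d x y)"

text \<open>Function types are not an instance of \<open>real_vector\<close>, so convexity of the sublevel sets is
  spelled out.\<close>

definition level_convex :: "'a::euclidean_space set \<Rightarrow> (('a \<Rightarrow> real) \<Rightarrow> ereal) \<Rightarrow> bool" where
  "level_convex \<Omega> G \<longleftrightarrow>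
     (\<forall>l::real. \<forall>u \<in> {u \<in> W1inf \<Omega>. G u \<le> ereal l}. \<forall>v \<in> {u \<in> W1inf \<Omega>. G u \<le> ereal l}.
        \<forall>t\<in>{0..1}. (\<lambda>x. (1 - t) * u x + t * v x) \<in> {u \<in> W1inf \<Omega>. G u \<le> ereal l})"


subsection \<open>Well-definedness of the topologies\<close>

lemma seq_closedin_Un:
  assumes A: "seq_closedin T A" and B: "seq_closedin T B"
  shows "seq_closedin T (A \<union> B)"
  unfolding seq_closedin_def
proof (rule conjI)
  show "A \<union> B \<subseteq> topspace T" using A B by (simp add: seq_closedin_def)
  show "\<forall>s l. (\<forall>n :: nat. s n \<in> A \<union> B) \<and> limitin T s l sequentially \<longrightarrow> l \<in> A \<union> B"
  proof (rule allI, rule allI, rule impI, erule conjE)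
    fix s :: "nat \<Rightarrow> 'a" and l
    assume s: "\<forall>n. s n \<in> A \<union> B" and l: "limitin T s l sequentially"
    have sub: "l \<in> C" if C: "seq_closedin T C" and inf: "infinite {n. s n \<in> C}" for C
    proof -
      from infinite_enumerate[OF inf] obtain r :: "nat \<Rightarrow> nat"
        where r: "strict_mono r" "\<forall>n. r n \<in> {n. s n \<in> C}"
        by (elim exE conjE)
      have "limitin T (s \<circ> r) l sequentially"
        by (rule limitin_subsequence[OF r(1) l])
      moreover have "\<forall>n. (s \<circ> r) n \<in> C" using r(2) by simp
      ultimately show ?thesis using C by (simp only: seq_closedin_def)
    qed
    have "{n. s n \<in> A} \<union> {n. s n \<in> B} = UNIV" using s by auto
    then have "infinite {n. s n \<in> A} \<or> infinite {n. s n \<in> B}"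
      by (metis finite_Un infinite_UNIV_nat)
    then show "l \<in> A \<union> B" using sub[OF A] sub[OF B] by auto
  qed
qed

lemma seq_closedin_Inter:
  assumes K: "\<And>S. S \<in> K \<Longrightarrow> seq_closedin T (topspace T - S)"
  shows "seq_closedin T (topspace T - \<Union>K)"
  unfolding seq_closedin_def
proof (rule conjI)
  show "topspace T - \<Union>K \<subseteq> topspace T" by auto
  show "\<forall>s l. (\<forall>n :: nat. s n \<in> topspace T - \<Union>K) \<and> limitin T s l sequentially \<longrightarrow>
          l \<in> topspace T - \<Union>K"
  proof (rule allI, rule allI, rule impI, erule conjE)
    fix s :: "nat \<Rightarrow> 'a" and l
    assume s: "\<forall>n. s n \<in> topspace T - \<Union>K" and l: "limitin T s l sequentially"
    have "l \<in> topspace T - S" if "S \<in> K" for S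
    proof -
      have "\<forall>n. s n \<in> topspace T - S" using s that by auto
      then show ?thesis using K[OF that] l by (simp only: seq_closedin_def)
    qed
    moreover have "l \<in> topspace T" using l limitin_topspace by metis
    ultimately show "l \<in> topspace T - \<Union>K" by auto
  qed
qed

lemma istopology_seq:
  "istopology (\<lambda>U. U \<subseteq> topspace T \<and> seq_closedin T (topspace T - U))"
  unfolding istopology_def
proof (intro conjI allI impI)
  fix S U
  assume S: "S \<subseteq> topspace T \<and> seq_closedin T (topspace T - S)"
    and U: "U \<subseteq> topspace T \<and> seq_closedin T (topspace T - U)"
  show "S \<inter> U \<subseteq> topspace T" using S by (simp add: le_infI1)
  show "seq_closedin T (topspace T - S \<inter> U)"
    using seq_closedin_Un[OF S[THEN conjunct2] U[THEN conjunct2]] by (simp only: Diff_Int)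
next
  fix K
  assume K: "\<forall>S\<in>K. S \<subseteq> topspace T \<and> seq_closedin T (topspace T - S)"
  show "\<Union>K \<subseteq> topspace T" using K by (simp add: Union_least)
  show "seq_closedin T (topspace T - \<Union>K)" by (rule seq_closedin_Inter) (simp add: K)
qed

lemma openin_seq_topology:
  "openin (seq_topology T) U \<longleftrightarrow> U \<subseteq> topspace T \<and> seq_closedin T (topspace T - U)"
  unfolding seq_topology_def by (subst topology_inverse'[OF istopology_seq]) (rule refl)

lemma topspace_seq_topology [simp]: "topspace (seq_topology T) = topspace T"
proof -
  have "openin (seq_topology T) (topspace T)"
    by (simp add: openin_seq_topology seq_closedin_def)
  moreover have "topspace (seq_topology T) \<subseteq> topspace T"
    using openin_topspace[of "seq_topology T"] by (simp only: openin_seq_topology)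
  ultimately show ?thesis by (simp add: openin_subset subset_antisym)
qed

lemma closedin_seq_topology: "closedin (seq_topology T) C \<longleftrightarrow> seq_closedin T C"
proof -
  have "topspace T - (topspace T - C) = C" if "C \<subseteq> topspace T"
    using that by (simp add: double_diff)
  then show ?thesis
    by (metis closedin_def openin_seq_topology topspace_seq_topology Diff_subset seq_closedin_def)
qed

lemma topspace_weak_star_Linf [simp]: "topspace (weak_star_Linf \<Omega>) = Linf \<Omega>"
proof -
  have "Linf \<Omega> \<in> {{g \<in> Linf \<Omega>. (LINT x|lebesgue_on \<Omega>. g x \<bullet> h x) \<in> V} | h V.
        integrable (lebesgue_on \<Omega>) h \<and> open V}"
    by (rule CollectI, rule exI[of _ "\<lambda>_. 0"], rule exI[of _ UNIV]) auto
  then show ?thesis unfolding weak_star_Linf_def topology_generated_by_topspace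
    by (intro subset_antisym Union_least Union_upper) auto
qed

lemma weak_gradient:
  assumes "u \<in> W1inf \<Omega>"
  shows "weak_gradient \<Omega> u \<in> Linf \<Omega>" "is_weak_gradient \<Omega> u (weak_gradient \<Omega> u)"
proof -
  have "\<exists>g. g \<in> Linf \<Omega> \<and> is_weak_gradient \<Omega> u g" using assms by (auto simp: W1inf_def)
  from someI_ex[OF this] show "weak_gradient \<Omega> u \<in> Linf \<Omega>"
    "is_weak_gradient \<Omega> u (weak_gradient \<Omega> u)" by (auto simp: weak_gradient_def)
qed

lemma topspace_wstar [simp]: "topspace (wstar \<Omega>) = W1inf \<Omega>"
proof -
  have "u \<in> Linf \<Omega>" if "u \<in> W1inf \<Omega>" for u using that by (simp add: W1inf_def)
  then show ?thesis
    using weak_gradient(1) by (auto simp: wstar_def topspace_pullback_topology)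
qed

lemma topspace_wstar_seq [simp]: "topspace (wstar_seq \<Omega>) = W1inf \<Omega>"
  by (simp add: wstar_seq_def)

text \<open>For open \<open>\<Omega>\<close>, the \<open>L\<^sup>\<infinity>\<close> distance is the supremum distance of continuous functions;
  in particular it is a metric on \<open>W1inf \<Omega>\<close>.\<close>

lemma AE_le_imp_le_open:
  fixes \<Omega> :: "'a::euclidean_space set" and w :: "'a \<Rightarrow> real"
  assumes "open \<Omega>" "continuous_on \<Omega> w" "AE x in lebesgue_on \<Omega>. w x \<le> c" "x \<in> \<Omega>"
  shows "w x \<le> c"
proof (rule ccontr)
  assume "\<not> w x \<le> c"
  define U where "U = {y\<in>\<Omega>. w y > c}"
  have "open (\<Omega> \<inter> w -` {c<..})"
    by (rule continuous_open_preimage[OF assms(2,1) open_greaterThan])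
  moreover have "\<Omega> \<inter> w -` {c<..} = U" by (auto simp: U_def)
  ultimately have U: "open U" "x \<in> U"
    using \<open>x \<in> \<Omega>\<close> \<open>\<not> w x \<le> c\<close> by (simp_all add: U_def)
  have "AE y in lebesgue. y \<in> \<Omega> \<longrightarrow> w y \<le> c"
    using assms(1,3) by (subst (asm) AE_restrict_space_iff) auto
  then have "AE y in lebesgue. y \<notin> U" by (rule AE_mp) (auto simp: U_def)
  then have "U \<in> null_sets lebesgue" using U by (subst (asm) AE_iff_null_sets[symmetric]) auto
  then have "negligible U" by (simp add: negligible_iff_null_sets)
  then show False using open_not_negligible[OF \<open>open U\<close>] U by blast
qed

lemma Linf_dist_le_iff:
  assumes "open \<Omega>" "\<Omega> \<noteq> {}" "u \<in> W1inf \<Omega>" "v \<in> W1inf \<Omega>"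
  shows "Linf_dist \<Omega> u v \<le> c \<longleftrightarrow> (\<forall>x\<in>\<Omega>. \<bar>u x - v x\<bar> \<le> c)"
proof -
  let ?M = "lebesgue_on \<Omega>" and ?w = "\<lambda>x. \<bar>u x - v x\<bar>"
  let ?s = "esssup ?M (\<lambda>x. ereal (?w x))"
  have meas: "u \<in> borel_measurable ?M" "v \<in> borel_measurable ?M"
    using assms by (auto simp: W1inf_def Linf_def)
  then have m: "(\<lambda>x. ereal (?w x)) \<in> borel_measurable ?M" by measurable
  have cont: "continuous_on \<Omega> ?w"
    using assms by (auto simp: W1inf_def intro!: continuous_intros)
  have le: "?s \<le> ereal c \<longleftrightarrow> (\<forall>x\<in>\<Omega>. ?w x \<le> c)" for c
  proof
    assume s: "?s \<le> ereal c"
    have "AE x in ?M. ereal (?w x) \<le> ?s" by (rule esssup_AE)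
    then have "AE x in ?M. ?w x \<le> c"
    proof eventually_elim
      case (elim x)
      then show ?case using order_trans[OF elim s] by simp
    qed
    then show "\<forall>x\<in>\<Omega>. ?w x \<le> c" using AE_le_imp_le_open[OF assms(1) cont] by blast
  next
    assume "\<forall>x\<in>\<Omega>. ?w x \<le> c"
    then show "?s \<le> ereal c" by (intro esssup_I[OF m]) auto
  qed
  obtain C D where CD: "AE x in ?M. norm (u x) \<le> C" "AE x in ?M. norm (v x) \<le> D"
    using assms by (auto simp: W1inf_def Linf_def)
  have "AE x in ?M. ?w x \<le> C + D" using CD by eventually_elim auto
  then have "?s \<le> ereal (C + D)" by (intro esssup_I[OF m]) auto
  moreover have "?s \<ge> 0"
  proof (rule ccontr)
    assume "\<not> 0 \<le> ?s"
    then have "?s < ereal 0" by (simp add: zero_ereal_def)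
    from ereal_dense2[OF this] obtain c where c: "?s < ereal c" "ereal c < ereal 0"
      by (elim exE conjE)
    have "\<forall>x\<in>\<Omega>. ?w x \<le> c" using le[of c] less_imp_le[OF c(1)] by (rule iffD1)
    moreover have "c < 0" using c(2) by simp
    ultimately have "False" if "x \<in> \<Omega>" for x
      using that by (smt (verit) abs_ge_zero)
    then show False using assms(2) by blast
  qed
  ultimately obtain r where "?s = ereal r" by (cases ?s) auto
  then show ?thesis using le[of c] by (simp add: Linf_dist_def)
qed

lemma Metric_space_Linf_dist:
  assumes "open \<Omega>"
  shows "Metric_space (W1inf \<Omega>) (Linf_dist \<Omega>)"
proof (cases "\<Omega> = {}")
  case True
  then have eq: "u = v" if "u \<in> W1inf \<Omega>" "v \<in> W1inf \<Omega>" for u v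
    using that by (auto simp: W1inf_def)
  have "ae_filter (lebesgue_on \<Omega>) = bot"
    using True by (auto simp: trivial_limit_def eventually_ae_filter space_restrict_space
        null_sets_def sets_restrict_space)
  then have "Linf_dist \<Omega> u v = 0" for u v :: "'a \<Rightarrow> real"
    by (simp add: Linf_dist_def esssup_def top_ereal_def bot_ereal_def)
  then show ?thesis by unfold_locales (use eq in auto)
next
  case False
  note le = Linf_dist_le_iff[OF assms False]
  show ?thesis
  proof
    fix u v :: "'a \<Rightarrow> real"
    have "esssup (lebesgue_on \<Omega>) (\<lambda>x. ereal \<bar>u x - v x\<bar>) \<ge> esssup (lebesgue_on \<Omega>) (\<lambda>x. 0)"
      by (rule esssup_mono) auto
    moreover have "emeasure (lebesgue_on \<Omega>) (space (lebesgue_on \<Omega>)) \<noteq> 0"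
      using assms False open_not_negligible[OF assms False]
      by (auto simp: emeasure_restrict_space space_restrict_space negligible_iff_null_sets
          null_sets_def)
    ultimately show "0 \<le> Linf_dist \<Omega> u v"
      by (simp add: Linf_dist_def esssup_const real_of_ereal_pos)
    show "Linf_dist \<Omega> u v = Linf_dist \<Omega> v u"
      by (simp add: Linf_dist_def abs_minus_commute)
  next
    fix u v assume uv: "u \<in> W1inf \<Omega>" "v \<in> W1inf \<Omega>"
    show "Linf_dist \<Omega> u v = 0 \<longleftrightarrow> u = v"
    proof
      assume "Linf_dist \<Omega> u v = 0"
      then have "\<forall>x\<in>\<Omega>. \<bar>u x - v x\<bar> \<le> 0" using le[OF uv, of 0] by simp
      then show "u = v" using uv by (fastforce simp: W1inf_def)
    next
      assume "u = v"
      moreover have "emeasure (lebesgue_on \<Omega>) (space (lebesgue_on \<Omega>)) \<noteq> 0"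
        using assms False open_not_negligible[OF assms False]
        by (auto simp: emeasure_restrict_space space_restrict_space negligible_iff_null_sets
            null_sets_def)
      ultimately show "Linf_dist \<Omega> u v = 0"
        using esssup_const[of "lebesgue_on \<Omega>" "0::ereal"] by (simp add: Linf_dist_def zero_ereal_def)
    qed
  next
    fix u v w assume uvw: "u \<in> W1inf \<Omega>" "v \<in> W1inf \<Omega>" "w \<in> W1inf \<Omega>"
    have "\<forall>x\<in>\<Omega>. \<bar>u x - v x\<bar> \<le> Linf_dist \<Omega> u v" "\<forall>x\<in>\<Omega>. \<bar>v x - w x\<bar> \<le> Linf_dist \<Omega> v w"
      using le uvw by blast+
    then have "\<forall>x\<in>\<Omega>. \<bar>u x - w x\<bar> \<le> Linf_dist \<Omega> u v + Linf_dist \<Omega> v w" by fastforce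
    then show "Linf_dist \<Omega> u w \<le> Linf_dist \<Omega> u v + Linf_dist \<Omega> v w"
      using le uvw by blast
  qed
qed

end

theory Submission
  imports Defs
begin

text \<open>All three envelopes equal the functional \<open>relaxation\<close>, whose value at \<open>u\<close> is the infimum of the levels \<open>l\<close>
  with \<open>u x - u y \<le> d\<^sub>l(x, y)\<close> for all \<open>x, y\<close>, where \<open>d\<^sub>l\<close> is the pseudo-distance of \<open>F\<close>.

  It is lower semicontinuous for each topology because the constraints are closed: pointwise for
  uniform convergence, and through averages over small balls for the weak* topology, the
  admissible functions being equi-Lipschitz along segments by the upper bound on \<open>d\<^sub>l\<close>.

  It is the largest such functional below \<open>F\<close> because every \<open>u\<close> satisfying the constraints is a uniform limit
  of functions with \<open>F \<le> l\<close>. The sublevel sets of a supremal functional are stable under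
  adding constants and under finite maxima and minima, so the lattice argument of the Stone--Weierstrass
  theorem applies, with the Lipschitz boundary giving the compactness. As the
  approximants are equi-Lipschitz, their gradients converge weakly* as well.\<close>


subsection \<open>Smooth bump functions\<close>

text \<open>The obstacle: a sublevel set of \<open>F\<close> need not be convex or stable under
  mollification, as a new gradient value may push \<open>f\<close> above the level. The approximants
  must come from operations after which the gradient is, almost everywhere, one of those already
  present. This leaves constants, maxima and minima, and makes the weak gradient of a function glued
  from two others the analytic core.

  \<open>weak_gradient\<close> is an arbitrary choice in its class, so every computed gradient has
  to be identified with it almost everywhere. This uniqueness, the bound of the gradient by the
  Lipschitz constant and the weak* convergence of gradients all extend a statement on test functions
  to pairings with \<open>L^1\<close> functions; hence the density of test functions, and the smooth
  bumps behind it.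

  The admissible functions are Lipschitz along segments in \<open>\<Omega>\<close>, not a priori for
  the Euclidean distance, so finite nets need control up to the boundary. For the weak* topology
  sequences do not decide closedness a priori, so it is shown with explicit neighbourhoods.\<close>

lemma C_k_SucD: "C_k (Suc k) \<phi> \<Longrightarrow> C_k k \<phi>"
proof (induction k arbitrary: \<phi>)
  case 0
  then show ?case
    by (auto intro!: continuous_at_imp_continuous_on differentiable_imp_continuous_within)
qed auto

text \<open>Derivatives are unique, so an explicit \<open>D\<close> may replace
  \<open>frechet_derivative\<close>; the closure rules below then follow from the standard
  derivative rules.\<close>

lemma C_k_SucI:
  assumes "\<And>x. (\<phi> has_derivative D x) (at x)" "\<And>b. b \<in> Basis \<Longrightarrow> C_k k (\<lambda>x. D x b)"
  shows "C_k (Suc k) \<phi>"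
proof -
  have "frechet_derivative \<phi> (at x) = D x" for x
    using frechet_derivative_at[OF assms(1)] by simp
  then show ?thesis using assms by (auto simp: differentiable_def)
qed

lemma C_k_SucE:
  assumes "C_k (Suc k) \<phi>"
  shows "(\<phi> has_derivative frechet_derivative \<phi> (at x)) (at x)"
  using assms by (simp add: frechet_derivative_works)

lemma C_k_const: "C_k k (\<lambda>_. c)"
proof (induction k arbitrary: c)
  case (Suc k)
  show ?case by (rule C_k_SucI[OF has_derivative_const]) (rule Suc)
qed simp

lemma C_k_add: "C_k k \<phi> \<Longrightarrow> C_k k \<psi> \<Longrightarrow> C_k k (\<lambda>x. \<phi> x + \<psi> x)"
proof (induction k arbitrary: \<phi> \<psi>)
  case 0
  then show ?case by (auto intro!: continuous_intros)
next
  case (Suc k)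
  show ?case
    by (rule C_k_SucI[OF has_derivative_add[OF C_k_SucE[OF Suc.prems(1)] C_k_SucE[OF Suc.prems(2)]]])
      (use Suc in auto)
qed

text \<open>The product rule pairs a derivative, of class \<open>k\<close>, with an undifferentiated
  factor, of class \<open>Suc k\<close>; \<open>C_k_SucD\<close> lowers the latter so that the
  induction hypothesis applies.\<close>

lemma C_k_mult: "C_k k \<phi> \<Longrightarrow> C_k k \<psi> \<Longrightarrow> C_k k (\<lambda>x. \<phi> x * \<psi> x)"
proof (induction k arbitrary: \<phi> \<psi>)
  case 0
  then show ?case by (auto intro!: continuous_intros)
next
  case (Suc k)
  show ?case
    by (rule C_k_SucI[OF has_derivative_mult[OF C_k_SucE[OF Suc.prems(1)] C_k_SucE[OF Suc.prems(2)]]])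
      (use Suc C_k_SucD[OF Suc.prems(1)] C_k_SucD[OF Suc.prems(2)] in \<open>auto intro!: C_k_add\<close>)
qed

lemma C_k_diff: "C_k k \<phi> \<Longrightarrow> C_k k \<psi> \<Longrightarrow> C_k k (\<lambda>x. \<phi> x - \<psi> x)"
  using C_k_add[OF _ C_k_mult[OF C_k_const[of k "-1"]], of \<phi> \<psi>] by simp

lemma C_k_prod: "(\<And>i. i \<in> I \<Longrightarrow> C_k k (\<phi> i)) \<Longrightarrow> C_k k (\<lambda>x. \<Prod>i\<in>I. \<phi> i x)"
  by (induction I rule: infinite_finite_induct) (auto intro!: C_k_const C_k_mult)

lemma C_k_power: "C_k k \<phi> \<Longrightarrow> C_k k (\<lambda>x. \<phi> x ^ n)"
  by (induction n) (auto intro!: C_k_const C_k_mult)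

lemma C_k_inner: "C_k k (\<lambda>x. x \<bullet> c)"
proof (cases k)
  case (Suc j)
  show ?thesis unfolding Suc
    by (rule C_k_SucI[of _ "\<lambda>x h. h \<bullet> c"]) (auto intro!: derivative_eq_intros C_k_const)
qed (auto intro!: continuous_intros)

lemma C_k_norm_sq: "C_k k (\<lambda>x. (x - a) \<bullet> (x - a))"
proof (cases k)
  case (Suc j)
  have "C_k j (\<lambda>x. 2 * (x \<bullet> b) - 2 * (a \<bullet> b))" for b
    by (intro C_k_diff C_k_mult C_k_const C_k_inner)
  then show ?thesis unfolding Suc
    by (intro C_k_SucI[of _ "\<lambda>x h. 2 * (x \<bullet> h) - 2 * (a \<bullet> h)"])
      (auto intro!: derivative_eq_intros simp: algebra_simps inner_commute)
qed (auto intro!: continuous_intros)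

text \<open>The family \<open>p(1/t) exp(-1/t)\<close>, extended by \<open>0\<close> to \<open>t \<le> 0\<close>, is closed under differentiation.\<close>

definition flat_exp :: "real poly \<Rightarrow> real \<Rightarrow> real" where
  "flat_exp p t = (if t > 0 then poly p (1 / t) * exp (- (1 / t)) else 0)"

lemma poly_times_exp_minus_tendsto_0:
  "((\<lambda>y. poly p y * exp (- y :: real)) \<longlongrightarrow> 0) at_top"
proof -
  have "((\<lambda>y. \<Sum>i\<le>degree p. coeff p i * (y ^ i / exp y)) \<longlongrightarrow> (\<Sum>i\<le>degree p. coeff p i * 0)) at_top"
    by (intro tendsto_intros tendsto_power_div_exp_0)
  moreover have "(\<lambda>y. \<Sum>i\<le>degree p. coeff p i * (y ^ i / exp y)) = (\<lambda>y. poly p y * exp (- y))"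
    by (simp add: poly_altdef sum_distrib_right sum_divide_distrib exp_minus field_simps)
  ultimately show ?thesis by simp
qed

lemma flat_exp_tendsto_0: "((\<lambda>t. flat_exp p t) \<longlongrightarrow> 0) (at_right 0)"
proof -
  have "((\<lambda>t. poly p (1 / t) * exp (- (1 / t :: real))) \<longlongrightarrow> 0) (at_right 0)"
    using filterlim_compose[OF poly_times_exp_minus_tendsto_0 filterlim_inverse_at_top_right, of p]
    by (simp add: inverse_eq_divide)
  then show ?thesis
    by (rule Lim_transform_eventually) (auto simp: flat_exp_def eventually_at_right_less
        intro: eventually_mono[OF eventually_at_right_less])
qed

text \<open>With \<open>y = 1/t\<close> the derivative of \<open>p(y) exp(-y)\<close> is
  \<open>y^2 (p(y) - p'(y)) exp(-y)\<close>, and \<open>[:0, 0, 1:]\<close> is the polynomial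
  \<open>y^2\<close>.\<close>

lemma flat_exp_has_derivative:
  "(flat_exp p has_real_derivative flat_exp ([:0, 0, 1:] * (p - pderiv p)) t) (at t)"
proof -
  consider "t > 0" | "t < 0" | "t = 0" by linarith
  then show ?thesis
  proof cases
    case 1
    have "((\<lambda>t. poly p (1 / t) * exp (- (1 / t))) has_real_derivative
        flat_exp ([:0, 0, 1:] * (p - pderiv p)) t) (at t)"
      using 1 by (auto intro!: derivative_eq_intros DERIV_chain2[OF poly_DERIV]
          simp: flat_exp_def field_simps power2_eq_square)
    then show ?thesis
      by (rule has_field_derivative_transform_within_open[of _ _ _ "{0<..}"])
        (use 1 in \<open>auto simp: flat_exp_def\<close>)
  next
    case 2
    have "((\<lambda>_. 0) has_real_derivative 0) (at t)" by simp
    then have "(flat_exp p has_real_derivative 0) (at t)"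
      by (rule has_field_derivative_transform_within_open[of _ _ _ "{..<0}"])
        (use 2 in \<open>auto simp: flat_exp_def\<close>)
    then show ?thesis using 2 by (simp add: flat_exp_def)
  next
    case 3
    \<comment> \<open>Dividing by \<open>h\<close> multiplies the polynomial in \<open>1/h\<close>
      by its variable, which gives \<open>pCons 0 p\<close>; the quotient is again a member of the
      family and tends to 0.\<close>
    have "((\<lambda>h. flat_exp p h / h) \<longlongrightarrow> 0) (at_right 0)"
    proof (rule Lim_transform_eventually[OF flat_exp_tendsto_0[of "pCons 0 p"]])
      show "\<forall>\<^sub>F h in at_right 0. flat_exp (pCons 0 p) h = flat_exp p h / h"
        by (rule eventually_mono[OF eventually_at_right_less]) (auto simp: flat_exp_def)
    qed
    moreover have "((\<lambda>h. flat_exp p h / h) \<longlongrightarrow> 0) (at_left 0)"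
      by (rule Lim_transform_eventually[OF tendsto_const])
        (auto simp: flat_exp_def eventually_at_left_field intro!: exI[of _ "-1"])
    ultimately have "((\<lambda>h. flat_exp p h / h) \<longlongrightarrow> 0) (at 0)"
      by (simp add: filterlim_split_at)
    then show ?thesis using 3 by (simp add: DERIV_def flat_exp_def)
  qed
qed

text \<open>\<open>p\<close> varies in the induction because each differentiation changes the
  polynomial; \<open>q\<close> has every order of smoothness because its derivative appears as a
  factor at each stage.\<close>

lemma C_k_flat_exp_compose:
  assumes "\<And>k. C_k k q"
  shows "C_k k (\<lambda>x. flat_exp p (q x))"
proof (induction k arbitrary: p)
  case 0
  have "continuous_on UNIV (flat_exp p)"
    by (meson flat_exp_has_derivative DERIV_isCont continuous_at_imp_continuous_on)
  then show ?case using assms[of 0] continuous_on_compose2[of UNIV "flat_exp p" UNIV q] by simp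
next
  case (Suc k)
  let ?p' = "[:0, 0, 1:] * (p - pderiv p)"
  have "((\<lambda>x. flat_exp p (q x)) has_derivative
      (\<lambda>h. flat_exp ?p' (q x) * frechet_derivative q (at x) h)) (at x)" for x
    using has_derivative_compose[OF C_k_SucE[OF assms[of "Suc 0"], of x]
        flat_exp_has_derivative[of p "q x", unfolded has_field_derivative_def]] .
  then show ?case
    by (rule C_k_SucI) (use Suc assms[of "Suc k"] in \<open>auto intro!: C_k_mult simp del: mult_pCons_left\<close>)
qed

text \<open>On the ball this is \<open>exp (-1 / (r^2 - |x - a|^2))\<close>, the usual unnormalised
  mollifier kernel; the squared distance keeps it smooth at \<open>a\<close>.\<close>

definition bump :: "'a::euclidean_space \<Rightarrow> real \<Rightarrow> 'a \<Rightarrow> real" where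
  "bump a r x = flat_exp 1 (r\<^sup>2 - (x - a) \<bullet> (x - a))"

lemma C_k_bump: "C_k k (bump a r)"
  unfolding bump_def[abs_def]
  by (intro C_k_flat_exp_compose C_k_diff C_k_const C_k_norm_sq)

lemma bump_bounds: "0 \<le> bump a r x" "bump a r x < 1"
  by (auto simp: bump_def flat_exp_def)

lemma bump_pos_iff: "r > 0 \<Longrightarrow> 0 < bump a r x \<longleftrightarrow> x \<in> ball a r"
  by (auto simp: bump_def flat_exp_def dist_norm norm_minus_commute dot_square_norm
      power2_less_imp_less abs_le_square_iff intro: power_strict_mono)

section \<open>Translations of Lebesgue measure\<close>

lemma distr_lebesgue_translation:
  "distr lebesgue lebesgue (\<lambda>x::'a::euclidean_space. x + a) = lebesgue"
  and measurable_lebesgue_translation: "(\<lambda>x::'a::euclidean_space. x + a) \<in> lebesgue \<rightarrow>\<^sub>M lebesgue"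
  using lebesgue_affine_euclidean[of "\<lambda>_. 1" a] lebesgue_affine_measurable[of "\<lambda>_. 1" a]
  by (simp_all add: euclidean_representation add.commute density_1)

lemma borel_measurable_lebesgue_translation:
  "f \<in> borel_measurable lebesgue \<Longrightarrow> (\<lambda>x::'a::euclidean_space. f (x + a)) \<in> borel_measurable lebesgue"
  by (rule measurable_compose[OF measurable_lebesgue_translation])

lemma
  fixes f :: "'a::euclidean_space \<Rightarrow> real"
  assumes "f \<in> borel_measurable lebesgue"
  shows integral_lebesgue_translation: "(LINT x|lebesgue. f (x + a)) = (LINT x|lebesgue. f x)"
    and integrable_lebesgue_translation:
      "integrable lebesgue (\<lambda>x. f (x + a)) \<longleftrightarrow> integrable lebesgue f"
  using integral_distr[OF measurable_lebesgue_translation assms]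
    integrable_distr_eq[OF measurable_lebesgue_translation assms]
  unfolding distr_lebesgue_translation by simp_all

section \<open>Calculus of test functions\<close>

lemma test_function_continuous: "test_function U \<phi> \<Longrightarrow> continuous_on UNIV \<phi>"
  by (metis C_k.simps(1) test_function_def)

lemma test_function_mono: "test_function U \<phi> \<Longrightarrow> U \<subseteq> V \<Longrightarrow> test_function V \<phi>"
  by (auto simp: test_function_def)

lemma test_function_eq_0: "test_function U \<phi> \<Longrightarrow> x \<notin> U \<Longrightarrow> \<phi> x = 0"
  using closure_subset[of "{x. \<phi> x \<noteq> 0}"] by (auto simp: test_function_def)

lemma test_function_bounded:
  assumes "test_function U \<phi>"
  obtains B where "B > 0" "\<And>x. \<bar>\<phi> x\<bar> \<le> B"
proof -
  let ?S = "closure {x. \<phi> x \<noteq> 0}"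
  have "compact (\<phi> ` ?S)"
    using assms test_function_continuous[OF assms]
    by (auto simp: test_function_def intro!: compact_continuous_image elim: continuous_on_subset)
  then obtain B where B: "B > 0" "\<And>y. y \<in> \<phi> ` ?S \<Longrightarrow> \<bar>y\<bar> \<le> B"
    by (metis bounded_pos compact_imp_bounded real_norm_def)
  have "\<bar>\<phi> x\<bar> \<le> B" for x
    using B closure_subset[of "{x. \<phi> x \<noteq> 0}"] by (cases "\<phi> x = 0") auto
  then show thesis using that B by blast
qed

lemma test_function_integrable:
  assumes "test_function U \<phi>"
  shows "integrable lebesgue \<phi>"
proof -
  let ?S = "closure {x. \<phi> x \<noteq> 0}"
  have "integrable lborel (\<lambda>x. indicator ?S x *\<^sub>R \<phi> x)"
    using assms test_function_continuous[OF assms]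
    by (intro borel_integrable_compact) (auto simp: test_function_def elim: continuous_on_subset)
  moreover have "(\<lambda>x. indicator ?S x *\<^sub>R \<phi> x) = \<phi>"
    using closure_subset[of "{x. \<phi> x \<noteq> 0}"] by (auto simp: indicator_def fun_eq_iff)
  ultimately have "integrable lborel \<phi>" by simp
  then show ?thesis by (simp add: integrable_completion borel_measurable_integrable)
qed

lemma test_function_measurable: "test_function U \<phi> \<Longrightarrow> \<phi> \<in> borel_measurable lebesgue"
  using test_function_integrable by blast

lemma test_function_partial:
  assumes "test_function U \<phi>" "b \<in> Basis"
  shows "test_function U (\<lambda>x. frechet_derivative \<phi> (at x) b)"
proof -
  let ?S = "closure {x. \<phi> x \<noteq> 0}"
  have "frechet_derivative \<phi> (at x) b = 0" if "x \<notin> ?S" for x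
  proof -
    have "((\<lambda>_. 0) has_derivative (\<lambda>_. 0)) (at x)" by simp
    then have "(\<phi> has_derivative (\<lambda>_. 0)) (at x)"
      by (rule has_derivative_transform_within_open[of _ _ _ _ "- ?S"])
        (use that closure_subset[of "{x. \<phi> x \<noteq> 0}"] in auto)
    from frechet_derivative_at[OF this] show ?thesis by metis
  qed
  then have "closure {x. frechet_derivative \<phi> (at x) b \<noteq> 0} \<subseteq> ?S"
    by (intro closure_minimal) auto
  moreover have "C_k k (\<lambda>x. frechet_derivative \<phi> (at x) b)" for k
    using assms C_k.simps(2)[of k \<phi>] by (auto simp: test_function_def simp del: C_k.simps)
  moreover have "compact (closure {x. frechet_derivative \<phi> (at x) b \<noteq> 0})"
    using calculation(1) assms(1) unfolding test_function_def
    by (metis bounded_subset closed_closure compact_eq_bounded_closed)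
  moreover have "?S \<subseteq> U" using assms(1) by (simp add: test_function_def)
  ultimately show ?thesis unfolding test_function_def by blast
qed

lemma test_function_has_field_derivative:
  assumes "test_function U \<phi>"
  shows "((\<lambda>t. \<phi> (x + t *\<^sub>R b)) has_real_derivative frechet_derivative \<phi> (at (x + t *\<^sub>R b)) b) (at t)"
proof -
  have *: "(\<phi> has_derivative frechet_derivative \<phi> (at (x + t *\<^sub>R b))) (at (x + t *\<^sub>R b))"
    using assms C_k_SucE[of 0] by (auto simp: test_function_def simp del: C_k.simps)
  have "((\<lambda>t. x + t *\<^sub>R b) has_derivative (\<lambda>h. h *\<^sub>R b)) (at t)"
    by (auto intro!: derivative_eq_intros)
  from has_derivative_compose[OF this *]
  have "((\<lambda>t. \<phi> (x + t *\<^sub>R b)) has_derivative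
      (\<lambda>h. frechet_derivative \<phi> (at (x + t *\<^sub>R b)) (h *\<^sub>R b))) (at t)" .
  then show ?thesis
    by (simp add: has_field_derivative_def linear_cmul[OF has_derivative_linear[OF *]] mult_commute_abs)
qed

lemma test_function_diff_quotient_bound:
  assumes "test_function U \<phi>" "\<And>x. \<bar>frechet_derivative \<phi> (at x) b\<bar> \<le> M"
  shows "\<bar>\<phi> (x + s *\<^sub>R b) - \<phi> x\<bar> \<le> M * \<bar>s\<bar>"
  using field_differentiable_bound[OF convex_UNIV, of "\<lambda>t. \<phi> (x + t *\<^sub>R b)"
      "\<lambda>t. frechet_derivative \<phi> (at (x + t *\<^sub>R b)) b" M s 0]
    test_function_has_field_derivative[OF assms(1)] assms(2) by simp

text \<open>The bound on \<open>f\<close> is asked for where \<open>g\<close> does not vanish: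
  difference quotients are controlled on a neighbourhood \<open>U\<close> of the support of a test
  function, and \<open>g\<close> will be supported in \<open>U\<close>.\<close>

lemma
  fixes f g :: "'a \<Rightarrow> real"
  assumes "f \<in> borel_measurable M" "AE x in M. g x \<noteq> 0 \<longrightarrow> \<bar>f x\<bar> \<le> B" "integrable M g"
  shows integrable_mult_bounded_on: "integrable M (\<lambda>x. f x * g x)"
    and integral_mult_bounded_on: "\<bar>LINT x|M. f x * g x\<bar> \<le> B * (LINT x|M. \<bar>g x\<bar>)"
proof -
  have AE: "AE x in M. \<bar>f x * g x\<bar> \<le> B * \<bar>g x\<bar>"
    using assms(2)
  proof eventually_elim
    case (elim x)
    then show ?case by (cases "g x = 0") (auto simp: abs_mult intro!: mult_right_mono)
  qed
  show int: "integrable M (\<lambda>x. f x * g x)"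
  proof (rule Bochner_Integration.integrable_bound[of M "\<lambda>x. B * \<bar>g x\<bar>"])
    show "AE x in M. norm (f x * g x) \<le> norm (B * \<bar>g x\<bar>)"
      using AE by eventually_elim auto
  qed (use assms in auto)
  have "\<bar>LINT x|M. f x * g x\<bar> \<le> (LINT x|M. \<bar>f x * g x\<bar>)" by (rule integral_abs_bound)
  also have "\<dots> \<le> (LINT x|M. B * \<bar>g x\<bar>)"
    using int assms(3) AE by (intro integral_mono_AE) auto
  finally show "\<bar>LINT x|M. f x * g x\<bar> \<le> B * (LINT x|M. \<bar>g x\<bar>)" by simp
qed

lemma integrable_mult_bounded:
  fixes f g :: "'a \<Rightarrow> real"
  assumes "f \<in> borel_measurable M" "AE x in M. \<bar>f x\<bar> \<le> B" "integrable M g"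
  shows "integrable M (\<lambda>x. f x * g x)"
  by (rule integrable_mult_bounded_on[OF assms(1) _ assms(3), of B])
    (use assms(2) in eventually_elim, simp)

text \<open>Discrete integration by parts: a translation moves the difference quotient from
  \<open>u\<close> to \<open>\<phi>\<close>, where it converges by smoothness. As \<open>u\<close>
  is merely bounded and measurable, this applies to a glued function before its weak gradient is
  known.\<close>

lemma integral_diff_quotient_tendsto:
  fixes u \<phi> :: "'a::euclidean_space \<Rightarrow> real"
  assumes u: "u \<in> borel_measurable lebesgue" "\<And>x. \<bar>u x\<bar> \<le> B"
    and \<phi>: "test_function U \<phi>" and b: "b \<in> Basis"
    and h: "h \<longlonglongrightarrow> 0" "\<And>n. h n \<noteq> 0"
  shows "(\<lambda>n. LINT x|lebesgue. (u (x + h n *\<^sub>R b) - u x) / h n * \<phi> x)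
           \<longlonglongrightarrow> - (LINT x|lebesgue. u x * frechet_derivative \<phi> (at x) b)"
proof -
  note [measurable] = u(1) test_function_measurable[OF \<phi>]
    test_function_measurable[OF test_function_partial[OF \<phi> b]]
    borel_measurable_lebesgue_translation[OF u(1)]
    borel_measurable_lebesgue_translation[OF test_function_measurable[OF \<phi>]]
  have [measurable]: "(\<lambda>x. x - a) \<in> lebesgue \<rightarrow>\<^sub>M lebesgue" for a :: 'a
    using measurable_lebesgue_translation[of "- a"] by simp
  have eq: "(LINT x|lebesgue. (u (x + s *\<^sub>R b) - u x) / s * \<phi> x) =
      (LINT x|lebesgue. u x * ((\<phi> (x + - s *\<^sub>R b) - \<phi> x) / s))" if "s \<noteq> 0" for s :: real
  proof -
    have i1: "integrable lebesgue (\<lambda>x. u (x + s *\<^sub>R b) * \<phi> x)" "integrable lebesgue (\<lambda>x. u x * \<phi> x)"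
      using u(2) test_function_integrable[OF \<phi>]
      by (auto intro!: integrable_mult_bounded[of _ _ B])
    have i2: "integrable lebesgue (\<lambda>x. u x * \<phi> (x + - s *\<^sub>R b))"
      using u(2) test_function_integrable[OF \<phi>]
        integrable_lebesgue_translation[OF test_function_measurable[OF \<phi>], of "- s *\<^sub>R b"]
      by (auto intro!: integrable_mult_bounded[of _ _ B] simp del: scaleR_minus_left)
    have "(LINT x|lebesgue. u (x + s *\<^sub>R b) * \<phi> x) = (LINT x|lebesgue. u x * \<phi> (x + - s *\<^sub>R b))"
      using integral_lebesgue_translation[OF borel_measurable_integrable[OF i2], of "s *\<^sub>R b"] by simp
    then have "(LINT x|lebesgue. u (x + s *\<^sub>R b) * \<phi> x - u x * \<phi> x) / s =
        (LINT x|lebesgue. u x * \<phi> (x + - s *\<^sub>R b) - u x * \<phi> x) / s"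
      using i1 i2 by simp
    then show ?thesis
      by (simp only: integral_divide_zero[symmetric])
        (simp add: algebra_simps diff_divide_distrib)
  qed
  obtain M where M: "M > 0" "\<And>x. \<bar>frechet_derivative \<phi> (at x) b\<bar> \<le> M"
    using test_function_bounded[OF test_function_partial[OF \<phi> b]] by metis
  obtain R where R: "\<And>n. \<bar>h n\<bar> \<le> R" "R > 0"
    by (metis Bseq_def convergentI convergent_imp_Bseq h(1) real_norm_def)
  obtain r where r: "\<And>x. \<phi> x \<noteq> 0 \<Longrightarrow> norm x \<le> r"
  proof -
    have "bounded {x. \<phi> x \<noteq> 0}"
      using \<phi> bounded_subset[OF compact_imp_bounded closure_subset]
      by (auto simp: test_function_def)
    then show thesis using that by (auto simp: bounded_iff)
  qed
  have "(\<lambda>n. LINT x|lebesgue. u x * ((\<phi> (x + - h n *\<^sub>R b) - \<phi> x) / h n))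
      \<longlonglongrightarrow> (LINT x|lebesgue. u x * (- frechet_derivative \<phi> (at x) b))"
  proof (rule integral_dominated_convergence)
    \<comment> \<open>All shifts have length at most \<open>R\<close> and \<open>\<phi>\<close>
      lives in the ball of radius \<open>r\<close>, so beyond radius \<open>r + R\<close> both terms
      of the quotient vanish.\<close>
    show "integrable lebesgue (\<lambda>x::'a. B * M * indicator (cball 0 (r + R)) x)"
      by (intro integrable_mult_right integrable_real_indicator)
        (use emeasure_bounded_finite[of "cball (0::'a) (r + R)"] in auto)
    show "AE x in lebesgue. norm (u x * ((\<phi> (x + - h n *\<^sub>R b) - \<phi> x) / h n))
        \<le> B * M * indicator (cball 0 (r + R)) x" for n
    proof (rule AE_I2)
      fix x
      show "norm (u x * ((\<phi> (x + - h n *\<^sub>R b) - \<phi> x) / h n)) \<le> B * M * indicator (cball 0 (r + R)) x"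
      proof (cases "norm x \<le> r + R")
        case True
        have "\<bar>(\<phi> (x + - h n *\<^sub>R b) - \<phi> x) / h n\<bar> \<le> M"
          using test_function_diff_quotient_bound[OF \<phi> M(2), of x "- h n"] h(2)[of n]
          by (simp add: abs_divide divide_le_eq)
        then have "\<bar>u x\<bar> * \<bar>(\<phi> (x + - h n *\<^sub>R b) - \<phi> x) / h n\<bar> \<le> B * M"
          using u(2)[of x] by (intro mult_mono) auto
        then show ?thesis using True by (simp add: abs_mult)
      next
        case False
        have "norm x \<le> norm (x + - h n *\<^sub>R b) + norm (h n *\<^sub>R b)"
          using norm_triangle_ineq[of "x + - h n *\<^sub>R b" "h n *\<^sub>R b"] by simp
        then have "norm x \<le> norm (x + - h n *\<^sub>R b) + R"
          using R(1)[of n] b by simp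
        then have "\<phi> (x + - h n *\<^sub>R b) = 0" "\<phi> x = 0"
          using False r[of x] r[of "x + - h n *\<^sub>R b"] R(2) by force+
        then show ?thesis using u(2)[of x] M(1) by (auto simp: indicator_def)
      qed
    qed
    show "AE x in lebesgue. (\<lambda>n. u x * ((\<phi> (x + - h n *\<^sub>R b) - \<phi> x) / h n))
        \<longlonglongrightarrow> u x * (- frechet_derivative \<phi> (at x) b)"
    proof (rule AE_I2)
      fix x
      have "((\<lambda>t. (\<phi> (x + t *\<^sub>R b) - \<phi> x) / t) \<longlongrightarrow> frechet_derivative \<phi> (at x) b) (at 0)"
        using test_function_has_field_derivative[OF \<phi>, of x b 0] by (simp add: DERIV_def)
      \<comment> \<open>The shift was transferred with the opposite sign, so the quotients run along
        \<open>- h n\<close>; this is the origin of the minus sign in the limit.\<close>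
      moreover have "filterlim (\<lambda>n. - h n) (at 0) sequentially"
        using h tendsto_minus[OF h(1)] by (auto simp: filterlim_at)
      ultimately have "(\<lambda>n. (\<phi> (x + - h n *\<^sub>R b) - \<phi> x) / - h n) \<longlonglongrightarrow> frechet_derivative \<phi> (at x) b"
        by (rule filterlim_compose)
      from tendsto_mult[OF tendsto_const[of "- u x"] this]
      show "(\<lambda>n. u x * ((\<phi> (x + - h n *\<^sub>R b) - \<phi> x) / h n))
        \<longlonglongrightarrow> u x * (- frechet_derivative \<phi> (at x) b)" by simp
    qed
  qed (measurable, simp_all)
  then show ?thesis unfolding eq[OF h(2)] mult_minus_right integral_minus .
qed


subsection \<open>Density of test functions\<close>

lemma test_functionI:
  assumes "\<And>k. C_k k \<phi>" "\<And>x. \<phi> x \<noteq> 0 \<Longrightarrow> x \<in> S" "compact S" "S \<subseteq> U"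
  shows "test_function U \<phi>"
proof -
  have "closure {x. \<phi> x \<noteq> 0} \<subseteq> S"
    using assms(2,3) by (intro closure_minimal compact_imp_closed) auto
  then show ?thesis
    using assms bounded_subset[OF compact_imp_bounded[OF assms(3)]]
    by (auto simp: test_function_def compact_eq_bounded_closed)
qed

definition test_approximable :: "'a::euclidean_space set \<Rightarrow> ('a \<Rightarrow> real) \<Rightarrow> bool" where
  "test_approximable U h \<longleftrightarrow> integrable lebesgue h \<and>
     (\<forall>e>0. \<exists>\<phi>. test_function U \<phi> \<and> (LINT x|lebesgue. \<bar>h x - \<phi> x\<bar>) < e)"

lemma L1_triangle:
  fixes f g h :: "'a::euclidean_space \<Rightarrow> real"
  assumes "integrable M f" "integrable M g" "integrable M h"
  shows "(LINT x|M. \<bar>f x - h x\<bar>) \<le> (LINT x|M. \<bar>f x - g x\<bar>) + (LINT x|M. \<bar>g x - h x\<bar>)"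
proof -
  have "(LINT x|M. \<bar>f x - h x\<bar>) \<le> (LINT x|M. \<bar>f x - g x\<bar> + \<bar>g x - h x\<bar>)"
    using assms by (intro integral_mono) auto
  then show ?thesis using assms by simp
qed

lemma test_approximable_limit:
  assumes "integrable lebesgue h"
    and "\<And>e. e > 0 \<Longrightarrow> \<exists>k. test_approximable U k \<and> (LINT x|lebesgue. \<bar>h x - k x\<bar>) < e"
  shows "test_approximable U h"
  unfolding test_approximable_def
proof (intro conjI allI impI assms(1))
  fix e :: real assume "e > 0"
  then obtain k where k: "test_approximable U k" "(LINT x|lebesgue. \<bar>h x - k x\<bar>) < e / 2"
    using assms(2)[of "e / 2"] by auto
  then obtain \<phi> where \<phi>: "test_function U \<phi>" "(LINT x|lebesgue. \<bar>k x - \<phi> x\<bar>) < e / 2"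
    using \<open>e > 0\<close> half_gt_zero unfolding test_approximable_def by blast
  have "(LINT x|lebesgue. \<bar>h x - \<phi> x\<bar>) < e"
    using L1_triangle[OF assms(1), of k \<phi>] k \<phi> test_function_integrable[OF \<phi>(1)]
    by (auto simp: test_approximable_def)
  then show "\<exists>\<phi>. test_function U \<phi> \<and> (LINT x|lebesgue. \<bar>h x - \<phi> x\<bar>) < e" using \<phi>(1) by blast
qed

lemma test_function_add:
  fixes \<phi> \<psi> :: "'a::euclidean_space \<Rightarrow> real"
  assumes "test_function U \<phi>" "test_function U \<psi>"
  shows "test_function U (\<lambda>x. \<phi> x + \<psi> x)"
proof -
  have sub: "{x. f x \<noteq> 0} \<subseteq> closure {x. f x \<noteq> 0}" for f :: "'a \<Rightarrow> real"
    by (rule closure_subset)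
  show ?thesis
  proof (rule test_functionI[of _ "closure {x. \<phi> x \<noteq> 0} \<union> closure {x. \<psi> x \<noteq> 0}"])
    fix x assume "\<phi> x + \<psi> x \<noteq> 0"
    then have "\<phi> x \<noteq> 0 \<or> \<psi> x \<noteq> 0" by auto
    then show "x \<in> closure {x. \<phi> x \<noteq> 0} \<union> closure {x. \<psi> x \<noteq> 0}"
      using sub[of \<phi>] sub[of \<psi>] by blast
  qed (use assms in \<open>auto simp: test_function_def intro!: C_k_add compact_Un\<close>)
qed

lemma test_function_cmult:
  assumes "test_function U \<phi>"
  shows "test_function U (\<lambda>x. c * \<phi> x)"
proof -
  have "{x. \<phi> x \<noteq> 0} \<subseteq> closure {x. \<phi> x \<noteq> 0}" by (rule closure_subset)
  then show ?thesis
    by (intro test_functionI[of _ "closure {x. \<phi> x \<noteq> 0}"])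
      (use assms in \<open>auto simp: test_function_def intro!: C_k_mult[OF C_k_const]\<close>)
qed

lemma test_approximable_add:
  assumes "test_approximable U f" "test_approximable U g"
  shows "test_approximable U (\<lambda>x. f x + g x)"
  unfolding test_approximable_def
proof (intro conjI allI impI)
  show "integrable lebesgue (\<lambda>x. f x + g x)" using assms by (auto simp: test_approximable_def)
  fix e :: real assume "e > 0"
  then obtain \<phi> \<psi> where \<phi>: "test_function U \<phi>" "(LINT x|lebesgue. \<bar>f x - \<phi> x\<bar>) < e / 2"
    and \<psi>: "test_function U \<psi>" "(LINT x|lebesgue. \<bar>g x - \<psi> x\<bar>) < e / 2"
    using assms half_gt_zero unfolding test_approximable_def by meson
  have i: "integrable lebesgue f" "integrable lebesgue g" "integrable lebesgue \<phi>" "integrable lebesgue \<psi>"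
    using assms \<phi> \<psi> test_function_integrable by (auto simp: test_approximable_def)
  have "(LINT x|lebesgue. \<bar>f x + g x - (\<phi> x + \<psi> x)\<bar>) \<le>
      (LINT x|lebesgue. \<bar>f x - \<phi> x\<bar> + \<bar>g x - \<psi> x\<bar>)"
    using i by (intro integral_mono) auto
  then have "(LINT x|lebesgue. \<bar>f x + g x - (\<phi> x + \<psi> x)\<bar>) < e" using \<phi> \<psi> i by simp
  then show "\<exists>\<phi>. test_function U \<phi> \<and> (LINT x|lebesgue. \<bar>f x + g x - \<phi> x\<bar>) < e"
    using test_function_add[OF \<phi>(1) \<psi>(1)] by blast
qed

lemma test_approximable_cmult:
  assumes "test_approximable U f"
  shows "test_approximable U (\<lambda>x. c * f x)"
  unfolding test_approximable_def
proof (intro conjI allI impI)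
  show "integrable lebesgue (\<lambda>x. c * f x)" using assms by (auto simp: test_approximable_def)
  fix e :: real assume "e > 0"
  then have "e / (\<bar>c\<bar> + 1) > 0" by simp
  then obtain \<phi> where \<phi>: "test_function U \<phi>" "(LINT x|lebesgue. \<bar>f x - \<phi> x\<bar>) < e / (\<bar>c\<bar> + 1)"
    using assms unfolding test_approximable_def by meson
  have "(LINT x|lebesgue. \<bar>c * f x - c * \<phi> x\<bar>) = \<bar>c\<bar> * (LINT x|lebesgue. \<bar>f x - \<phi> x\<bar>)"
    by (simp add: abs_mult flip: right_diff_distrib)
  also have "\<dots> \<le> (\<bar>c\<bar> + 1) * (LINT x|lebesgue. \<bar>f x - \<phi> x\<bar>)"
    by (intro mult_right_mono) auto
  also have "\<dots> < e" using \<phi>(2) by (simp add: field_simps add_nonneg_pos)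
  finally show "\<exists>\<phi>. test_function U \<phi> \<and> (LINT x|lebesgue. \<bar>c * f x - \<phi> x\<bar>) < e"
    using test_function_cmult[OF \<phi>(1)] by blast
qed

text \<open>If \<open>P\<close> is a product of \<open>1 - bump\<close>, then \<open>1 - P ^ n\<close> are test functions that increase to the
  indicator of the union of the balls.\<close>

lemma test_approximable_balls:
  fixes a :: "'i \<Rightarrow> 'a::euclidean_space"
  assumes fin: "finite I" and r: "\<And>i. i \<in> I \<Longrightarrow> r i > 0" and sub: "\<And>i. i \<in> I \<Longrightarrow> cball (a i) (r i) \<subseteq> U"
  shows "test_approximable U (indicator (\<Union>i\<in>I. ball (a i) (r i)))"
proof -
  let ?W = "\<Union>i\<in>I. ball (a i) (r i)"
  define P where "P x = (\<Prod>i\<in>I. 1 - bump (a i) (r i) x)" for x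
  define \<phi> where "\<phi> n x = 1 - P x ^ n" for n x
  have bump01: "0 \<le> bump c s x" "bump c s x \<le> 1" for c :: 'a and s x
    using bump_bounds[of c s x] by auto
  have P1: "P x = 1" if "x \<notin> ?W" for x
  proof -
    have "bump (a i) (r i) x = 0" if "i \<in> I" for i
      using bump_bounds(1)[of "a i" "r i" x] bump_pos_iff[OF r[OF that], of "a i" x] that \<open>x \<notin> ?W\<close>
      by force
    then show ?thesis by (simp add: P_def)
  qed
  have P0: "0 \<le> P x" "P x \<le> 1" for x
    unfolding P_def by (auto intro!: prod_nonneg prod_le_1 simp: bump01)
  have Plt: "P x < 1" if x: "x \<in> ?W" for x
  proof -
    obtain i where i: "i \<in> I" "x \<in> ball (a i) (r i)" using x by auto
    have "P x = (1 - bump (a i) (r i) x) * (\<Prod>i\<in>I - {i}. 1 - bump (a i) (r i) x)"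
      unfolding P_def using fin i(1) by (simp add: prod.remove)
    also have "\<dots> \<le> (1 - bump (a i) (r i) x) * 1"
      by (intro mult_left_mono prod_le_1) (auto simp: bump01)
    finally have le: "P x \<le> 1 - bump (a i) (r i) x" by simp
    have "0 < bump (a i) (r i) x" using bump_pos_iff[OF r[OF i(1)], THEN iffD2, OF i(2)] .
    then have "1 - bump (a i) (r i) x < 1" by simp
    then show "P x < 1" using le by simp
  qed
  have C: "C_k k (\<phi> n)" for k n
    unfolding \<phi>_def[abs_def] P_def by (intro C_k_diff C_k_const C_k_power C_k_prod C_k_bump)
  have comp: "compact (\<Union>i\<in>I. cball (a i) (r i))" using fin by (intro compact_UN) auto
  have test: "test_function U (\<phi> n)" for n
  proof (rule test_functionI[OF C _ comp])
    fix x assume "\<phi> n x \<noteq> 0"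
    then have "x \<in> ?W" using P1[of x] by (cases "x \<in> ?W") (auto simp: \<phi>_def)
    then show "x \<in> (\<Union>i\<in>I. cball (a i) (r i))" using ball_subset_cball by blast
  qed (use sub in blast)
  have [measurable]: "\<phi> n \<in> borel_measurable lebesgue" for n
    using test_function_measurable[OF test] .
  have "open ?W" by auto
  then have W[measurable]: "?W \<in> sets lebesgue" by (intro sets_completionI_sets) auto
  have "?W \<in> lmeasurable"
    using bounded_subset[OF compact_imp_bounded[OF comp], of ?W] ball_subset_cball
    by (intro lmeasurable_open) (auto simp: subset_iff)
  then have intW: "integrable lebesgue (indicator ?W :: _ \<Rightarrow> real)"
    using W by (intro integrable_real_indicator) (auto simp: fmeasurable_def)
  have "(\<lambda>n. LINT x|lebesgue. \<bar>indicator ?W x - \<phi> n x\<bar>) \<longlonglongrightarrow> (LINT x::'a|lebesgue. 0)"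
  proof (rule integral_dominated_convergence[where w="indicator ?W"])
    show "AE x in lebesgue. norm \<bar>indicator ?W x - \<phi> n x\<bar> \<le> indicator ?W x" for n
      by (rule AE_I2) (use P1 P0 in \<open>auto simp: \<phi>_def indicator_def power_le_one\<close>)
    show "AE x in lebesgue. (\<lambda>n. \<bar>indicator ?W x - \<phi> n x\<bar>) \<longlonglongrightarrow> 0"
    proof (rule AE_I2)
      fix x
      show "(\<lambda>n. \<bar>indicator ?W x - \<phi> n x\<bar>) \<longlonglongrightarrow> 0"
      proof (cases "x \<in> ?W")
        case True
        then have "(\<lambda>n. P x ^ n) \<longlonglongrightarrow> 0" using P0 Plt by (intro LIMSEQ_realpow_zero) auto
        then show ?thesis using True P0(1)[of x] by (simp add: \<phi>_def)
      qed (simp add: \<phi>_def P1)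
    qed
  qed (use intW in \<open>simp_all, measurable\<close>)
  then have lim: "(\<lambda>n. LINT x|lebesgue. \<bar>indicator ?W x - \<phi> n x\<bar>) \<longlonglongrightarrow> 0" by simp
  show ?thesis
    unfolding test_approximable_def
  proof (intro conjI allI impI intW)
    fix e :: real assume "e > 0"
    then have "\<exists>n. (LINT x|lebesgue. \<bar>indicator ?W x - \<phi> n x\<bar>) < e"
      using order_tendstoD(2)[OF lim] eventually_happens by force
    then show "\<exists>\<phi>. test_function U \<phi> \<and> (LINT x|lebesgue. \<bar>indicator ?W x - \<phi> x\<bar>) < e"
      using test by blast
  qed
qed

lemma L1_dist_indicator:
  assumes "A \<subseteq> B" "A \<in> lmeasurable" "B \<in> lmeasurable"
  shows "(LINT x|lebesgue. \<bar>indicator B x - indicator A x\<bar>) = measure lebesgue (B - A)"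
    "(LINT x|lebesgue. \<bar>indicator A x - indicator B x\<bar>) = measure lebesgue (B - A)"
proof -
  have "(\<lambda>x. \<bar>indicator B x - indicator A x\<bar>) = (indicator (B - A) :: _ \<Rightarrow> real)"
    "(\<lambda>x. \<bar>indicator A x - indicator B x\<bar>) = (indicator (B - A) :: _ \<Rightarrow> real)"
    using assms(1) by (auto simp: indicator_def fun_eq_iff)
  then show "(LINT x|lebesgue. \<bar>indicator B x - indicator A x\<bar>) = measure lebesgue (B - A)"
    "(LINT x|lebesgue. \<bar>indicator A x - indicator B x\<bar>) = measure lebesgue (B - A)" by simp_all
qed

text \<open>Compact sets exhaust \<open>V\<close> in measure; covering one of them by finitely many
  balls whose closures stay in \<open>V\<close> squeezes a finite union of balls between it and
  \<open>V\<close>.\<close>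

lemma test_approximable_open:
  fixes V :: "'a::euclidean_space set"
  assumes V: "open V" "V \<subseteq> U" "V \<in> lmeasurable"
  shows "test_approximable U (indicator V)"
proof (rule test_approximable_limit)
  show "integrable lebesgue (indicator V :: _ \<Rightarrow> real)"
    using V(3) by (intro integrable_real_indicator) (auto simp: fmeasurable_def)
  fix e :: real assume "e > 0"
  obtain C :: "nat \<Rightarrow> 'a set" where C: "\<And>n. compact (C n)" "\<And>n. C n \<subseteq> V"
    "\<And>n. C n \<subseteq> interior (C (Suc n))" "\<Union>(range C) = V"
    using open_Union_compact_subsets[OF V(1)] by metis
  have Cm: "C n \<in> lmeasurable" for n using C(1) lmeasurable_compact by blast
  have "incseq C" using C(3) interior_subset by (intro incseq_SucI) blast
  then have "(\<lambda>n. measure lebesgue (C n)) \<longlonglongrightarrow> measure lebesgue (\<Union>(range C))"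
    using Cm V(3) C(4) by (intro Lim_measure_incseq) (auto simp: fmeasurable_def)
  then have "\<forall>\<^sub>F n in sequentially. measure lebesgue V - e < measure lebesgue (C n)"
    using C(4) \<open>e > 0\<close> by (intro order_tendstoD(1)) auto
  then obtain n where n: "measure lebesgue V - e < measure lebesgue (C n)"
    using eventually_happens trivial_limit_sequentially by blast
  have "\<exists>r>0. cball x r \<subseteq> V" if "x \<in> C n" for x
    using C(2) V(1) that open_contains_cball by blast
  then obtain r where r: "\<And>x. x \<in> C n \<Longrightarrow> r x > 0 \<and> cball x (r x) \<subseteq> V" by metis
  have "C n \<subseteq> (\<Union>x\<in>C n. ball x (r x))" using r by force
  then obtain I where I: "I \<subseteq> C n" "finite I" "C n \<subseteq> (\<Union>x\<in>I. ball x (r x))"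
    using compactE_image[OF C(1)[of n], of "C n" "\<lambda>x. ball x (r x)"] by auto
  let ?W = "\<Union>x\<in>I. ball x (r x)"
  have app: "test_approximable U (indicator ?W)"
    using r I V(2) by (intro test_approximable_balls) blast+
  have WV: "?W \<subseteq> V" using r I ball_subset_cball by blast
  have "open ?W" by auto
  then have "?W \<in> sets lebesgue" by (intro sets_completionI_sets) auto
  then have W: "?W \<in> lmeasurable" by (rule fmeasurableI2[OF V(3) WV])
  have "measure lebesgue (C n) \<le> measure lebesgue ?W"
    using I(3) W Cm by (intro measure_mono_fmeasurable) (auto simp: fmeasurable_def)
  then have "measure lebesgue (V - ?W) < e"
    using n measurable_measure_Diff[OF V(3) _ WV] W by (auto simp: fmeasurable_def)
  then have "(LINT x|lebesgue. \<bar>indicator V x - indicator ?W x\<bar>) < e"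
    using L1_dist_indicator(1)[OF WV W V(3)] by simp
  then show "\<exists>k. test_approximable U k \<and> (LINT x|lebesgue. \<bar>indicator V x - k x\<bar>) < e"
    using app by blast
qed

text \<open>Outer regularity gives an open superset of nearly the same measure; intersecting it with
  \<open>U\<close> keeps the approximating test functions supported in \<open>U\<close>.\<close>

lemma test_approximable_indicator:
  assumes U: "open U" "A \<subseteq> U" "A \<in> lmeasurable"
  shows "test_approximable U (indicator A)"
proof (rule test_approximable_limit)
  show "integrable lebesgue (indicator A :: _ \<Rightarrow> real)"
    using U(3) by (intro integrable_real_indicator) (auto simp: fmeasurable_def)
  fix e :: real assume "e > 0"
  then obtain T where T: "open T" "A \<subseteq> T" "T - A \<in> lmeasurable"
    "emeasure lebesgue (T - A) < ennreal e"
    using sets_lebesgue_outer_open[of A e] U(3) by (auto simp: fmeasurable_def)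
  let ?V = "T \<inter> U"
  have "T = (T - A) \<union> A" using T(2) by blast
  then have Tm: "T \<in> lmeasurable" using T(3) U(3) fmeasurable.Un by metis
  have V: "open ?V" "?V \<subseteq> U" "A \<subseteq> ?V" using T U by auto
  have Vm: "?V \<in> lmeasurable"
    by (rule fmeasurableI2[OF Tm]) (use V in \<open>auto intro!: borel_open sets_completionI_sets\<close>)
  have "?V - A \<subseteq> T - A" by auto
  then have "measure lebesgue (?V - A) \<le> measure lebesgue (T - A)"
    using T(3) Vm U(3) by (intro measure_mono_fmeasurable) (auto simp: fmeasurable_def)
  also have "\<dots> < e"
    using T(3,4) \<open>e > 0\<close> by (simp add: emeasure_eq_measure2 ennreal_less_iff)
  finally have "(LINT x|lebesgue. \<bar>indicator A x - indicator ?V x\<bar>) < e"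
    using L1_dist_indicator(2)[OF V(3) U(3) Vm] by simp
  then show "\<exists>k. test_approximable U k \<and> (LINT x|lebesgue. \<bar>indicator A x - k x\<bar>) < e"
    using test_approximable_open[OF V(1,2) Vm] by blast
qed

text \<open>Induction over integrable functions: indicators, sums, dominated limits. The factor
  \<open>indicator U\<close> is built into the statement because the functions met on the way need
  not vanish off \<open>U\<close>.\<close>

lemma test_approximable_restrict:
  fixes h :: "'a::euclidean_space \<Rightarrow> real"
  assumes U: "open U" and h: "integrable lebesgue h"
  shows "test_approximable U (\<lambda>x. indicator U x * h x)"
  using h
proof induction
  case (base A c)
  have "U \<in> sets lebesgue" using U by (intro borel_open sets_completionI_sets) auto
  then have "A \<inter> U \<in> lmeasurable"
    using base by (intro fmeasurable_Int_fmeasurable fmeasurableI) auto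
  from test_approximable_cmult[OF test_approximable_indicator[OF U _ this], of c]
  show ?case by (simp add: indicator_inter_arith mult_ac)
next
  case (add f g)
  then show ?case using test_approximable_add by (auto simp: distrib_left)
next
  case (lim f s)
  have [measurable]: "U \<in> sets lebesgue" using U by (intro borel_open sets_completionI_sets) auto
  have int: "integrable lebesgue (\<lambda>x. indicator U x * f x)"
    using lim.hyps(4) by (intro integrable_mult_bounded[of _ _ 1] borel_measurable_indicator) auto
  have [measurable]: "s i \<in> borel_measurable lebesgue" "f \<in> borel_measurable lebesgue" for i
    using lim by auto
  have "(\<lambda>i. LINT x|lebesgue. \<bar>indicator U x * f x - indicator U x * s i x\<bar>) \<longlonglongrightarrow> (LINT x::'a|lebesgue. 0)"
  \<comment> \<open>The approximating sequence satisfies \<open>|s i x| \<le> 2 * |f x|\<close>,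
    whence the factor 3.\<close>
  proof (rule integral_dominated_convergence[where w="\<lambda>x. 3 * \<bar>f x\<bar>"])
    show "AE x in lebesgue. norm \<bar>indicator U x * f x - indicator U x * s i x\<bar> \<le> 3 * \<bar>f x\<bar>" for i
    proof (rule AE_I2)
      fix x show "norm \<bar>indicator U x * f x - indicator U x * s i x\<bar> \<le> 3 * \<bar>f x\<bar>"
        using lim.hyps(3)[of x i] by (auto simp: indicator_def)
    qed
    show "AE x in lebesgue. (\<lambda>i. \<bar>indicator U x * f x - indicator U x * s i x\<bar>) \<longlonglongrightarrow> 0"
    proof (rule AE_I2)
      fix x :: 'a
      have "(\<lambda>i. \<bar>indicator U x * f x - indicator U x * s i x\<bar>) \<longlonglongrightarrow>
          \<bar>indicator U x * f x - indicator U x * f x\<bar>"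
        using lim.hyps(2)[of x] by (intro tendsto_intros) auto
      then show "(\<lambda>i. \<bar>indicator U x * f x - indicator U x * s i x\<bar>) \<longlonglongrightarrow> 0" by simp
    qed
  qed (use lim.hyps(4) in \<open>simp_all, measurable\<close>)
  then have lim': "(\<lambda>i. LINT x|lebesgue. \<bar>indicator U x * f x - indicator U x * s i x\<bar>) \<longlonglongrightarrow> 0" by simp
  show ?case
  proof (rule test_approximable_limit[OF int])
    fix e :: real assume "e > 0"
    then have "\<exists>i. (LINT x|lebesgue. \<bar>indicator U x * f x - indicator U x * s i x\<bar>) < e"
      using order_tendstoD(2)[OF lim'] eventually_happens by force
    then show "\<exists>k. test_approximable U k \<and> (LINT x|lebesgue. \<bar>indicator U x * f x - k x\<bar>) < e"
      using lim.IH by blast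
  qed
qed

lemma test_functions_dense:
  fixes h :: "'a::euclidean_space \<Rightarrow> real"
  assumes "open U" "integrable lebesgue h" "\<And>x. x \<notin> U \<Longrightarrow> h x = 0" "e > 0"
  obtains \<phi> where "test_function U \<phi>" "(LINT x|lebesgue. \<bar>h x - \<phi> x\<bar>) < e"
proof -
  have "(\<lambda>x. indicator U x * h x) = h" using assms(3) by (auto simp: indicator_def fun_eq_iff)
  then show thesis
    using test_approximable_restrict[OF assms(1,2)] assms(4) that
    unfolding test_approximable_def by metis
qed

section \<open>Pairings of bounded functions with test functions\<close>

lemma integral_lebesgue_on_eq:
  fixes f :: "'a::euclidean_space \<Rightarrow> real"
  assumes "S \<in> sets lebesgue" "\<And>x. x \<notin> S \<Longrightarrow> f x = 0"
  shows "(LINT x|lebesgue_on S. f x) = (LINT x|lebesgue. f x)"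
proof -
  have "(\<lambda>x. if x \<in> S then f x else 0) = f" using assms(2) by auto
  then show ?thesis using Lebesgue_Measure.integral_restrict_UNIV[OF assms(1), of f] by simp
qed

text \<open>\<open>M\<close> may be much larger than \<open>C\<close>: it controls the pairing with
  the small error \<open>\<psi> - \<phi>\<close> and disappears in the limit.\<close>

lemma test_pairing_bound_extends:
  fixes k \<psi> :: "'a::euclidean_space \<Rightarrow> real"
  assumes U: "open U" and k: "k \<in> borel_measurable lebesgue" "AE x in lebesgue. x \<in> U \<longrightarrow> \<bar>k x\<bar> \<le> M"
    and test: "\<And>\<phi>. test_function U \<phi> \<Longrightarrow> \<bar>LINT x|lebesgue. k x * \<phi> x\<bar> \<le> C * (LINT x|lebesgue. \<bar>\<phi> x\<bar>)"
    and \<psi>: "integrable lebesgue \<psi>" "\<And>x. x \<notin> U \<Longrightarrow> \<psi> x = 0" and "C \<ge> 0" "M \<ge> 0"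
  shows "\<bar>LINT x|lebesgue. k x * \<psi> x\<bar> \<le> C * (LINT x|lebesgue. \<bar>\<psi> x\<bar>)"
proof (rule field_le_epsilon)
  fix e :: real assume "e > 0"
  \<comment> \<open>The total error is \<open>M + C\<close> times the \<open>L^1\<close> distance;
    the summand 1 keeps the divisor positive.\<close>
  then have "e / (M + C + 1) > 0" using \<open>C \<ge> 0\<close> \<open>M \<ge> 0\<close> by (simp add: add_nonneg_pos)
  from test_functions_dense[OF U \<psi> this] obtain \<phi>
    where \<phi>: "test_function U \<phi>" "(LINT x|lebesgue. \<bar>\<psi> x - \<phi> x\<bar>) < e / (M + C + 1)" by blast
  let ?d = "LINT x|lebesgue. \<bar>\<psi> x - \<phi> x\<bar>"
  note i\<phi> = test_function_integrable[OF \<phi>(1)]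
  have AE: "AE x in lebesgue. f x \<noteq> 0 \<longrightarrow> \<bar>k x\<bar> \<le> M" if "\<And>x. x \<notin> U \<Longrightarrow> f x = 0" for f :: "'a \<Rightarrow> real"
    using k(2) by eventually_elim (use that in blast)
  have ik: "integrable lebesgue (\<lambda>x. k x * \<psi> x)" "integrable lebesgue (\<lambda>x. k x * \<phi> x)"
    by (rule integrable_mult_bounded_on[OF k(1) AE];
        use \<psi> i\<phi> test_function_eq_0[OF \<phi>(1)] in blast)+
  have "(LINT x|lebesgue. k x * \<psi> x) = (LINT x|lebesgue. k x * (\<psi> x - \<phi> x)) + (LINT x|lebesgue. k x * \<phi> x)"
    using ik by (simp add: right_diff_distrib)
  moreover have "\<bar>LINT x|lebesgue. k x * (\<psi> x - \<phi> x)\<bar> \<le> M * ?d"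
    using \<psi> i\<phi> test_function_eq_0[OF \<phi>(1)]
    by (intro integral_mult_bounded_on[OF k(1) AE]) auto
  ultimately have "\<bar>LINT x|lebesgue. k x * \<psi> x\<bar> \<le> M * ?d + C * (LINT x|lebesgue. \<bar>\<phi> x\<bar>)"
    using test[OF \<phi>(1)] by linarith
  moreover have "(LINT x|lebesgue. \<bar>\<phi> x\<bar>) \<le> ?d + (LINT x|lebesgue. \<bar>\<psi> x\<bar>)"
  proof -
    have "(LINT x|lebesgue. \<bar>\<phi> x\<bar>) \<le> (LINT x|lebesgue. \<bar>\<psi> x - \<phi> x\<bar> + \<bar>\<psi> x\<bar>)"
      using \<psi> i\<phi> by (intro integral_mono) auto
    then show ?thesis using \<psi> i\<phi> by simp
  qed
  then have "C * (LINT x|lebesgue. \<bar>\<phi> x\<bar>) \<le> C * ?d + C * (LINT x|lebesgue. \<bar>\<psi> x\<bar>)"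
    using mult_left_mono[OF _ \<open>C \<ge> 0\<close>] by (simp add: distrib_left[symmetric])
  moreover have "M * ?d + C * ?d \<le> e"
  proof -
    have "(M + C) * ?d \<le> (M + C + 1) * ?d" by (intro mult_right_mono) auto
    also have "\<dots> \<le> e" using \<phi>(2) \<open>C \<ge> 0\<close> \<open>M \<ge> 0\<close> by (simp add: field_simps add_nonneg_pos)
    finally show ?thesis by (simp add: distrib_right)
  qed
  ultimately show "\<bar>LINT x|lebesgue. k x * \<psi> x\<bar> \<le> C * (LINT x|lebesgue. \<bar>\<psi> x\<bar>) + e" by linarith
qed

text \<open>Converse Hoelder inequality. Pairing with \<open>sgn k\<close> on the set
  \<open>S\<close> where \<open>|k| > C\<close> makes the integral of \<open>|k| - C\<close> over
  \<open>S\<close> at most 0, so \<open>S\<close> is null. The finite measure of \<open>U\<close>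
  makes \<open>sgn k\<close> integrable on \<open>S\<close>.\<close>

lemma AE_bound_of_test_pairing:
  fixes k :: "'a::euclidean_space \<Rightarrow> real"
  assumes U: "open U" "U \<in> lmeasurable"
    and k: "k \<in> borel_measurable lebesgue" "AE x in lebesgue. x \<in> U \<longrightarrow> \<bar>k x\<bar> \<le> M"
    and test: "\<And>\<phi>. test_function U \<phi> \<Longrightarrow> \<bar>LINT x|lebesgue. k x * \<phi> x\<bar> \<le> C * (LINT x|lebesgue. \<bar>\<phi> x\<bar>)"
    and "C \<ge> 0" "M \<ge> 0"
  shows "AE x in lebesgue. x \<in> U \<longrightarrow> \<bar>k x\<bar> \<le> C"
proof -
  define S where "S = {x \<in> U. \<bar>k x\<bar> > C}"
  note [measurable] = k(1)
  have Um: "U \<in> sets lebesgue" using U(2) by auto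
  have "(\<lambda>x. \<bar>k x\<bar>) \<in> borel_measurable lebesgue" by measurable
  then have "(\<lambda>x. \<bar>k x\<bar>) -` {C<..} \<inter> space lebesgue \<in> sets lebesgue"
    by (rule measurable_sets) simp
  moreover have "S = U \<inter> ((\<lambda>x. \<bar>k x\<bar>) -` {C<..} \<inter> space lebesgue)" by (auto simp: S_def)
  ultimately have Sm: "S \<in> sets lebesgue" using Um by simp
  have S: "S \<in> lmeasurable" by (rule fmeasurableI2[OF U(2) _ Sm]) (auto simp: S_def)
  then have iS: "integrable lebesgue (indicator S :: 'a \<Rightarrow> real)"
    by (intro integrable_real_indicator) (auto simp: fmeasurable_def)
  let ?\<psi> = "\<lambda>x. sgn (k x) * indicator S x"
  have i\<psi>: "integrable lebesgue ?\<psi>"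
    by (rule integrable_mult_bounded_on[of _ _ _ 1]) (use iS in \<open>auto simp: sgn_if\<close>)
  have "\<bar>LINT x|lebesgue. k x * ?\<psi> x\<bar> \<le> C * (LINT x|lebesgue. \<bar>?\<psi> x\<bar>)"
    by (rule test_pairing_bound_extends[OF U(1) k test i\<psi>]) (use assms in \<open>auto simp: S_def\<close>)
  moreover have "(\<lambda>x. \<bar>?\<psi> x\<bar>) = indicator S"
    using \<open>C \<ge> 0\<close> by (auto simp: fun_eq_iff indicator_def S_def sgn_if)
  ultimately have le: "(LINT x|lebesgue. k x * ?\<psi> x) \<le> C * (LINT x|lebesgue. indicator S x)" by simp
  have ik: "integrable lebesgue (\<lambda>x. k x * ?\<psi> x)"
    by (rule integrable_mult_bounded_on[OF k(1) _ i\<psi>, of M], use k(2) in eventually_elim)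
      (auto simp: S_def)
  have nn: "AE x in lebesgue. 0 \<le> k x * ?\<psi> x - C * indicator S x"
    by (rule AE_I2) (auto simp: indicator_def S_def sgn_if)
  have int: "integrable lebesgue (\<lambda>x. k x * ?\<psi> x - C * indicator S x)" using ik iS by simp
  have "(LINT x|lebesgue. k x * ?\<psi> x - C * indicator S x) =
      (LINT x|lebesgue. k x * ?\<psi> x) - C * (LINT x|lebesgue. indicator S x)"
    using ik iS by simp
  then have "(LINT x|lebesgue. k x * ?\<psi> x - C * indicator S x) = 0"
    using le integral_nonneg_AE[OF nn] by linarith
  then have "AE x in lebesgue. k x * ?\<psi> x - C * indicator S x = 0"
    using integral_nonneg_eq_0_iff_AE[OF int nn] by simp
  then show ?thesis
    by eventually_elim (auto simp: S_def indicator_def sgn_if split: if_splits)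
qed

text \<open>Weak* convergence of a bounded sequence may be checked on a dense part of
  \<open>L^1\<close>: the uniform bound \<open>M\<close> makes the approximation error independent
  of \<open>n\<close>.\<close>

lemma test_pairing_convergence_extends:
  fixes k :: "'a::euclidean_space \<Rightarrow> real" and K :: "nat \<Rightarrow> 'a \<Rightarrow> real"
  assumes U: "open U"
    and K: "\<And>n. K n \<in> borel_measurable lebesgue" "\<And>n. AE x in lebesgue. x \<in> U \<longrightarrow> \<bar>K n x\<bar> \<le> M"
    and k: "k \<in> borel_measurable lebesgue" "AE x in lebesgue. x \<in> U \<longrightarrow> \<bar>k x\<bar> \<le> M"
    and test: "\<And>\<phi>. test_function U \<phi> \<Longrightarrow>
      (\<lambda>n. LINT x|lebesgue. K n x * \<phi> x) \<longlonglongrightarrow> (LINT x|lebesgue. k x * \<phi> x)"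
    and \<psi>: "integrable lebesgue \<psi>" "\<And>x. x \<notin> U \<Longrightarrow> \<psi> x = 0" and "M \<ge> 0"
  shows "(\<lambda>n. LINT x|lebesgue. K n x * \<psi> x) \<longlonglongrightarrow> (LINT x|lebesgue. k x * \<psi> x)"
proof (rule tendstoI)
  fix e :: real assume "e > 0"
  \<comment> \<open>Three errors below \<open>e / 4\<close> occur: replacing \<open>\<psi>\<close>
    by \<open>\<phi>\<close> for \<open>K n\<close>, the same for \<open>k\<close>, and the
    convergence on \<open>\<phi>\<close>.\<close>
  then have "e / (4 * (M + 1)) > 0" using \<open>M \<ge> 0\<close> by simp
  from test_functions_dense[OF U \<psi> this] obtain \<phi>
    where \<phi>: "test_function U \<phi>" "(LINT x|lebesgue. \<bar>\<psi> x - \<phi> x\<bar>) < e / (4 * (M + 1))" by blast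
  let ?d = "LINT x|lebesgue. \<bar>\<psi> x - \<phi> x\<bar>"
  note i\<phi> = test_function_integrable[OF \<phi>(1)]
  have M: "M * ?d < e / 4"
  proof -
    have "M * ?d \<le> (M + 1) * ?d" by (intro mult_right_mono) auto
    also have "\<dots> < e / 4" using \<phi>(2) \<open>M \<ge> 0\<close> by (simp add: field_simps add_nonneg_pos)
    finally show ?thesis .
  qed
  have approx: "\<bar>(LINT x|lebesgue. g x * \<psi> x) - (LINT x|lebesgue. g x * \<phi> x)\<bar> < e / 4"
    if g: "g \<in> borel_measurable lebesgue" "AE x in lebesgue. x \<in> U \<longrightarrow> \<bar>g x\<bar> \<le> M" for g
  proof -
    have AE: "AE x in lebesgue. f x \<noteq> 0 \<longrightarrow> \<bar>g x\<bar> \<le> M" if "\<And>x. x \<notin> U \<Longrightarrow> f x = 0" for f :: "'a \<Rightarrow> real"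
      using g(2) by eventually_elim (use that in blast)
    have ig: "integrable lebesgue (\<lambda>x. g x * \<psi> x)" "integrable lebesgue (\<lambda>x. g x * \<phi> x)"
      by (rule integrable_mult_bounded_on[OF g(1) AE];
          use \<psi> i\<phi> test_function_eq_0[OF \<phi>(1)] in blast)+
    have "\<bar>LINT x|lebesgue. g x * (\<psi> x - \<phi> x)\<bar> \<le> M * ?d"
      using \<psi> i\<phi> test_function_eq_0[OF \<phi>(1)]
      by (intro integral_mult_bounded_on[OF g(1) AE]) auto
    moreover have "(LINT x|lebesgue. g x * (\<psi> x - \<phi> x)) =
        (LINT x|lebesgue. g x * \<psi> x) - (LINT x|lebesgue. g x * \<phi> x)"
      using ig by (simp add: right_diff_distrib)
    ultimately show ?thesis using M by linarith
  qed
  have "\<forall>\<^sub>F n in sequentially. dist (LINT x|lebesgue. K n x * \<phi> x) (LINT x|lebesgue. k x * \<phi> x) < e / 4"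
    using test[OF \<phi>(1)] \<open>e > 0\<close> by (intro tendstoD) auto
  then show "\<forall>\<^sub>F n in sequentially. dist (LINT x|lebesgue. K n x * \<psi> x) (LINT x|lebesgue. k x * \<psi> x) < e"
  proof eventually_elim
    case (elim n)
    then show ?case using approx[OF K(1)[of n] K(2)[of n]] approx[OF k]
      unfolding dist_real_def abs_less_iff by linarith
  qed
qed

section \<open>Continuity of translations in \<open>L^1\<close>\<close>

lemma translation_L1_tendsto_0_test:
  fixes b :: "'a::euclidean_space"
  assumes \<phi>: "test_function U \<phi>" and b: "b \<in> Basis" and h: "h \<longlonglongrightarrow> 0"
  shows "(\<lambda>n. LINT x|lebesgue. \<bar>\<phi> (x + h n *\<^sub>R b) - \<phi> x\<bar>) \<longlonglongrightarrow> 0"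
proof -
  obtain M where M: "M > 0" "\<And>x. \<bar>frechet_derivative \<phi> (at x) b\<bar> \<le> M"
    using test_function_bounded[OF test_function_partial[OF \<phi> b]] by metis
  obtain R where R: "\<And>n. \<bar>h n\<bar> \<le> R" "R > 0"
    by (metis Bseq_def convergentI convergent_imp_Bseq h(1) real_norm_def)
  obtain r where r: "\<And>x. \<phi> x \<noteq> 0 \<Longrightarrow> norm x \<le> r"
  proof -
    have "bounded {x. \<phi> x \<noteq> 0}"
      using \<phi> bounded_subset[OF compact_imp_bounded closure_subset]
      by (auto simp: test_function_def)
    then show thesis using that by (auto simp: bounded_iff)
  qed
  let ?D = "cball (0::'a) (r + R)"
  have iD: "integrable lebesgue (\<lambda>x. M * \<bar>h n\<bar> * indicator ?D x)" for n
    using emeasure_bounded_finite[of ?D]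
    by (intro integrable_mult_right integrable_real_indicator) auto
  have le: "\<bar>\<phi> (x + h n *\<^sub>R b) - \<phi> x\<bar> \<le> M * \<bar>h n\<bar> * indicator ?D x" for n x
  proof (cases "norm x \<le> r + R")
    case True
    then show ?thesis using test_function_diff_quotient_bound[OF \<phi> M(2), of x "h n"] by simp
  next
    case False
    have "norm x \<le> norm (x + h n *\<^sub>R b) + norm (h n *\<^sub>R b)"
      using norm_triangle_ineq4[of "x + h n *\<^sub>R b" "h n *\<^sub>R b"] by simp
    then have "norm x \<le> norm (x + h n *\<^sub>R b) + R" using R(1)[of n] b by simp
    then have "\<phi> (x + h n *\<^sub>R b) = 0" "\<phi> x = 0"
      using False r[of x] r[of "x + h n *\<^sub>R b"] R(2) by force+
    then show ?thesis using M(1) by (auto simp: indicator_def)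
  qed
  have "norm (LINT x|lebesgue. \<bar>\<phi> (x + h n *\<^sub>R b) - \<phi> x\<bar>) \<le> \<bar>h n\<bar> * (M * measure lebesgue ?D)" for n
  proof -
    have "(LINT x|lebesgue. \<bar>\<phi> (x + h n *\<^sub>R b) - \<phi> x\<bar>) \<le> (LINT x|lebesgue. M * \<bar>h n\<bar> * indicator ?D x)"
      using test_function_integrable[OF \<phi>] iD le
        integrable_lebesgue_translation[OF test_function_measurable[OF \<phi>], of "h n *\<^sub>R b"]
      by (intro integral_mono) auto
    then show ?thesis by (simp add: mult_ac)
  qed
  moreover have "(\<lambda>n. \<bar>h n\<bar> * (M * measure lebesgue ?D)) \<longlonglongrightarrow> 0"
    using tendsto_mult_left_zero[OF tendsto_rabs_zero[OF h]] by simp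
  ultimately show ?thesis by (rule Lim_null_comparison[OF always_eventually[OF allI]])
qed

text \<open>Translations preserve the \<open>L^1\<close> norm, so replacing \<open>f\<close> by a
  test function costs their distance twice, uniformly in the shift.\<close>

lemma translation_L1_tendsto_0:
  fixes b :: "'a::euclidean_space" and f :: "'a \<Rightarrow> real"
  assumes f: "integrable lebesgue f" and b: "b \<in> Basis" and h: "h \<longlonglongrightarrow> 0"
  shows "(\<lambda>n. LINT x|lebesgue. \<bar>f (x + h n *\<^sub>R b) - f x\<bar>) \<longlonglongrightarrow> 0"
proof (rule tendstoI)
  fix e :: real assume "e > 0"
  then obtain \<phi> where \<phi>: "test_function UNIV \<phi>" "(LINT x|lebesgue. \<bar>f x - \<phi> x\<bar>) < e / 4"
    using test_functions_dense[of UNIV f "e / 4"] f by auto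
  note i\<phi> = test_function_integrable[OF \<phi>(1)]
  have tr: "integrable lebesgue (\<lambda>x. g (x + a))" "(LINT x|lebesgue. g (x + a)) = (LINT x|lebesgue. g x)"
    if "integrable lebesgue g" for g :: "'a \<Rightarrow> real" and a
    using that integrable_lebesgue_translation[of g a] integral_lebesgue_translation[of g a] by auto
  have le: "(LINT x|lebesgue. \<bar>f (x + a) - f x\<bar>) \<le>
      2 * (LINT x|lebesgue. \<bar>f x - \<phi> x\<bar>) + (LINT x|lebesgue. \<bar>\<phi> (x + a) - \<phi> x\<bar>)" for a
  proof -
    have id: "integrable lebesgue (\<lambda>x. \<bar>f x - \<phi> x\<bar>)" using f i\<phi> by simp
    have "(LINT x|lebesgue. \<bar>f (x + a) - f x\<bar>) \<le>
        (LINT x|lebesgue. \<bar>f (x + a) - \<phi> (x + a)\<bar> + \<bar>\<phi> (x + a) - \<phi> x\<bar> + \<bar>f x - \<phi> x\<bar>)"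
      using f i\<phi> tr(1)[OF f, of a] tr(1)[OF i\<phi>, of a] by (intro integral_mono) auto
    also have "\<dots> = (LINT x|lebesgue. \<bar>f (x + a) - \<phi> (x + a)\<bar>) + (LINT x|lebesgue. \<bar>\<phi> (x + a) - \<phi> x\<bar>)
        + (LINT x|lebesgue. \<bar>f x - \<phi> x\<bar>)"
      using f i\<phi> tr(1)[OF f, of a] tr(1)[OF i\<phi>, of a] by simp
    finally show ?thesis using tr(2)[OF id, of a] by simp
  qed
  have "\<forall>\<^sub>F n in sequentially. dist (LINT x|lebesgue. \<bar>\<phi> (x + h n *\<^sub>R b) - \<phi> x\<bar>) 0 < e / 4"
    using translation_L1_tendsto_0_test[OF \<phi>(1) b h] \<open>e > 0\<close> by (intro tendstoD) auto
  then show "\<forall>\<^sub>F n in sequentially. dist (LINT x|lebesgue. \<bar>f (x + h n *\<^sub>R b) - f x\<bar>) 0 < e"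
  proof eventually_elim
    case (elim n)
    then show ?case using le[of "h n *\<^sub>R b"] \<phi>(2) \<open>e > 0\<close> by (simp add: dist_real_def)
  qed
qed


subsection \<open>Weak gradients and difference quotients\<close>

text \<open>A bound by the geodetic distance gives no Euclidean Lipschitz constant on a domain that
  is not convex. It does give one along segments inside \<open>\<Omega>\<close>, and difference
  quotients see nothing else.\<close>

definition segment_lipschitz :: "'a::euclidean_space set \<Rightarrow> real \<Rightarrow> ('a \<Rightarrow> real) \<Rightarrow> bool" where
  "segment_lipschitz \<Omega> L u \<longleftrightarrow>
     (\<forall>x y. closed_segment x y \<subseteq> \<Omega> \<longrightarrow> \<bar>u x - u y\<bar> \<le> L * norm (x - y))"

lemma segment_lipschitzD:
  "segment_lipschitz \<Omega> L u \<Longrightarrow> closed_segment x y \<subseteq> \<Omega> \<Longrightarrow> \<bar>u x - u y\<bar> \<le> L * norm (x - y)"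
  by (simp add: segment_lipschitz_def)

lemma segment_lipschitz_continuous_on:
  fixes u :: "'a::euclidean_space \<Rightarrow> real"
  assumes \<Omega>: "open \<Omega>" and u: "segment_lipschitz \<Omega> L u"
  shows "continuous_on \<Omega> u"
proof (rule continuous_at_imp_continuous_on, rule ballI)
  fix x assume "x \<in> \<Omega>"
  then obtain r where r: "r > 0" "ball x r \<subseteq> \<Omega>" using \<Omega> open_contains_ball by blast
  have "\<forall>\<^sub>F y in at x. norm (u y - u x) \<le> L * norm (y - x)"
  proof (rule eventually_mono)
    show "\<forall>\<^sub>F y in at x. y \<in> ball x r"
      using r(1) by (intro eventually_at_in_open') auto
    fix y assume "y \<in> ball x r"
    then have "closed_segment y x \<subseteq> ball x r"
      using r(1) by (intro closed_segment_subset) auto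
    then show "norm (u y - u x) \<le> L * norm (y - x)"
      using segment_lipschitzD[OF u] r(2) by auto
  qed
  moreover have "((\<lambda>y. L * norm (y - x)) \<longlongrightarrow> 0) (at x)"
    by (auto intro!: tendsto_eq_intros)
  ultimately have "((\<lambda>y. u y - u x) \<longlongrightarrow> 0) (at x)"
    by (rule Lim_null_comparison)
  then show "isCont u x" by (simp add: isCont_def LIM_zero_iff)
qed

lemma Linf_measurable_extension:
  fixes g :: "'a::euclidean_space \<Rightarrow> 'b::euclidean_space"
  assumes "open \<Omega>" "g \<in> Linf \<Omega>"
  shows "(\<lambda>x. if x \<in> \<Omega> then g x else 0) \<in> borel_measurable lebesgue"
  using assms by (auto simp: Linf_def intro!: borel_measurable_if_I)

lemma Linf_AE_bound:
  fixes g :: "'a::euclidean_space \<Rightarrow> 'b::euclidean_space"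
  assumes "open \<Omega>" "g \<in> Linf \<Omega>"
  obtains C where "C \<ge> 0" "AE x in lebesgue. x \<in> \<Omega> \<longrightarrow> norm (g x) \<le> C"
proof -
  obtain C where "AE x in lebesgue_on \<Omega>. norm (g x) \<le> C" using assms by (auto simp: Linf_def)
  then have "AE x in lebesgue. x \<in> \<Omega> \<longrightarrow> norm (g x) \<le> C"
    using assms(1) by (subst (asm) AE_restrict_space_iff) auto
  then have "AE x in lebesgue. x \<in> \<Omega> \<longrightarrow> norm (g x) \<le> max C 0" by eventually_elim auto
  then show thesis using that[of "max C 0"] by auto
qed

lemma W1inf_measurable:
  assumes "open \<Omega>" "u \<in> W1inf \<Omega>"
  shows "u \<in> borel_measurable lebesgue"
proof -
  have "(\<lambda>x. if x \<in> \<Omega> then u x else 0) = u" using assms(2) by (auto simp: W1inf_def)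
  then show ?thesis using Linf_measurable_extension[OF assms(1), of u] assms(2) by (simp add: W1inf_def)
qed

lemma W1inf_bounded:
  assumes "open \<Omega>" "u \<in> W1inf \<Omega>"
  obtains B where "B \<ge> 0" "\<And>x. \<bar>u x\<bar> \<le> B"
proof -
  obtain C where "AE x in lebesgue_on \<Omega>. norm (u x) \<le> C" using assms by (auto simp: W1inf_def Linf_def)
  then have AE: "AE x in lebesgue_on \<Omega>. \<bar>u x\<bar> \<le> C" by simp
  have "continuous_on \<Omega> (\<lambda>x. \<bar>u x\<bar>)"
    using assms(2) by (auto simp: W1inf_def intro!: continuous_intros)
  then have "\<bar>u x\<bar> \<le> C" if "x \<in> \<Omega>" for x
    using AE_le_imp_le_open[OF assms(1) _ AE that] by blast
  then have "\<bar>u x\<bar> \<le> max C 0" for x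
    using assms(2) by (cases "x \<in> \<Omega>") (fastforce simp: W1inf_def)+
  then show thesis using that[of "max C 0"] by auto
qed

text \<open>Room for difference quotients: \<open>U\<close> is the \<open>d / 2\<close>
  neighbourhood of the support and the shifts are at most \<open>d / 2\<close>, so the segments stay
  within \<open>d\<close> of the support and hence in \<open>\<Omega>\<close>.\<close>

lemma test_function_shrink_domain:
  fixes \<Omega> :: "'a::euclidean_space set"
  assumes "open \<Omega>" "test_function \<Omega> \<phi>" "b \<in> Basis"
  obtains U and h :: "nat \<Rightarrow> real" where "open U" "U \<subseteq> \<Omega>" "test_function U \<phi>" "h \<longlonglongrightarrow> 0" "\<And>n. h n > 0"
    "\<And>n x. x \<in> U \<Longrightarrow> closed_segment x (x + h n *\<^sub>R b) \<subseteq> \<Omega>"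
proof -
  let ?K = "closure {x. \<phi> x \<noteq> 0}"
  have K: "compact ?K" "?K \<subseteq> \<Omega>" using assms(2) by (auto simp: test_function_def)
  obtain d where d: "d > 0" "(\<Union>x\<in>?K. ball x d) \<subseteq> \<Omega>"
    using compact_subset_open_imp_ball_epsilon_subset[OF K(1) assms(1) K(2)] by metis
  define U where "U = (\<Union>x\<in>?K. ball x (d / 2))"
  define h where "h n = d / 2 * (1 / real (Suc n))" for n
  show thesis
  proof
    show "open U" by (auto simp: U_def)
    show "U \<subseteq> \<Omega>" using d by (fastforce simp: U_def)
    have "?K \<subseteq> U" using d(1) by (force simp: U_def)
    then show "test_function U \<phi>" using assms(2) by (auto simp: test_function_def)
    show "h \<longlonglongrightarrow> 0"
      unfolding h_def by (intro tendsto_mult_right_zero LIMSEQ_Suc[OF lim_1_over_n])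
    show pos: "h n > 0" for n using d(1) by (simp add: h_def)
    fix n x assume "x \<in> U"
    then obtain z where z: "z \<in> ?K" "dist z x < d / 2" by (auto simp: U_def)
    have "h n \<le> d / 2" using d(1) by (simp add: h_def field_simps)
    then have "dist x (x + h n *\<^sub>R b) \<le> d / 2" using pos[of n] assms(3) by (simp add: dist_norm)
    then have "dist z (x + h n *\<^sub>R b) < d"
      using dist_triangle[of z "x + h n *\<^sub>R b" x] z(2) by linarith
    then have "closed_segment x (x + h n *\<^sub>R b) \<subseteq> ball z d"
      using z(2) d(1) by (intro closed_segment_subset) auto
    then show "closed_segment x (x + h n *\<^sub>R b) \<subseteq> \<Omega>" using d(2) z(1) by blast
  qed
qed

lemma segment_lipschitz_diff_quotient:
  assumes "segment_lipschitz \<Omega> L u" "h > 0" "b \<in> Basis" "closed_segment x (x + h *\<^sub>R b) \<subseteq> \<Omega>"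
  shows "\<bar>(u (x + h *\<^sub>R b) - u x) / h\<bar> \<le> L"
  using segment_lipschitzD[OF assms(1,4)] assms(2,3)
  by (simp add: abs_divide divide_le_eq abs_minus_commute)

text \<open>The integrals move to the whole space, where translations act. \<open>g\<close> must be
  cut off explicitly, since nothing is known about it outside \<open>\<Omega>\<close>, whereas
  \<open>u\<close> vanishes there.\<close>

lemma is_weak_gradient_iff:
  assumes \<Omega>: "open \<Omega>" and u: "\<And>x. x \<notin> \<Omega> \<Longrightarrow> u x = 0"
  shows "is_weak_gradient \<Omega> u g \<longleftrightarrow> (\<forall>\<phi>. test_function \<Omega> \<phi> \<longrightarrow> (\<forall>b\<in>Basis.
      (LINT x|lebesgue. u x * frechet_derivative \<phi> (at x) b) =
      - (LINT x|lebesgue. (if x \<in> \<Omega> then g x \<bullet> b else 0) * \<phi> x)))"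
proof -
  have \<Omega>m: "\<Omega> \<in> sets lebesgue" using \<Omega> by (intro sets_completionI_sets) auto
  have "(LINT x|lebesgue_on \<Omega>. u x * frechet_derivative \<phi> (at x) b) =
      (LINT x|lebesgue. u x * frechet_derivative \<phi> (at x) b)" for \<phi> b
    using u by (intro integral_lebesgue_on_eq \<Omega>m) auto
  moreover have "(LINT x|lebesgue_on \<Omega>. (g x \<bullet> b) * \<phi> x) =
      (LINT x|lebesgue. (if x \<in> \<Omega> then g x \<bullet> b else 0) * \<phi> x)" for \<phi> b
  proof -
    have "(LINT x|lebesgue_on \<Omega>. (g x \<bullet> b) * \<phi> x) =
        (LINT x|lebesgue_on \<Omega>. (if x \<in> \<Omega> then g x \<bullet> b else 0) * \<phi> x)"
      by (intro Bochner_Integration.integral_cong) auto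
    also have "\<dots> = (LINT x|lebesgue. (if x \<in> \<Omega> then g x \<bullet> b else 0) * \<phi> x)"
      by (intro integral_lebesgue_on_eq \<Omega>m) auto
    finally show ?thesis .
  qed
  ultimately show ?thesis unfolding is_weak_gradient_def by simp
qed

lemma weak_gradient_integral:
  assumes "open \<Omega>" "\<And>x. x \<notin> \<Omega> \<Longrightarrow> u x = 0" "is_weak_gradient \<Omega> u g" "test_function \<Omega> \<phi>" "b \<in> Basis"
  shows "(LINT x|lebesgue. u x * frechet_derivative \<phi> (at x) b) =
     - (LINT x|lebesgue. (if x \<in> \<Omega> then g x \<bullet> b else 0) * \<phi> x)"
  using is_weak_gradient_iff[of \<Omega> u g] assms by blast

lemma is_weak_gradientI:
  assumes "open \<Omega>" "\<And>x. x \<notin> \<Omega> \<Longrightarrow> u x = 0"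
    and "\<And>\<phi> b. test_function \<Omega> \<phi> \<Longrightarrow> b \<in> Basis \<Longrightarrow>
      (LINT x|lebesgue. u x * frechet_derivative \<phi> (at x) b) =
     - (LINT x|lebesgue. (if x \<in> \<Omega> then g x \<bullet> b else 0) * \<phi> x)"
  shows "is_weak_gradient \<Omega> u g"
  using is_weak_gradient_iff[of \<Omega> u g] assms by blast

lemma Linf_component:
  fixes g :: "'a::euclidean_space \<Rightarrow> 'a"
  assumes \<Omega>: "open \<Omega>" and g: "g \<in> Linf \<Omega>" and b: "b \<in> Basis"
  shows "(\<lambda>x. if x \<in> \<Omega> then g x \<bullet> b else 0) \<in> borel_measurable lebesgue" (is ?m)
    and "\<exists>C\<ge>0. AE x in lebesgue. \<bar>if x \<in> \<Omega> then g x \<bullet> b else 0\<bar> \<le> C" (is ?b)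
proof -
  have "(\<lambda>x. (if x \<in> \<Omega> then g x else 0) \<bullet> b) \<in> borel_measurable lebesgue"
    using Linf_measurable_extension[OF \<Omega> g] by (intro borel_measurable_inner) auto
  moreover have "(\<lambda>x. (if x \<in> \<Omega> then g x else 0) \<bullet> b) = (\<lambda>x. if x \<in> \<Omega> then g x \<bullet> b else 0)"
    by auto
  ultimately show ?m by simp
  obtain C where C: "C \<ge> 0" "AE x in lebesgue. x \<in> \<Omega> \<longrightarrow> norm (g x) \<le> C"
    using Linf_AE_bound[OF \<Omega> g] by blast
  have "AE x in lebesgue. \<bar>if x \<in> \<Omega> then g x \<bullet> b else 0\<bar> \<le> C"
    using C(2) by eventually_elim (use C(1) Basis_le_norm[OF b] order_trans in auto)
  then show ?b using C(1) by blast
qed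

text \<open>As \<open>weak_gradient\<close> is a choice, this is the way to evaluate it. The
  difference of two gradients pairs to 0 with every test function, so the converse Hoelder bound
  holds with constant 0.\<close>

lemma weak_gradient_unique:
  fixes g g' :: "'a::euclidean_space \<Rightarrow> 'a"
  assumes \<Omega>: "open \<Omega>" "bounded \<Omega>" and u: "\<And>x. x \<notin> \<Omega> \<Longrightarrow> u x = 0"
    and g: "g \<in> Linf \<Omega>" "is_weak_gradient \<Omega> u g" and g': "g' \<in> Linf \<Omega>" "is_weak_gradient \<Omega> u g'"
  shows "AE x in lebesgue_on \<Omega>. g x = g' x"
proof -
  have \<Omega>m: "\<Omega> \<in> lmeasurable" using \<Omega> by (intro lmeasurable_open)
  have "AE x in lebesgue. x \<in> \<Omega> \<longrightarrow> g x \<bullet> b = g' x \<bullet> b" if b: "b \<in> Basis" for b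
  proof -
    let ?k = "\<lambda>g x. if x \<in> \<Omega> then g x \<bullet> b else 0"
    note m = Linf_component(1)[OF \<Omega>(1) g(1) b] Linf_component(1)[OF \<Omega>(1) g'(1) b]
    obtain C where C: "C \<ge> 0" "AE x in lebesgue. \<bar>?k g x\<bar> \<le> C"
      using Linf_component(2)[OF \<Omega>(1) g(1) b] by blast
    obtain C' where C': "C' \<ge> 0" "AE x in lebesgue. \<bar>?k g' x\<bar> \<le> C'"
      using Linf_component(2)[OF \<Omega>(1) g'(1) b] by blast
    have "AE x in lebesgue. x \<in> \<Omega> \<longrightarrow> \<bar>?k g x - ?k g' x\<bar> \<le> 0"
    proof (rule AE_bound_of_test_pairing[OF \<Omega>(1) \<Omega>m, where M="C + C'"])
      show "(\<lambda>x. ?k g x - ?k g' x) \<in> borel_measurable lebesgue" using m by (rule borel_measurable_diff)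
      show "AE x in lebesgue. x \<in> \<Omega> \<longrightarrow> \<bar>?k g x - ?k g' x\<bar> \<le> C + C'"
        using C(2) C'(2) by eventually_elim linarith
      fix \<phi> assume \<phi>: "test_function \<Omega> \<phi>"
      have "integrable lebesgue (\<lambda>x. ?k g x * \<phi> x)" "integrable lebesgue (\<lambda>x. ?k g' x * \<phi> x)"
        using integrable_mult_bounded[OF m(1) C(2) test_function_integrable[OF \<phi>]]
          integrable_mult_bounded[OF m(2) C'(2) test_function_integrable[OF \<phi>]] by blast+
      then have "(LINT x|lebesgue. (?k g x - ?k g' x) * \<phi> x) =
          (LINT x|lebesgue. ?k g x * \<phi> x) - (LINT x|lebesgue. ?k g' x * \<phi> x)"
        unfolding left_diff_distrib by (rule Bochner_Integration.integral_diff)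
      also have "\<dots> = 0"
        using weak_gradient_integral[OF \<Omega>(1) u g(2) \<phi> b] weak_gradient_integral[OF \<Omega>(1) u g'(2) \<phi> b]
        by linarith
      finally show "\<bar>LINT x|lebesgue. (?k g x - ?k g' x) * \<phi> x\<bar> \<le> 0 * (LINT x|lebesgue. \<bar>\<phi> x\<bar>)"
        by simp
    qed (use C C' in auto)
    then show ?thesis by eventually_elim auto
  qed
  then have "AE x in lebesgue. \<forall>b\<in>Basis. x \<in> \<Omega> \<longrightarrow> g x \<bullet> b = g' x \<bullet> b"
    by (intro AE_finite_allI) auto
  then have "AE x in lebesgue. x \<in> \<Omega> \<longrightarrow> g x = g' x"
    by eventually_elim (auto intro: euclidean_eqI)
  then show ?thesis using \<Omega>(1) by (subst AE_restrict_space_iff) auto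
qed

lemma diff_quotient_tendsto_weak_gradient:
  assumes \<Omega>: "open \<Omega>" and u: "u \<in> W1inf \<Omega>" and g: "is_weak_gradient \<Omega> u g"
    and \<phi>: "test_function \<Omega> \<phi>" and b: "b \<in> Basis" and h: "h \<longlonglongrightarrow> 0" "\<And>n. h n \<noteq> 0"
  shows "(\<lambda>n. LINT x|lebesgue. (u (x + h n *\<^sub>R b) - u x) / h n * \<phi> x)
           \<longlonglongrightarrow> (LINT x|lebesgue. (if x \<in> \<Omega> then g x \<bullet> b else 0) * \<phi> x)"
proof -
  obtain B where B: "\<And>x. \<bar>u x\<bar> \<le> B" using W1inf_bounded[OF \<Omega> u] by blast
  have u0: "u x = 0" if "x \<notin> \<Omega>" for x using u that by (simp add: W1inf_def)
  show ?thesis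
    using integral_diff_quotient_tendsto[OF W1inf_measurable[OF \<Omega> u] B \<phi> b h]
      weak_gradient_integral[OF \<Omega> u0 g \<phi> b] by simp
qed

lemma borel_measurable_diff_quotient:
  fixes u :: "'a::euclidean_space \<Rightarrow> real"
  assumes "u \<in> borel_measurable lebesgue"
  shows "(\<lambda>x. (u (x + a) - u x) / h) \<in> borel_measurable lebesgue"
  using assms borel_measurable_lebesgue_translation[OF assms] by measurable

text \<open>Near the support of a test function the difference quotients are at most
  \<open>L\<close>; the bound survives the weak limit, and the converse Hoelder inequality makes it
  pointwise.\<close>

lemma segment_lipschitz_gradient_bound:
  assumes \<Omega>: "open \<Omega>" "bounded \<Omega>" and u: "u \<in> W1inf \<Omega>" and g: "g \<in> Linf \<Omega>" "is_weak_gradient \<Omega> u g"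
    and L: "segment_lipschitz \<Omega> L u" "L \<ge> 0" and b: "b \<in> Basis"
  shows "AE x in lebesgue. x \<in> \<Omega> \<longrightarrow> \<bar>g x \<bullet> b\<bar> \<le> L"
proof -
  have \<Omega>m: "\<Omega> \<in> lmeasurable" using \<Omega> by (intro lmeasurable_open)
  let ?k = "\<lambda>x. if x \<in> \<Omega> then g x \<bullet> b else 0"
  note m = Linf_component(1)[OF \<Omega>(1) g(1) b]
  obtain C where C: "C \<ge> 0" "AE x in lebesgue. \<bar>?k x\<bar> \<le> C"
    using Linf_component(2)[OF \<Omega>(1) g(1) b] by blast
  have "AE x in lebesgue. x \<in> \<Omega> \<longrightarrow> \<bar>?k x\<bar> \<le> L"
  proof (rule AE_bound_of_test_pairing[OF \<Omega>(1) \<Omega>m m, where M=C])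
    show "AE x in lebesgue. x \<in> \<Omega> \<longrightarrow> \<bar>?k x\<bar> \<le> C" using C(2) by eventually_elim auto
    fix \<phi> assume \<phi>: "test_function \<Omega> \<phi>"
    obtain U and h :: "nat \<Rightarrow> real" where U: "open U" "U \<subseteq> \<Omega>" "test_function U \<phi>" "h \<longlonglongrightarrow> 0"
      "\<And>n. h n > 0" "\<And>n x. x \<in> U \<Longrightarrow> closed_segment x (x + h n *\<^sub>R b) \<subseteq> \<Omega>"
      using test_function_shrink_domain[OF \<Omega>(1) \<phi> b] by blast
    have h0: "h n \<noteq> 0" for n using U(5)[of n] by simp
    have lim: "(\<lambda>n. \<bar>LINT x|lebesgue. (u (x + h n *\<^sub>R b) - u x) / h n * \<phi> x\<bar>)
        \<longlonglongrightarrow> \<bar>LINT x|lebesgue. ?k x * \<phi> x\<bar>"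
      using diff_quotient_tendsto_weak_gradient[OF \<Omega>(1) u g(2) \<phi> b U(4) h0] by (rule tendsto_rabs)
    have "\<bar>LINT x|lebesgue. (u (x + h n *\<^sub>R b) - u x) / h n * \<phi> x\<bar> \<le> L * (LINT x|lebesgue. \<bar>\<phi> x\<bar>)" for n
    proof (rule integral_mult_bounded_on[OF borel_measurable_diff_quotient[OF W1inf_measurable[OF \<Omega>(1) u]]])
      show "AE x in lebesgue. \<phi> x \<noteq> 0 \<longrightarrow> \<bar>(u (x + h n *\<^sub>R b) - u x) / h n\<bar> \<le> L"
      proof (rule AE_I2, rule impI)
        fix x assume "\<phi> x \<noteq> 0"
        then have "x \<in> U" using test_function_eq_0[OF U(3)] by blast
        then show "\<bar>(u (x + h n *\<^sub>R b) - u x) / h n\<bar> \<le> L"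
          using segment_lipschitz_diff_quotient[OF L(1) U(5) b U(6)] by blast
      qed
    qed (rule test_function_integrable[OF \<phi>])
    then show "\<bar>LINT x|lebesgue. ?k x * \<phi> x\<bar> \<le> L * (LINT x|lebesgue. \<bar>\<phi> x\<bar>)"
      by (intro LIMSEQ_le_const2[OF lim]) blast
  qed (use L C in auto)
  then show ?thesis by eventually_elim auto
qed

text \<open>Rademacher's theorem is avoided: the weak gradient is the weak limit of the difference quotients.
  Those of \<open>m\<close> and \<open>u\<close> agree on \<open>A\<close> except where the translation leaves \<open>A\<close>, a set whose measure
  tends to \<open>0\<close> by continuity of translations in \<open>L\<^sup>1\<close>; likewise for \<open>v\<close> off \<open>A\<close>.\<close>

lemma segment_lipschitz_glue_is_weak_gradient:
  fixes \<Omega> :: "'a::euclidean_space set"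
  assumes \<Omega>: "open \<Omega>" "bounded \<Omega>"
    and u: "u \<in> W1inf \<Omega>" "gu \<in> Linf \<Omega>" "is_weak_gradient \<Omega> u gu" "segment_lipschitz \<Omega> L u"
    and v: "v \<in> W1inf \<Omega>" "gv \<in> Linf \<Omega>" "is_weak_gradient \<Omega> v gv" "segment_lipschitz \<Omega> L v"
    and A: "A \<in> sets lebesgue"
    and m: "\<And>x. x \<notin> \<Omega> \<Longrightarrow> m x = 0" "\<And>x. x \<in> \<Omega> \<Longrightarrow> x \<in> A \<Longrightarrow> m x = u x"
      "\<And>x. x \<in> \<Omega> \<Longrightarrow> x \<notin> A \<Longrightarrow> m x = v x" "segment_lipschitz \<Omega> L m" and "L \<ge> 0"
  shows "is_weak_gradient \<Omega> m (\<lambda>x. if x \<in> A then gu x else gv x)"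
proof (rule is_weak_gradientI[OF \<Omega>(1) m(1)])
  fix \<phi> b assume \<phi>: "test_function \<Omega> \<phi>" and b: "b \<in> (Basis :: 'a set)"
  obtain U and h :: "nat \<Rightarrow> real" where U: "open U" "U \<subseteq> \<Omega>" "test_function U \<phi>" and h: "h \<longlonglongrightarrow> 0"
    "\<And>n. h n > 0" "\<And>n x. x \<in> U \<Longrightarrow> closed_segment x (x + h n *\<^sub>R b) \<subseteq> \<Omega>"
    using test_function_shrink_domain[OF \<Omega>(1) \<phi> b] by blast
  have h0: "h n \<noteq> 0" for n using h(2)[of n] by simp
  have A': "- A \<in> sets lebesgue" using A Compl_in_sets_lebesgue by blast
  define D where "D w n x = (w (x + h n *\<^sub>R b) - w x) / h n" for w :: "'a \<Rightarrow> real" and n x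
  define k where "k g x = (if x \<in> \<Omega> then g x \<bullet> b else 0)" for g :: "'a \<Rightarrow> 'a" and x
  have um: "u \<in> borel_measurable lebesgue" "v \<in> borel_measurable lebesgue"
    using W1inf_measurable[OF \<Omega>(1)] u(1) v(1) by blast+
  obtain Bu Bv where B: "\<And>x. \<bar>u x\<bar> \<le> Bu" "\<And>x. \<bar>v x\<bar> \<le> Bv" "Bu \<ge> 0" "Bv \<ge> 0"
    using W1inf_bounded[OF \<Omega>(1) u(1)] W1inf_bounded[OF \<Omega>(1) v(1)] by metis
  have m_eq: "m = (\<lambda>x. if x \<in> A then u x else v x)"
  proof (rule ext)
    fix x
    have "u x = 0" "v x = 0" if "x \<notin> \<Omega>" using u(1) v(1) that by (simp_all add: W1inf_def)
    then show "m x = (if x \<in> A then u x else v x)"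
      using m(1-3)[of x] by (cases "x \<in> \<Omega>") auto
  qed
  have mm: "m \<in> borel_measurable lebesgue"
    unfolding m_eq using um A by (intro measurable_If_set) auto
  have mB: "\<bar>m x\<bar> \<le> max Bu Bv" for x
    unfolding m_eq using B(1,2)[of x] by auto
  have Dm: "D w n \<in> borel_measurable lebesgue" if "w \<in> borel_measurable lebesgue" for w n
    unfolding D_def[abs_def] using borel_measurable_diff_quotient[OF that] .
  have DL: "\<bar>D w n x\<bar> \<le> L" if "segment_lipschitz \<Omega> L w" "x \<in> U" for w n x
    unfolding D_def using segment_lipschitz_diff_quotient[OF that(1) h(2) b h(3)[OF that(2)]] .
  have cut: "integrable lebesgue (\<lambda>x. indicator S x * \<phi> x)" if S: "S \<in> sets lebesgue" for S
    by (rule integrable_mult_bounded[OF borel_measurable_indicator[OF S] _ test_function_integrable[OF \<phi>], of 1])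
      (auto simp: indicator_def)
  \<comment> \<open>\<open>indicator S x * \<phi> x\<close> is not a test function. Convergence
    against it needs the extension to integrable functions, and so the common bound \<open>L\<close>
    on quotients and gradient.\<close>
  have piece: "(\<lambda>n. LINT x|lebesgue. D w n x * (indicator S x * \<phi> x))
      \<longlonglongrightarrow> (LINT x|lebesgue. k g x * (indicator S x * \<phi> x))"
    if w: "w \<in> W1inf \<Omega>" "g \<in> Linf \<Omega>" "is_weak_gradient \<Omega> w g" "segment_lipschitz \<Omega> L w"
      and S: "S \<in> sets lebesgue" for w g S
  proof (rule test_pairing_convergence_extends[OF U(1), where M=L])
    show "D w n \<in> borel_measurable lebesgue" for n
      by (rule Dm[OF W1inf_measurable[OF \<Omega>(1) w(1)]])
    show "AE x in lebesgue. x \<in> U \<longrightarrow> \<bar>D w n x\<bar> \<le> L" for n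
      by (rule AE_I2) (use DL[OF w(4)] in blast)
    show "k g \<in> borel_measurable lebesgue"
      unfolding k_def[abs_def] by (rule Linf_component(1)[OF \<Omega>(1) w(2) b])
    show "AE x in lebesgue. x \<in> U \<longrightarrow> \<bar>k g x\<bar> \<le> L"
      using segment_lipschitz_gradient_bound[OF \<Omega> w \<open>L \<ge> 0\<close> b]
      by eventually_elim (use \<open>L \<ge> 0\<close> U(2) in \<open>auto simp: k_def\<close>)
    show "(\<lambda>n. LINT x|lebesgue. D w n x * \<psi> x) \<longlonglongrightarrow> (LINT x|lebesgue. k g x * \<psi> x)"
      if "test_function U \<psi>" for \<psi>
      unfolding D_def k_def
      using diff_quotient_tendsto_weak_gradient[OF \<Omega>(1) w(1,3) test_function_mono[OF that U(2)] b h(1) h0] .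
    show "integrable lebesgue (\<lambda>x. indicator S x * \<phi> x)" by (rule cut[OF S])
    show "indicator S x * \<phi> x = 0" if "x \<notin> U" for x
      using test_function_eq_0[OF U(3) that] by simp
  qed (rule \<open>L \<ge> 0\<close>)
  obtain M where M: "M > 0" "\<And>x. \<bar>\<phi> x\<bar> \<le> M" using test_function_bounded[OF \<phi>] by blast
  let ?R = "\<lambda>n x. D m n x * \<phi> x - D u n x * (indicator A x * \<phi> x) - D v n x * (indicator (- A) x * \<phi> x)"
  \<comment> \<open>Intersecting with \<open>\<Omega>\<close> gives finite measure, as continuity of
    translations in \<open>L^1\<close> requires. Where \<open>\<phi>\<close> is nonzero, a point and
    its shift both lie in \<open>\<Omega>\<close>, so nothing is lost.\<close>
  let ?J = "indicator (A \<inter> \<Omega>) :: 'a \<Rightarrow> real"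
  have \<Omega>m: "\<Omega> \<in> lmeasurable" using \<Omega> by (intro lmeasurable_open)
  have "A \<inter> \<Omega> \<in> lmeasurable" using fmeasurable_Int_fmeasurable[OF \<Omega>m A] by (simp add: Int_commute)
  then have iJ: "integrable lebesgue ?J"
    by (intro integrable_real_indicator) (auto simp: fmeasurable_def)
  have tr: "integrable lebesgue (\<lambda>x. ?J (x + a))" for a
    using iJ integrable_lebesgue_translation[of ?J a] by auto
  have sl: "segment_lipschitz \<Omega> L w \<Longrightarrow> w \<in> borel_measurable lebesgue \<Longrightarrow> S \<in> sets lebesgue \<Longrightarrow>
      integrable lebesgue (\<lambda>x. D w n x * (indicator S x * \<phi> x))" for w n S
  proof -
    assume w: "segment_lipschitz \<Omega> L w" "w \<in> borel_measurable lebesgue" "S \<in> sets lebesgue"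
    show ?thesis
    proof (rule integrable_mult_bounded_on[OF Dm[OF w(2)], where B=L])
      show "AE x in lebesgue. indicator S x * \<phi> x \<noteq> 0 \<longrightarrow> \<bar>D w n x\<bar> \<le> L"
        by (rule AE_I2) (use DL[OF w(1)] test_function_eq_0[OF U(3)] in auto)
      show "integrable lebesgue (\<lambda>x. indicator S x * \<phi> x)" by (rule cut[OF w(3)])
    qed
  qed
  have iR: "integrable lebesgue (\<lambda>x. D m n x * \<phi> x)"
    "integrable lebesgue (\<lambda>x. D u n x * (indicator A x * \<phi> x))"
    "integrable lebesgue (\<lambda>x. D v n x * (indicator (- A) x * \<phi> x))" for n
    using sl[OF m(4) mm, of UNIV n] sl[OF u(4) um(1) A, of n] sl[OF v(4) um(2) A', of n] by auto
  \<comment> \<open>Only points whose shift crosses between \<open>A\<close> and its complement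
    contribute, and there each of the two quotients is at most \<open>L\<close> in modulus.\<close>
  have pt: "\<bar>?R n x\<bar> \<le> 2 * L * M * \<bar>?J (x + h n *\<^sub>R b) - ?J x\<bar>" for n x
  proof (cases "\<phi> x = 0")
    case True
    then show ?thesis using M(1) \<open>L \<ge> 0\<close> by simp
  next
    case False
    then have x: "x \<in> U" using test_function_eq_0[OF U(3)] by blast
    then have in\<Omega>: "x \<in> \<Omega>" "x + h n *\<^sub>R b \<in> \<Omega>" using h(3)[OF x, of n] U(2) by auto
    have bd: "\<bar>(D m n x - D w n x) * \<phi> x\<bar> \<le> 2 * L * M" if "segment_lipschitz \<Omega> L w" for w
    proof -
      have "\<bar>D m n x - D w n x\<bar> \<le> 2 * L" using DL[OF m(4) x, of n] DL[OF that x, of n] by linarith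
      then show ?thesis unfolding abs_mult using M \<open>L \<ge> 0\<close> by (intro mult_mono) auto
    qed
    show ?thesis
    proof (cases "x \<in> A")
      case True
      then have R: "?R n x = (D m n x - D u n x) * \<phi> x" by (simp add: algebra_simps)
      show ?thesis
      proof (cases "x + h n *\<^sub>R b \<in> A")
        case True
        then have "D m n x = D u n x" using \<open>x \<in> A\<close> in\<Omega> m(2) by (simp add: D_def)
        then show ?thesis using R M(1) \<open>L \<ge> 0\<close> by simp
      next
        case False
        then have "\<bar>?J (x + h n *\<^sub>R b) - ?J x\<bar> = 1" using \<open>x \<in> A\<close> in\<Omega> by simp
        then show ?thesis using bd[OF u(4)] R by simp
      qed
    next
      case False
      then have R: "?R n x = (D m n x - D v n x) * \<phi> x" by (simp add: algebra_simps)
      show ?thesis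
      proof (cases "x + h n *\<^sub>R b \<in> A")
        case True
        then have "\<bar>?J (x + h n *\<^sub>R b) - ?J x\<bar> = 1" using \<open>x \<notin> A\<close> in\<Omega> by simp
        then show ?thesis using bd[OF v(4)] R by simp
      next
        case False
        then have "D m n x = D v n x" using \<open>x \<notin> A\<close> in\<Omega> m(3) by (simp add: D_def)
        then show ?thesis using R M(1) \<open>L \<ge> 0\<close> by simp
      qed
    qed
  qed
  have "(\<lambda>n. LINT x|lebesgue. ?R n x) \<longlonglongrightarrow> 0"
  proof (rule Lim_null_comparison[OF always_eventually[OF allI]])
    fix n
    have "\<bar>LINT x|lebesgue. ?R n x\<bar> \<le> (LINT x|lebesgue. \<bar>?R n x\<bar>)" by (rule integral_abs_bound)
    also have "\<dots> \<le> (LINT x|lebesgue. 2 * L * M * \<bar>?J (x + h n *\<^sub>R b) - ?J x\<bar>)"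
      using iR[of n] iJ tr[of "h n *\<^sub>R b"] pt by (intro integral_mono) auto
    finally show "norm (LINT x|lebesgue. ?R n x) \<le>
        2 * L * M * (LINT x|lebesgue. \<bar>?J (x + h n *\<^sub>R b) - ?J x\<bar>)" by simp
    show "(\<lambda>n. 2 * L * M * (LINT x|lebesgue. \<bar>?J (x + h n *\<^sub>R b) - ?J x\<bar>)) \<longlonglongrightarrow> 0"
      using tendsto_mult_right_zero[OF translation_L1_tendsto_0[OF iJ b h(1)], of "2 * L * M"] .
  qed
  moreover have "(LINT x|lebesgue. ?R n x) = (LINT x|lebesgue. D m n x * \<phi> x) -
      (LINT x|lebesgue. D u n x * (indicator A x * \<phi> x)) -
      (LINT x|lebesgue. D v n x * (indicator (- A) x * \<phi> x))" for n
    using iR[of n] by simp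
  ultimately have "(\<lambda>n. (LINT x|lebesgue. D m n x * \<phi> x) -
      (LINT x|lebesgue. D u n x * (indicator A x * \<phi> x)) -
      (LINT x|lebesgue. D v n x * (indicator (- A) x * \<phi> x))) \<longlonglongrightarrow> 0" by simp
  \<comment> \<open>The term with \<open>m\<close> converges by discrete integration by parts alone;
    comparing the two limits identifies the gradient of \<open>m\<close>.\<close>
  moreover have "(\<lambda>n. (LINT x|lebesgue. D m n x * \<phi> x) -
      (LINT x|lebesgue. D u n x * (indicator A x * \<phi> x)) -
      (LINT x|lebesgue. D v n x * (indicator (- A) x * \<phi> x))) \<longlonglongrightarrow>
      - (LINT x|lebesgue. m x * frechet_derivative \<phi> (at x) b)
      - (LINT x|lebesgue. k gu x * (indicator A x * \<phi> x))
      - (LINT x|lebesgue. k gv x * (indicator (- A) x * \<phi> x))"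
    using integral_diff_quotient_tendsto[OF mm mB \<phi> b h(1) h0, folded D_def]
    by (intro tendsto_diff piece u v A A')
  ultimately have "- (LINT x|lebesgue. m x * frechet_derivative \<phi> (at x) b)
      - (LINT x|lebesgue. k gu x * (indicator A x * \<phi> x))
      - (LINT x|lebesgue. k gv x * (indicator (- A) x * \<phi> x)) = 0"
    using LIMSEQ_unique by blast
  moreover have "(LINT x|lebesgue. (if x \<in> \<Omega> then (if x \<in> A then gu x else gv x) \<bullet> b else 0) * \<phi> x) =
      (LINT x|lebesgue. k gu x * (indicator A x * \<phi> x)) +
      (LINT x|lebesgue. k gv x * (indicator (- A) x * \<phi> x))"
  proof -
    have ik: "integrable lebesgue (\<lambda>x. k g x * (indicator S x * \<phi> x))"
      if g: "g \<in> Linf \<Omega>" and S: "S \<in> sets lebesgue" for g S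
    proof -
      obtain C where C: "AE x in lebesgue. \<bar>k g x\<bar> \<le> C"
        using Linf_component(2)[OF \<Omega>(1) g b] unfolding k_def by blast
      show ?thesis
        using integrable_mult_bounded[OF _ C cut[OF S]] Linf_component(1)[OF \<Omega>(1) g b] unfolding k_def by blast
    qed
    have "(\<lambda>x. (if x \<in> \<Omega> then (if x \<in> A then gu x else gv x) \<bullet> b else 0) * \<phi> x) =
       (\<lambda>x. k gu x * (indicator A x * \<phi> x) + k gv x * (indicator (- A) x * \<phi> x))"
      by (auto simp: k_def fun_eq_iff)
    then show ?thesis
      using ik[OF u(2) A] ik[OF v(2) A'] by simp
  qed
  ultimately show "(LINT x|lebesgue. m x * frechet_derivative \<phi> (at x) b) =
      - (LINT x|lebesgue. (if x \<in> \<Omega> then (if x \<in> A then gu x else gv x) \<bullet> b else 0) * \<phi> x)"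
    by linarith
qed

text \<open>Uniqueness carries the gradient just found over to the chosen
  \<open>weak_gradient\<close>. The segment bound on \<open>m\<close> also supplies continuity,
  which gluing along an arbitrary measurable set would not.\<close>

lemma segment_lipschitz_glue:
  fixes \<Omega> :: "'a::euclidean_space set"
  assumes \<Omega>: "open \<Omega>" "bounded \<Omega>"
    and u: "u \<in> W1inf \<Omega>" "segment_lipschitz \<Omega> L u"
    and v: "v \<in> W1inf \<Omega>" "segment_lipschitz \<Omega> L v"
    and A: "A \<in> sets lebesgue"
    and m: "\<And>x. x \<notin> \<Omega> \<Longrightarrow> m x = 0" "\<And>x. x \<in> \<Omega> \<Longrightarrow> x \<in> A \<Longrightarrow> m x = u x"
      "\<And>x. x \<in> \<Omega> \<Longrightarrow> x \<notin> A \<Longrightarrow> m x = v x" "segment_lipschitz \<Omega> L m" and "L \<ge> 0"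
  shows "m \<in> W1inf \<Omega>"
    and "AE x in lebesgue_on \<Omega>. weak_gradient \<Omega> m x =
      (if x \<in> A then weak_gradient \<Omega> u x else weak_gradient \<Omega> v x)"
proof -
  let ?g = "\<lambda>x. if x \<in> A then weak_gradient \<Omega> u x else weak_gradient \<Omega> v x"
  have g: "is_weak_gradient \<Omega> m ?g"
    using segment_lipschitz_glue_is_weak_gradient[OF \<Omega> u(1) weak_gradient[OF u(1)] u(2)
        v(1) weak_gradient[OF v(1)] v(2) A m \<open>L \<ge> 0\<close>] .
  have A': "A \<inter> space (lebesgue_on \<Omega>) \<in> sets (lebesgue_on \<Omega>)"
    using A \<Omega>(1) by (auto simp: sets_restrict_space image_iff Int_commute)
  have glue: "(\<lambda>x. if x \<in> A then f x else h x) \<in> Linf \<Omega>"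
    if f: "f \<in> Linf \<Omega>" and h: "h \<in> Linf \<Omega>" for f h :: "'a \<Rightarrow> 'c::euclidean_space"
  proof -
    obtain C C' where C: "AE x in lebesgue_on \<Omega>. norm (f x) \<le> C" "AE x in lebesgue_on \<Omega>. norm (h x) \<le> C'"
      using f h by (auto simp: Linf_def)
    have "(\<lambda>x. if x \<in> A then f x else h x) \<in> borel_measurable (lebesgue_on \<Omega>)"
      using f h A' by (intro measurable_If_set) (auto simp: Linf_def)
    moreover have "AE x in lebesgue_on \<Omega>. norm (if x \<in> A then f x else h x) \<le> max C C'"
      using C by eventually_elim auto
    ultimately show ?thesis unfolding Linf_def by blast
  qed
  have gL: "?g \<in> Linf \<Omega>" using weak_gradient(1) u(1) v(1) by (intro glue)
  have m_eq: "m = (\<lambda>x. if x \<in> A then u x else v x)"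
  proof (rule ext)
    fix x
    have "u x = 0" "v x = 0" if "x \<notin> \<Omega>" using u(1) v(1) that by (simp_all add: W1inf_def)
    then show "m x = (if x \<in> A then u x else v x)"
      using m(1-3)[of x] by (cases "x \<in> \<Omega>") auto
  qed
  have "m \<in> Linf \<Omega>" unfolding m_eq using u(1) v(1) by (intro glue) (auto simp: W1inf_def)
  then show mW: "m \<in> W1inf \<Omega>"
    using segment_lipschitz_continuous_on[OF \<Omega>(1) m(4)] m(1) gL g unfolding W1inf_def by blast
  show "AE x in lebesgue_on \<Omega>. weak_gradient \<Omega> m x = ?g x"
    by (rule weak_gradient_unique[OF \<Omega> m(1) weak_gradient[OF mW] gL g])
qed

section \<open>Linear combinations and constants\<close>

lemma integral_test_function_partial:
  fixes \<phi> :: "'a::euclidean_space \<Rightarrow> real"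
  assumes \<phi>: "test_function U \<phi>" and b: "b \<in> Basis"
  shows "(LINT x|lebesgue. frechet_derivative \<phi> (at x) b) = 0"
proof -
  have h: "(\<lambda>n. 1 / real (Suc n)) \<longlonglongrightarrow> 0" by (rule LIMSEQ_Suc[OF lim_1_over_n])
  \<comment> \<open>Discrete integration by parts for the constant function 1, whose difference
    quotients vanish.\<close>
  have "(\<lambda>n. LINT x|lebesgue. ((1 :: real) - 1) / (1 / real (Suc n)) * \<phi> x)
      \<longlonglongrightarrow> - (LINT x|lebesgue. 1 * frechet_derivative \<phi> (at x) b)"
    by (rule integral_diff_quotient_tendsto[where B=1, OF _ _ \<phi> b h]) auto
  then have "(\<lambda>n::nat. 0 :: real) \<longlonglongrightarrow> - (LINT x|lebesgue. frechet_derivative \<phi> (at x) b)" by simp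
  from LIMSEQ_unique[OF tendsto_const this] show ?thesis by simp
qed

text \<open>This serves level convexity of the relaxation, whose sublevel sets are described by
  differences of values; so the gradient of the combination is not recorded.\<close>

lemma W1inf_lincomb:
  fixes \<Omega> :: "'a::euclidean_space set"
  assumes \<Omega>: "open \<Omega>" "bounded \<Omega>" and u: "u \<in> W1inf \<Omega>" and v: "v \<in> W1inf \<Omega>"
  shows "(\<lambda>x. s * u x + t * v x) \<in> W1inf \<Omega>"
proof -
  let ?w = "\<lambda>x. s * u x + t * v x"
  let ?g = "\<lambda>x. s *\<^sub>R weak_gradient \<Omega> u x + t *\<^sub>R weak_gradient \<Omega> v x"
  have lin: "(\<lambda>x. s *\<^sub>R f x + t *\<^sub>R h x) \<in> Linf \<Omega>"
    if f: "f \<in> Linf \<Omega>" and h: "h \<in> Linf \<Omega>" for f h :: "'a \<Rightarrow> 'c::euclidean_space"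
  proof -
    obtain C C' where C: "AE x in lebesgue_on \<Omega>. norm (f x) \<le> C" "AE x in lebesgue_on \<Omega>. norm (h x) \<le> C'"
      using f h by (auto simp: Linf_def)
    have "(\<lambda>x. s *\<^sub>R f x + t *\<^sub>R h x) \<in> borel_measurable (lebesgue_on \<Omega>)"
      using f h by (intro borel_measurable_add borel_measurable_scaleR) (auto simp: Linf_def)
    moreover have "AE x in lebesgue_on \<Omega>. norm (s *\<^sub>R f x + t *\<^sub>R h x) \<le> \<bar>s\<bar> * C + \<bar>t\<bar> * C'"
      using C
    proof eventually_elim
      case (elim x)
      have "norm (s *\<^sub>R f x + t *\<^sub>R h x) \<le> \<bar>s\<bar> * norm (f x) + \<bar>t\<bar> * norm (h x)"
        by (rule norm_triangle_le) simp
      also have "\<dots> \<le> \<bar>s\<bar> * C + \<bar>t\<bar> * C'"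
        using elim by (intro add_mono mult_left_mono) auto
      finally show ?case .
    qed
    ultimately show ?thesis unfolding Linf_def by blast
  qed
  have gL: "?g \<in> Linf \<Omega>" using weak_gradient(1) u v by (intro lin)
  have wL: "?w \<in> Linf \<Omega>" using lin[of u v] u v by (simp add: W1inf_def)
  have u0: "u x = 0" "v x = 0" if "x \<notin> \<Omega>" for x using u v that by (simp_all add: W1inf_def)
  have "is_weak_gradient \<Omega> ?w ?g"
  proof (rule is_weak_gradientI[OF \<Omega>(1)])
    show "s * u x + t * v x = 0" if "x \<notin> \<Omega>" for x using u0[OF that] by simp
    fix \<phi> b assume \<phi>: "test_function \<Omega> \<phi>" and b: "b \<in> (Basis :: 'a set)"
    let ?D = "\<lambda>x. frechet_derivative \<phi> (at x) b"
    let ?k = "\<lambda>w x. if x \<in> \<Omega> then weak_gradient \<Omega> w x \<bullet> b else 0"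
    have i1: "integrable lebesgue (\<lambda>x. w x * ?D x)" if w: "w \<in> W1inf \<Omega>" for w
    proof -
      obtain B where "\<And>x. \<bar>w x\<bar> \<le> B" using W1inf_bounded[OF \<Omega>(1) w] by blast
      then show ?thesis
        using W1inf_measurable[OF \<Omega>(1) w] test_function_integrable[OF test_function_partial[OF \<phi> b]]
        by (intro integrable_mult_bounded[of _ _ B]) auto
    qed
    have i2: "integrable lebesgue (\<lambda>x. ?k w x * \<phi> x)" if w: "w \<in> W1inf \<Omega>" for w
    proof -
      obtain C where C: "AE x in lebesgue. \<bar>?k w x\<bar> \<le> C"
        using Linf_component(2)[OF \<Omega>(1) weak_gradient(1)[OF w] b] by blast
      show ?thesis
        by (rule integrable_mult_bounded[OF Linf_component(1)[OF \<Omega>(1) weak_gradient(1)[OF w] b] C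
              test_function_integrable[OF \<phi>]])
    qed
    have "(LINT x|lebesgue. (s * u x + t * v x) * ?D x) =
        (LINT x|lebesgue. s * (u x * ?D x) + t * (v x * ?D x))"
      by (intro Bochner_Integration.integral_cong) (auto simp: algebra_simps)
    also have "\<dots> = s * (LINT x|lebesgue. u x * ?D x) + t * (LINT x|lebesgue. v x * ?D x)"
      using i1[OF u] i1[OF v] by simp
    also have "\<dots> = - (s * (LINT x|lebesgue. ?k u x * \<phi> x) + t * (LINT x|lebesgue. ?k v x * \<phi> x))"
      using weak_gradient_integral[OF \<Omega>(1) u0(1) weak_gradient(2)[OF u] \<phi> b]
        weak_gradient_integral[OF \<Omega>(1) u0(2) weak_gradient(2)[OF v] \<phi> b] by simp
    also have "s * (LINT x|lebesgue. ?k u x * \<phi> x) + t * (LINT x|lebesgue. ?k v x * \<phi> x) =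
        (LINT x|lebesgue. s * (?k u x * \<phi> x) + t * (?k v x * \<phi> x))"
      using i2[OF u] i2[OF v] by simp
    also have "\<dots> = (LINT x|lebesgue. (if x \<in> \<Omega> then ?g x \<bullet> b else 0) * \<phi> x)"
      by (intro Bochner_Integration.integral_cong) (auto simp: algebra_simps inner_add_left)
    finally show "(LINT x|lebesgue. (s * u x + t * v x) * ?D x) =
        - (LINT x|lebesgue. (if x \<in> \<Omega> then ?g x \<bullet> b else 0) * \<phi> x)" .
  qed
  moreover have "continuous_on \<Omega> ?w" using u v by (auto simp: W1inf_def intro!: continuous_intros)
  ultimately show ?thesis using wL gL u0 unfolding W1inf_def by auto
qed

text \<open>The constant is added inside \<open>\<Omega>\<close> alone, to respect the
  normalisation. It leaves the gradient unchanged because partial derivatives of test functions have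
  integral 0.\<close>

lemma W1inf_add_const:
  fixes \<Omega> :: "'a::euclidean_space set" and c :: real
  assumes \<Omega>: "open \<Omega>" "bounded \<Omega>" and u: "u \<in> W1inf \<Omega>"
  defines "w \<equiv> \<lambda>x. if x \<in> \<Omega> then u x + c else 0"
  shows "w \<in> W1inf \<Omega>" and "AE x in lebesgue_on \<Omega>. weak_gradient \<Omega> w x = weak_gradient \<Omega> u x"
proof -
  have \<Omega>m: "\<Omega> \<in> sets lebesgue" using \<Omega> by (intro sets_completionI_sets) auto
  have u0: "u x = 0" if "x \<notin> \<Omega>" for x using u that by (simp add: W1inf_def)
  have w0: "w x = 0" if "x \<notin> \<Omega>" for x using that by (simp add: w_def)
  obtain B where B: "\<And>x. \<bar>u x\<bar> \<le> B" "B \<ge> 0" using W1inf_bounded[OF \<Omega>(1) u] by blast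
  have w_eq: "w = (\<lambda>x. u x + c * indicator \<Omega> x)" using u0 by (auto simp: w_def fun_eq_iff)
  have wm: "w \<in> borel_measurable lebesgue"
    unfolding w_eq using W1inf_measurable[OF \<Omega>(1) u] \<Omega>m by measurable
  have "\<bar>w x\<bar> \<le> B + \<bar>c\<bar>" for x using B(1)[of x] B(2) by (auto simp: w_def)
  then have wL: "w \<in> Linf \<Omega>"
    using measurable_restrict_space1[OF wm] unfolding Linf_def by auto
  have g: "is_weak_gradient \<Omega> w (weak_gradient \<Omega> u)"
  proof (rule is_weak_gradientI[OF \<Omega>(1) w0])
    fix \<phi> b assume \<phi>: "test_function \<Omega> \<phi>" and b: "b \<in> (Basis :: 'a set)"
    let ?D = "\<lambda>x. frechet_derivative \<phi> (at x) b"
    note D = test_function_partial[OF \<phi> b]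
    have "w x * ?D x = u x * ?D x + c * ?D x" for x
      using test_function_eq_0[OF D, of x] u0[of x] by (auto simp: w_def algebra_simps)
    moreover have "integrable lebesgue (\<lambda>x. u x * ?D x)"
      using B W1inf_measurable[OF \<Omega>(1) u] test_function_integrable[OF D]
      by (intro integrable_mult_bounded[of _ _ B]) auto
    ultimately have "(LINT x|lebesgue. w x * ?D x) = (LINT x|lebesgue. u x * ?D x)"
      using test_function_integrable[OF D] integral_test_function_partial[OF \<phi> b] by simp
    then show "(LINT x|lebesgue. w x * ?D x) =
        - (LINT x|lebesgue. (if x \<in> \<Omega> then weak_gradient \<Omega> u x \<bullet> b else 0) * \<phi> x)"
      using weak_gradient_integral[OF \<Omega>(1) u0 weak_gradient(2)[OF u] \<phi> b] by simp
  qed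
  have "continuous_on \<Omega> (\<lambda>x. u x + c)" using u by (auto simp: W1inf_def intro!: continuous_intros)
  then have "continuous_on \<Omega> w" by (rule continuous_on_eq) (simp add: w_def)
  then show wW: "w \<in> W1inf \<Omega>" using wL w0 weak_gradient(1)[OF u] g unfolding W1inf_def by auto
  show "AE x in lebesgue_on \<Omega>. weak_gradient \<Omega> w x = weak_gradient \<Omega> u x"
    by (rule weak_gradient_unique[OF \<Omega> w0 weak_gradient[OF wW] weak_gradient(1)[OF u] g])
qed


subsection \<open>Weak* convergence and closedness\<close>

text \<open>Eventual membership passes to finite intersections and to unions, so the subbasic sets
  given by the pairings suffice.\<close>

lemma limitin_weak_star_Linf:
  fixes g :: "nat \<Rightarrow> 'a::euclidean_space \<Rightarrow> 'b::euclidean_space"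
  assumes g: "\<And>n. g n \<in> Linf \<Omega>" "l \<in> Linf \<Omega>"
    and lim: "\<And>h. integrable (lebesgue_on \<Omega>) h \<Longrightarrow>
      (\<lambda>n. LINT x|lebesgue_on \<Omega>. g n x \<bullet> h x) \<longlonglongrightarrow> (LINT x|lebesgue_on \<Omega>. l x \<bullet> h x)"
  shows "limitin (weak_star_Linf \<Omega>) g l sequentially"
proof -
  let ?S = "{{g \<in> Linf \<Omega>. (LINT x|lebesgue_on \<Omega>. g x \<bullet> h x) \<in> V} | (h :: 'a \<Rightarrow> 'b) V.
        integrable (lebesgue_on \<Omega>) h \<and> open V}"
  have "\<forall>\<^sub>F n in sequentially. g n \<in> U" if "generate_topology_on ?S U" "l \<in> U" for U
    using that
  proof induction
    case (Int a b)
    then show ?case by (auto intro: eventually_conj)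
  next
    case (UN K)
    then obtain k where k: "k \<in> K" "l \<in> k" by blast
    show ?case by (rule eventually_mono[OF UN.IH[OF k]]) (use k in blast)
  next
    case (Basis s)
    then obtain h :: "'a \<Rightarrow> 'b" and V where s: "s = {g \<in> Linf \<Omega>. (LINT x|lebesgue_on \<Omega>. g x \<bullet> h x) \<in> V}"
      "integrable (lebesgue_on \<Omega>) h" "open V" by blast
    have "\<forall>\<^sub>F n in sequentially. (LINT x|lebesgue_on \<Omega>. g n x \<bullet> h x) \<in> V"
      using lim[OF s(2)] s(3) Basis(2) s(1) by (intro topological_tendstoD) auto
    then show ?case by eventually_elim (simp add: s(1) g)
  qed simp
  then show ?thesis
    using g(2) by (auto simp: limitin_def weak_star_Linf_def[symmetric]
        openin_topology_generated_by_iff[of ?S, folded weak_star_Linf_def])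
qed

lemma uniform_limit_weak_star:
  fixes \<Omega> :: "'a::euclidean_space set"
  assumes \<Omega>: "open \<Omega>" and w: "\<And>n. w n \<in> W1inf \<Omega>" and u: "u \<in> W1inf \<Omega>"
    and conv: "\<And>n x. \<bar>w n x - u x\<bar> \<le> d n" "d \<longlonglongrightarrow> (0::real)"
    and h: "integrable (lebesgue_on \<Omega>) h"
  shows "(\<lambda>n. LINT x|lebesgue_on \<Omega>. w n x * h x) \<longlonglongrightarrow> (LINT x|lebesgue_on \<Omega>. u x * h x)"
proof -
  have meas: "v \<in> borel_measurable (lebesgue_on \<Omega>)" if "v \<in> W1inf \<Omega>" for v
    using that by (simp add: W1inf_def Linf_def)
  have int: "integrable (lebesgue_on \<Omega>) (\<lambda>x. v x * h x)" if v: "v \<in> W1inf \<Omega>" for v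
  proof -
    obtain B where "\<And>x. \<bar>v x\<bar> \<le> B" using W1inf_bounded[OF \<Omega> v] by blast
    then show ?thesis using meas[OF v] h by (intro integrable_mult_bounded[of _ _ B]) auto
  qed
  have "norm ((LINT x|lebesgue_on \<Omega>. w n x * h x) - (LINT x|lebesgue_on \<Omega>. u x * h x)) \<le>
      d n * (LINT x|lebesgue_on \<Omega>. \<bar>h x\<bar>)" for n
  proof -
    have "(LINT x|lebesgue_on \<Omega>. w n x * h x) - (LINT x|lebesgue_on \<Omega>. u x * h x) =
        (LINT x|lebesgue_on \<Omega>. (w n x - u x) * h x)"
      using int[OF w] int[OF u] by (simp add: left_diff_distrib)
    moreover have "\<bar>LINT x|lebesgue_on \<Omega>. (w n x - u x) * h x\<bar> \<le> d n * (LINT x|lebesgue_on \<Omega>. \<bar>h x\<bar>)"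
      using conv(1) meas[OF w] meas[OF u] h by (intro integral_mult_bounded_on) auto
    ultimately show ?thesis by simp
  qed
  then have "(\<lambda>n. (LINT x|lebesgue_on \<Omega>. w n x * h x) - (LINT x|lebesgue_on \<Omega>. u x * h x)) \<longlonglongrightarrow> 0"
    by (intro Lim_null_comparison[OF always_eventually[OF allI] tendsto_mult_left_zero[OF conv(2)]])
  then show ?thesis by (simp add: LIM_zero_iff)
qed

text \<open>Against a test function the gradient is integrated by parts back onto
  \<open>w n\<close>, where uniform convergence applies. The common Lipschitz constant bounds the
  gradients, and density does the rest.\<close>

lemma uniform_limit_weak_gradient_component:
  fixes \<Omega> :: "'a::euclidean_space set"
  assumes \<Omega>: "open \<Omega>" "bounded \<Omega>" and w: "\<And>n. w n \<in> W1inf \<Omega>" "\<And>n. segment_lipschitz \<Omega> L (w n)"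
    and u: "u \<in> W1inf \<Omega>" "segment_lipschitz \<Omega> L u" and "L \<ge> 0"
    and conv: "\<And>n x. \<bar>w n x - u x\<bar> \<le> d n" "d \<longlonglongrightarrow> (0::real)"
    and h: "integrable (lebesgue_on \<Omega>) h" and b: "b \<in> Basis"
  shows "(\<lambda>n. LINT x|lebesgue_on \<Omega>. (weak_gradient \<Omega> (w n) x \<bullet> b) * h x)
           \<longlonglongrightarrow> (LINT x|lebesgue_on \<Omega>. (weak_gradient \<Omega> u x \<bullet> b) * h x)"
proof -
  have \<Omega>m: "\<Omega> \<in> sets lebesgue" using \<Omega> by (intro sets_completionI_sets) auto
  let ?k = "\<lambda>v x. if x \<in> \<Omega> then weak_gradient \<Omega> v x \<bullet> b else 0"
  let ?h = "\<lambda>x. if x \<in> \<Omega> then h x else 0"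
  have ih: "integrable lebesgue ?h" using h Lebesgue_Measure.integrable_restrict_UNIV[OF \<Omega>m] by blast
  have eq: "(LINT x|lebesgue_on \<Omega>. (weak_gradient \<Omega> v x \<bullet> b) * h x) = (LINT x|lebesgue. ?k v x * ?h x)" for v
  proof -
    have "(LINT x|lebesgue_on \<Omega>. (weak_gradient \<Omega> v x \<bullet> b) * h x) = (LINT x|lebesgue_on \<Omega>. ?k v x * ?h x)"
      by (intro Bochner_Integration.integral_cong) auto
    also have "\<dots> = (LINT x|lebesgue. ?k v x * ?h x)" by (intro integral_lebesgue_on_eq[OF \<Omega>m]) auto
    finally show ?thesis .
  qed
  have bd: "AE x in lebesgue. x \<in> \<Omega> \<longrightarrow> \<bar>?k v x\<bar> \<le> L" if v: "v \<in> W1inf \<Omega>" "segment_lipschitz \<Omega> L v" for v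
    using segment_lipschitz_gradient_bound[OF \<Omega> v(1) weak_gradient[OF v(1)] v(2) \<open>L \<ge> 0\<close> b]
    by eventually_elim auto
  have "(\<lambda>n. LINT x|lebesgue. ?k (w n) x * ?h x) \<longlonglongrightarrow> (LINT x|lebesgue. ?k u x * ?h x)"
  proof (rule test_pairing_convergence_extends[OF \<Omega>(1) _ bd[OF w] _ bd[OF u] _ ih _ \<open>L \<ge> 0\<close>])
    show "?k (w n) \<in> borel_measurable lebesgue" for n
      by (rule Linf_component(1)[OF \<Omega>(1) weak_gradient(1)[OF w(1)] b])
    show "?k u \<in> borel_measurable lebesgue"
      by (rule Linf_component(1)[OF \<Omega>(1) weak_gradient(1)[OF u(1)] b])
    fix \<phi> assume \<phi>: "test_function \<Omega> \<phi>"
    let ?D = "\<lambda>x. frechet_derivative \<phi> (at x) b"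
    note D = test_function_partial[OF \<phi> b]
    have "integrable (lebesgue_on \<Omega>) ?D"
      using integrable_mult_bounded[OF borel_measurable_indicator[OF \<Omega>m] _ test_function_integrable[OF D], of 1]
        integrable_restrict_space[of \<Omega> lebesgue ?D] \<Omega>m by (auto simp: indicator_def)
    from uniform_limit_weak_star[OF \<Omega>(1) w(1) u(1) conv this]
    have "(\<lambda>n. LINT x|lebesgue_on \<Omega>. w n x * ?D x) \<longlonglongrightarrow> (LINT x|lebesgue_on \<Omega>. u x * ?D x)" .
    moreover have "(LINT x|lebesgue_on \<Omega>. v x * ?D x) = - (LINT x|lebesgue. ?k v x * \<phi> x)"
      if v: "v \<in> W1inf \<Omega>" for v
    proof -
      have v0: "v x = 0" if "x \<notin> \<Omega>" for x using v that by (simp add: W1inf_def)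
      have "(LINT x|lebesgue_on \<Omega>. v x * ?D x) = (LINT x|lebesgue. v x * ?D x)"
        using v0 by (intro integral_lebesgue_on_eq[OF \<Omega>m]) auto
      then show ?thesis using weak_gradient_integral[OF \<Omega>(1) v0 weak_gradient(2)[OF v] \<phi> b] by simp
    qed
    ultimately have "(\<lambda>n. - (LINT x|lebesgue. ?k (w n) x * \<phi> x)) \<longlonglongrightarrow> - (LINT x|lebesgue. ?k u x * \<phi> x)"
      using w(1) u(1) by simp
    then show "(\<lambda>n. LINT x|lebesgue. ?k (w n) x * \<phi> x) \<longlonglongrightarrow> (LINT x|lebesgue. ?k u x * \<phi> x)"
      by (rule tendsto_minus_cancel)
  qed simp
  then show ?thesis unfolding eq .
qed

lemma limitin_wstar:
  fixes \<Omega> :: "'a::euclidean_space set"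
  assumes \<Omega>: "open \<Omega>" "bounded \<Omega>" and w: "\<And>n. w n \<in> W1inf \<Omega>" "\<And>n. segment_lipschitz \<Omega> L (w n)"
    and u: "u \<in> W1inf \<Omega>" "segment_lipschitz \<Omega> L u" and "L \<ge> 0"
    and conv: "\<And>n x. \<bar>w n x - u x\<bar> \<le> d n" "d \<longlonglongrightarrow> (0::real)"
  shows "limitin (wstar \<Omega>) w u sequentially"
proof -
  have W: "v \<in> Linf \<Omega>" if "v \<in> W1inf \<Omega>" for v using that by (simp add: W1inf_def)
  have l1: "limitin (weak_star_Linf \<Omega>) w u sequentially"
    using uniform_limit_weak_star[OF \<Omega>(1) w(1) u(1) conv] W w(1) u(1)
    by (intro limitin_weak_star_Linf) auto
  have l2: "limitin (weak_star_Linf \<Omega>) (\<lambda>n. weak_gradient \<Omega> (w n)) (weak_gradient \<Omega> u) sequentially"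
  proof (rule limitin_weak_star_Linf)
    fix h :: "'a \<Rightarrow> 'a" assume h: "integrable (lebesgue_on \<Omega>) h"
    have hb: "integrable (lebesgue_on \<Omega>) (\<lambda>x. h x \<bullet> b)" for b using h by simp
    have eq: "(LINT x|lebesgue_on \<Omega>. weak_gradient \<Omega> v x \<bullet> h x) =
        (\<Sum>b\<in>Basis. LINT x|lebesgue_on \<Omega>. (weak_gradient \<Omega> v x \<bullet> b) * (h x \<bullet> b))" if v: "v \<in> W1inf \<Omega>" for v
    proof -
      note g = weak_gradient(1)[OF v]
      obtain C where C: "AE x in lebesgue_on \<Omega>. norm (weak_gradient \<Omega> v x) \<le> C" using g by (auto simp: Linf_def)
      have "integrable (lebesgue_on \<Omega>) (\<lambda>x. (weak_gradient \<Omega> v x \<bullet> b) * (h x \<bullet> b))" if b: "b \<in> Basis" for b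
      proof (rule integrable_mult_bounded[OF _ _ hb])
        show "(\<lambda>x. weak_gradient \<Omega> v x \<bullet> b) \<in> borel_measurable (lebesgue_on \<Omega>)"
          using g by (auto simp: Linf_def)
        show "AE x in lebesgue_on \<Omega>. \<bar>weak_gradient \<Omega> v x \<bullet> b\<bar> \<le> C"
          using C by eventually_elim (use Basis_le_norm[OF b] order_trans in blast)
      qed
      then show ?thesis by (subst euclidean_inner) simp
    qed
    show "(\<lambda>n. LINT x|lebesgue_on \<Omega>. weak_gradient \<Omega> (w n) x \<bullet> h x)
        \<longlonglongrightarrow> (LINT x|lebesgue_on \<Omega>. weak_gradient \<Omega> u x \<bullet> h x)"
      unfolding eq[OF w(1)] eq[OF u(1)]
      by (intro tendsto_sum uniform_limit_weak_gradient_component[OF \<Omega> w u \<open>L \<ge> 0\<close> conv hb])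
  qed (use weak_gradient(1) w(1) u(1) in auto)
  have l: "limitin (prod_topology (weak_star_Linf \<Omega>) (weak_star_Linf \<Omega>))
      (\<lambda>n. (w n, weak_gradient \<Omega> (w n))) (u, weak_gradient \<Omega> u) sequentially"
    using l1 l2 by (simp add: limitin_pairwise o_def)
  show ?thesis
    unfolding limitin_def
  proof (intro conjI allI impI)
    show "u \<in> topspace (wstar \<Omega>)" using u(1) by simp
    fix U assume U: "openin (wstar \<Omega>) U \<and> u \<in> U"
    then obtain V where V: "openin (prod_topology (weak_star_Linf \<Omega>) (weak_star_Linf \<Omega>)) V"
      "U = (\<lambda>u. (u, weak_gradient \<Omega> u)) -` V \<inter> W1inf \<Omega>"
      unfolding wstar_def openin_pullback_topology by blast
    then have "\<forall>\<^sub>F n in sequentially. (w n, weak_gradient \<Omega> (w n)) \<in> V"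
      using l U unfolding limitin_def by blast
    then show "\<forall>\<^sub>F n in sequentially. w n \<in> U" by eventually_elim (simp add: V(2) w(1))
  qed
qed

section \<open>Closedness of difference constraints\<close>

lemma openin_wstar_pairing:
  assumes h: "integrable (lebesgue_on \<Omega>) h" and V: "open V"
  shows "openin (wstar \<Omega>) {u \<in> W1inf \<Omega>. (LINT x|lebesgue_on \<Omega>. u x * h x) \<in> V}"
proof -
  let ?N = "{g \<in> Linf \<Omega>. (LINT x|lebesgue_on \<Omega>. g x \<bullet> h x) \<in> V}"
  have "openin (weak_star_Linf \<Omega>) ?N"
    unfolding weak_star_Linf_def by (rule topology_generated_by_Basis) (use assms in blast)
  moreover have "openin (weak_star_Linf \<Omega>) (Linf \<Omega> :: ('a \<Rightarrow> 'a) set)"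
    using openin_topspace[of "weak_star_Linf \<Omega> :: ('a \<Rightarrow> 'a) topology"] by simp
  ultimately have "openin (prod_topology (weak_star_Linf \<Omega>) (weak_star_Linf \<Omega>)) (?N \<times> (Linf \<Omega> :: ('a \<Rightarrow> 'a) set))"
    by (simp add: openin_prod_Times_iff)
  moreover have "{u \<in> W1inf \<Omega>. (LINT x|lebesgue_on \<Omega>. u x * h x) \<in> V} =
      (\<lambda>u. (u, weak_gradient \<Omega> u)) -` (?N \<times> Linf \<Omega>) \<inter> W1inf \<Omega>"
    using weak_gradient(1) by (auto simp: W1inf_def)
  ultimately show ?thesis unfolding wstar_def openin_pullback_topology by blast
qed

text \<open>\<open>D\<close> is arbitrary here: closedness rests on the form of the constraints and,
  for the weak* topology, on a common Lipschitz constant.\<close>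

definition diff_bounded :: "'a::euclidean_space set \<Rightarrow> ('a \<Rightarrow> 'a \<Rightarrow> ereal) \<Rightarrow> ('a \<Rightarrow> real) set" where
  "diff_bounded \<Omega> D = {u \<in> W1inf \<Omega>. \<forall>x\<in>\<Omega>. \<forall>y\<in>\<Omega>. ereal (u x - u y) \<le> D x y}"

lemma closedin_tau_inf_diff_bounded:
  fixes \<Omega> :: "'a::euclidean_space set"
  assumes "open \<Omega>"
  shows "closedin (tau_inf \<Omega>) (diff_bounded \<Omega> D)"
proof -
  interpret Metric_space "W1inf \<Omega>" "Linf_dist \<Omega>" by (rule Metric_space_Linf_dist[OF assms])
  show ?thesis
    unfolding tau_inf_def metric_closedin_iff_sequentially_closed
  proof (intro conjI allI impI)
    show "diff_bounded \<Omega> D \<subseteq> W1inf \<Omega>" by (auto simp: diff_bounded_def)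
    fix s l assume *: "range s \<subseteq> diff_bounded \<Omega> D \<and> limitin mtopology s l sequentially"
    then have l: "l \<in> W1inf \<Omega>" and lim: "\<And>e. e > 0 \<Longrightarrow> \<forall>\<^sub>F n in sequentially. s n \<in> W1inf \<Omega> \<and> Linf_dist \<Omega> (s n) l < e"
      by (auto simp: limitin_metric)
    have pw: "(\<lambda>n. s n x) \<longlonglongrightarrow> l x" if "x \<in> \<Omega>" for x
    proof (rule tendstoI)
      fix e :: real assume "e > 0"
      then show "\<forall>\<^sub>F n in sequentially. dist (s n x) (l x) < e"
      proof (rule eventually_mono[OF lim])
        fix n assume n: "s n \<in> W1inf \<Omega> \<and> Linf_dist \<Omega> (s n) l < e"
        have "\<bar>s n x - l x\<bar> \<le> Linf_dist \<Omega> (s n) l"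
          using Linf_dist_le_iff[OF assms _ _ l, of "s n" "Linf_dist \<Omega> (s n) l"] n that by blast
        then show "dist (s n x) (l x) < e" using n by (simp add: dist_real_def)
      qed
    qed
    have "ereal (l x - l y) \<le> D x y" if "x \<in> \<Omega>" "y \<in> \<Omega>" for x y
    proof (rule LIMSEQ_le_const2)
      show "(\<lambda>n. ereal (s n x - s n y)) \<longlonglongrightarrow> ereal (l x - l y)"
        using pw that by (intro tendsto_intros) auto
      show "\<exists>N. \<forall>n\<ge>N. ereal (s n x - s n y) \<le> D x y"
        using * that by (fastforce simp: diff_bounded_def)
    qed
    then show "l \<in> diff_bounded \<Omega> D" using l by (simp add: diff_bounded_def)
  qed
qed

text \<open>The kernel has integral 1, so the average differs from the value at the centre by at
  most the oscillation on the ball. Its integrability makes the average an admissible weak*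
  pairing.\<close>

lemma ball_average_close:
  fixes v :: "'a::euclidean_space \<Rightarrow> real"
  assumes v: "v \<in> borel_measurable (lebesgue_on \<Omega>)" and \<Omega>: "open \<Omega>" and r: "r > 0" "ball x r \<subseteq> \<Omega>"
    and e: "\<And>z. z \<in> ball x r \<Longrightarrow> \<bar>v z - v x\<bar> \<le> e"
  shows "integrable (lebesgue_on \<Omega>) (\<lambda>z. indicator (ball x r) z / measure lebesgue (ball x r))"
    and "integrable (lebesgue_on \<Omega>) (\<lambda>z. v z * (indicator (ball x r) z / measure lebesgue (ball x r)))"
    and "\<bar>(LINT z|lebesgue_on \<Omega>. v z * (indicator (ball x r) z / measure lebesgue (ball x r))) - v x\<bar> \<le> e"
proof -
  let ?B = "ball x r" and ?M = "lebesgue_on \<Omega>"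
  let ?c = "measure lebesgue ?B"
  have \<Omega>m: "\<Omega> \<in> sets lebesgue" using \<Omega> by (intro sets_completionI_sets) auto
  have c: "?c > 0" using r(1) by (simp add: content_ball_pos)
  have Bm: "?B \<in> sets ?M" using r(2) \<Omega>m by (auto simp: sets_restrict_space image_iff Int_absorb1 intro!: bexI[of _ ?B])
  have mB: "measure ?M ?B = ?c" "emeasure ?M ?B < \<infinity>"
    using r(2) \<Omega>m emeasure_bounded_finite[of ?B]
    by (auto simp: measure_restrict_space emeasure_restrict_space)
  have iB: "integrable ?M (indicator ?B :: 'a \<Rightarrow> real)"
    using Bm mB(2) by (rule integrable_real_indicator)
  then show ik: "integrable ?M (\<lambda>z. indicator ?B z / ?c)" by simp
  have bd: "AE z in ?M. indicator ?B z / ?c \<noteq> 0 \<longrightarrow> \<bar>v z - v x\<bar> \<le> e"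
    by (rule AE_I2) (use e in \<open>auto simp: indicator_def split: if_splits\<close>)
  have vm: "(\<lambda>z. v z - v x) \<in> borel_measurable ?M" using v by simp
  have i1: "integrable ?M (\<lambda>z. (v z - v x) * (indicator ?B z / ?c))"
    by (rule integrable_mult_bounded_on[OF vm bd ik])
  have "integrable ?M (\<lambda>z. (v z - v x) * (indicator ?B z / ?c) + v x * (indicator ?B z / ?c))"
    by (rule Bochner_Integration.integrable_add[OF i1 integrable_mult_right[OF ik]])
  then show iv: "integrable ?M (\<lambda>z. v z * (indicator ?B z / ?c))"
    by (simp only: distrib_right[symmetric] diff_add_cancel)
  have one: "(LINT z|?M. indicator ?B z / ?c) = 1"
  proof -
    have "(LINT z|?M. indicator ?B z) = measure ?M ?B"
      using Bm r(2) by (simp add: Int_absorb2)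
    then show ?thesis using mB(1) c by simp
  qed
  have e1: "(LINT z|?M. v z * (indicator ?B z / ?c)) - v x = (LINT z|?M. (v z - v x) * (indicator ?B z / ?c))"
  proof -
    have "(LINT z|?M. (v z - v x) * (indicator ?B z / ?c)) =
        (LINT z|?M. v z * (indicator ?B z / ?c) - v x * (indicator ?B z / ?c))"
      by (simp only: left_diff_distrib)
    also have "\<dots> = (LINT z|?M. v z * (indicator ?B z / ?c)) - (LINT z|?M. v x * (indicator ?B z / ?c))"
      by (rule Bochner_Integration.integral_diff[OF iv integrable_mult_right[OF ik]])
    also have "(LINT z|?M. v x * (indicator ?B z / ?c)) = v x"
      using one by (simp only: integral_mult_right_zero mult_1_right)
    finally show ?thesis by simp
  qed
  have e2: "\<bar>LINT z|?M. (v z - v x) * (indicator ?B z / ?c)\<bar> \<le> e * (LINT z|?M. \<bar>indicator ?B z / ?c\<bar>)"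
    by (rule integral_mult_bounded_on[OF vm bd ik])
  have e3: "(LINT z|?M. \<bar>indicator ?B z / ?c\<bar>) = 1" using one c by simp
  show "\<bar>(LINT z|?M. v z * (indicator ?B z / ?c)) - v x\<bar> \<le> e"
    using e2 unfolding e1 e3 mult_1_right .
qed

text \<open>Point evaluations are replaced by averages over small balls, which are pairings with
  \<open>L\<^sup>1\<close> functions; the error is controlled because the set is equi-Lipschitz.\<close>

lemma closedin_wstar_diff_bounded:
  fixes \<Omega> :: "'a::euclidean_space set"
  assumes \<Omega>: "open \<Omega>" and L: "L \<ge> 0" "\<And>v. v \<in> diff_bounded \<Omega> D \<Longrightarrow> segment_lipschitz \<Omega> L v"
  shows "closedin (wstar \<Omega>) (diff_bounded \<Omega> D)"
proof -
  have sub: "diff_bounded \<Omega> D \<subseteq> W1inf \<Omega>" by (auto simp: diff_bounded_def)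
  have "\<exists>N. openin (wstar \<Omega>) N \<and> u \<in> N \<and> N \<subseteq> W1inf \<Omega> - diff_bounded \<Omega> D"
    if "u \<in> W1inf \<Omega> - diff_bounded \<Omega> D" for u
  proof -
    from that obtain x y where u: "u \<in> W1inf \<Omega>" and xy: "x \<in> \<Omega>" "y \<in> \<Omega>" "D x y < ereal (u x - u y)"
      by (force simp: diff_bounded_def)
    obtain c where c: "D x y < ereal c" "ereal c < ereal (u x - u y)"
      using ereal_dense2[OF xy(3)] by blast
    \<comment> \<open>Averaging costs at most \<open>2 * e\<close>. This leaves at least
      \<open>c + 6 * e\<close> for \<open>u\<close> and at most \<open>c + 2 * e\<close> for members
      of the set, so the threshold \<open>c + 4 * e\<close> separates them.\<close>
    define e where "e = (u x - u y - c) / 8"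
    have e: "e > 0" using c(2) by (simp add: e_def)
    have near: "\<exists>d>0. ball p d \<subseteq> \<Omega> \<and> (\<forall>z\<in>ball p d. \<bar>u z - u p\<bar> \<le> e)" if p: "p \<in> \<Omega>" for p
    proof -
      have "isCont u p" using u p \<Omega> by (auto simp: W1inf_def continuous_on_eq_continuous_at)
      then obtain d where d: "d > 0" "\<And>z. dist z p < d \<Longrightarrow> dist (u z) (u p) < e"
        using e unfolding continuous_at_eps_delta by meson
      obtain d' where d': "d' > 0" "ball p d' \<subseteq> \<Omega>" using p \<Omega> open_contains_ball by blast
      show ?thesis
        using d d' by (intro exI[of _ "min d d'"])
          (force simp: dist_real_def dist_commute intro: less_imp_le)
    qed
    obtain d1 where d1: "d1 > 0" "ball x d1 \<subseteq> \<Omega>" "\<And>z. z \<in> ball x d1 \<Longrightarrow> \<bar>u z - u x\<bar> \<le> e"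
      using near[OF xy(1)] by blast
    obtain d2 where d2: "d2 > 0" "ball y d2 \<subseteq> \<Omega>" "\<And>z. z \<in> ball y d2 \<Longrightarrow> \<bar>u z - u y\<bar> \<le> e"
      using near[OF xy(2)] by blast
    \<comment> \<open>Below \<open>d1\<close> and \<open>d2\<close> continuity controls
      \<open>u\<close>, which lies outside the set and has no Lipschitz bound at hand; below
      \<open>e / (L + 1)\<close> the constant \<open>L\<close> controls every member of the
      set.\<close>
    define r where "r = min (min d1 d2) (e / (L + 1))"
    have r: "r > 0" "L * r \<le> e" "r \<le> d1" "r \<le> d2"
    proof -
      show "r > 0" using d1 d2 e L by (simp add: r_def add_nonneg_pos)
      have "L * r \<le> (L + 1) * (e / (L + 1))"
        using L(1) e by (intro mult_mono) (use d1(1) d2(1) in \<open>auto simp: r_def\<close>)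
      then show "L * r \<le> e" using L(1) by simp
      show "r \<le> d1" "r \<le> d2" by (auto simp: r_def)
    qed
    have sb: "ball x r \<subseteq> \<Omega>" "ball y r \<subseteq> \<Omega>" using r d1 d2 by (force)+
    let ?I = "\<lambda>p z. indicator (ball p r) z / measure lebesgue (ball p r) :: real"
    let ?h = "\<lambda>z. ?I x z - ?I y z"
    have meas: "v \<in> borel_measurable (lebesgue_on \<Omega>)" if "v \<in> W1inf \<Omega>" for v
      using that by (simp add: W1inf_def Linf_def)
    have avg: "\<bar>(LINT z|lebesgue_on \<Omega>. v z * ?h z) - (v x - v y)\<bar> \<le> 2 * e" "integrable (lebesgue_on \<Omega>) ?h"
      if v: "v \<in> W1inf \<Omega>" "\<And>z. z \<in> ball x r \<Longrightarrow> \<bar>v z - v x\<bar> \<le> e" "\<And>z. z \<in> ball y r \<Longrightarrow> \<bar>v z - v y\<bar> \<le> e" for v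
    proof -
      note X = ball_average_close[OF meas[OF v(1)] \<Omega> r(1) sb(1) v(2)]
      note Y = ball_average_close[OF meas[OF v(1)] \<Omega> r(1) sb(2) v(3)]
      show "integrable (lebesgue_on \<Omega>) ?h" using X(1) Y(1) by (rule Bochner_Integration.integrable_diff)
      have "(LINT z|lebesgue_on \<Omega>. v z * ?h z) =
          (LINT z|lebesgue_on \<Omega>. v z * ?I x z) - (LINT z|lebesgue_on \<Omega>. v z * ?I y z)"
        unfolding right_diff_distrib using X(2) Y(2) by (rule Bochner_Integration.integral_diff)
      then show "\<bar>(LINT z|lebesgue_on \<Omega>. v z * ?h z) - (v x - v y)\<bar> \<le> 2 * e"
        using X(3) Y(3) by linarith
    qed
    define N where "N = {v \<in> W1inf \<Omega>. (LINT z|lebesgue_on \<Omega>. v z * ?h z) \<in> {c + 4 * e<..}}"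
    have near_u: "\<bar>u z - u x\<bar> \<le> e" if "z \<in> ball x r" for z using that r d1(3) by auto
    have near_u': "\<bar>u z - u y\<bar> \<le> e" if "z \<in> ball y r" for z using that r d2(3) by auto
    note au = avg[OF u near_u near_u']
    have "openin (wstar \<Omega>) N"
      unfolding N_def by (rule openin_wstar_pairing[OF au(2)]) auto
    moreover have "u \<in> N"
    proof -
      have "8 * e = u x - u y - c" by (simp add: e_def)
      then have "(LINT z|lebesgue_on \<Omega>. v z * ?h z) > c + 4 * e" if "v = u" for v
        unfolding that using au(1) e by linarith
      then show ?thesis using u by (simp add: N_def)
    qed
    moreover have "v \<notin> N" if v: "v \<in> diff_bounded \<Omega> D" for v
    proof -
      have "ereal (v x - v y) \<le> D x y" using v xy by (simp add: diff_bounded_def)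
      then have "ereal (v x - v y) < ereal c" using c(1) by (rule le_less_trans)
      then have "v x - v y < c" by simp
      have lip: "\<bar>v z - v p\<bar> \<le> e" if "z \<in> ball p r" "ball p r \<subseteq> \<Omega>" for z p
      proof -
        have "closed_segment z p \<subseteq> ball p r" using that r(1) by (intro closed_segment_subset) auto
        then have "\<bar>v z - v p\<bar> \<le> L * norm (z - p)"
          using segment_lipschitzD[OF L(2)[OF v]] that(2) by blast
        also have "\<dots> \<le> L * r"
          using that(1) L(1) by (intro mult_left_mono) (auto simp: dist_norm norm_minus_commute)
        finally show ?thesis using r(2) by simp
      qed
      have "v \<in> W1inf \<Omega>" using v sub by blast
      from avg(1)[OF this lip[OF _ sb(1)] lip[OF _ sb(2)]]
      have "(LINT z|lebesgue_on \<Omega>. v z * ?h z) \<le> c + 2 * e" using \<open>v x - v y < c\<close> by linarith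
      then show ?thesis using e by (simp add: N_def)
    qed
    ultimately show ?thesis unfolding N_def by blast
  qed
  then have "openin (wstar \<Omega>) (W1inf \<Omega> - diff_bounded \<Omega> D)"
    by (subst openin_subopen) blast
  then show ?thesis using sub by (simp add: closedin_def)
qed


subsection \<open>Geometry of Lipschitz domains\<close>

text \<open>Near a boundary point, two points of \<open>\<Omega>\<close> are joined by going up in the direction \<open>\<nu>\<close> by a multiple of
  their distance to the point, across, and down again.\<close>

lemma lipschitz_boundary_local_oscillation:
  fixes \<Omega> :: "'a::euclidean_space set"
  assumes \<Omega>: "open \<Omega>" "lipschitz_boundary \<Omega>" and p: "p \<in> closure \<Omega>" and L: "L \<ge> 0" and e: "e > 0"
  shows "\<exists>s>0. \<forall>x\<in>\<Omega> \<inter> ball p s. \<forall>y\<in>\<Omega> \<inter> ball p s. \<forall>w. segment_lipschitz \<Omega> L w \<longrightarrow> \<bar>w x - w y\<bar> \<le> e"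
proof (cases "p \<in> \<Omega>")
  case True
  then obtain r where r: "r > 0" "ball p r \<subseteq> \<Omega>" using \<Omega> open_contains_ball by blast
  define s where "s = min r (e / (2 * (L + 1)))"
  have s: "s > 0" "s \<le> r" "s \<le> e / (2 * (L + 1))" using r e L by (auto simp: s_def)
  have "\<bar>w x - w y\<bar> \<le> e" if x: "x \<in> ball p s" and y: "y \<in> ball p s" and w: "segment_lipschitz \<Omega> L w" for x y w
  proof -
    have "closed_segment x y \<subseteq> ball p s" using x y by (intro closed_segment_subset) auto
    then have "closed_segment x y \<subseteq> \<Omega>" using s(2) r(2) by force
    then have "\<bar>w x - w y\<bar> \<le> L * norm (x - y)" by (rule segment_lipschitzD[OF w])
    also have "\<dots> \<le> (L + 1) * (2 * s)"
    proof (rule mult_mono)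
      show "norm (x - y) \<le> 2 * s" using x y dist_triangle2[of x y p] by (simp add: dist_norm norm_minus_commute)
    qed (use L in auto)
    also have "\<dots> \<le> e" using s(3) L by (simp add: field_simps)
    finally show ?thesis .
  qed
  then show ?thesis using s(1) by blast
next
  case False
  then have "p \<in> frontier \<Omega>" using p \<Omega>(1) by (simp add: frontier_def interior_open)
  then obtain \<nu> and \<gamma> :: "'a \<Rightarrow> real" and K r where \<nu>: "norm \<nu> = 1" and r: "r > 0"
    and \<gamma>: "K-lipschitz_on {y. y \<bullet> \<nu> = 0} \<gamma>"
    and graph: "\<Omega> \<inter> ball p r = {x \<in> ball p r. \<gamma> (x - (x \<bullet> \<nu>) *\<^sub>R \<nu>) < x \<bullet> \<nu>}"
    using \<Omega>(2) unfolding lipschitz_boundary_def by meson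
  have K: "K \<ge> 0" using \<gamma> by (rule lipschitz_on_nonneg)
  define P where "P z = z - (z \<bullet> \<nu>) *\<^sub>R \<nu>" for z
  have \<nu>\<nu>: "\<nu> \<bullet> \<nu> = 1" using \<nu> by (simp add: norm_eq_1)
  have P_orth: "P z \<bullet> \<nu> = 0" for z by (simp add: P_def inner_diff_left \<nu>\<nu>)
  have P_shift: "P (z + t *\<^sub>R \<nu>) = P z" for z t
    by (simp add: P_def inner_add_left \<nu>\<nu> scaleR_add_left)
  \<comment> \<open>The factor 2 is crude for an orthogonal projection, but the triangle and
    Cauchy-Schwarz inequalities give it at once.\<close>
  have P_diff: "norm (P z - P z') \<le> 2 * norm (z - z')" for z z'
  proof -
    have "P z - P z' = (z - z') - ((z - z') \<bullet> \<nu>) *\<^sub>R \<nu>"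
      by (simp add: P_def inner_diff_left scaleR_diff_left)
    also have "norm \<dots> \<le> norm (z - z') + \<bar>(z - z') \<bullet> \<nu>\<bar>"
      using norm_triangle_ineq4[of "z - z'" "((z - z') \<bullet> \<nu>) *\<^sub>R \<nu>"] \<nu> by simp
    also have "\<bar>(z - z') \<bullet> \<nu>\<bar> \<le> norm (z - z')" using Cauchy_Schwarz_ineq2[of "z - z'" \<nu>] \<nu> by simp
    finally show ?thesis by simp
  qed
  have in\<Omega>: "z \<in> \<Omega>" if "z \<in> ball p r" "\<gamma> (P z) < z \<bullet> \<nu>" for z
    using that graph unfolding P_def by blast
  \<comment> \<open>Two points of the ball are at most \<open>2 * s\<close> apart: their projections
    differ by at most \<open>4 * s\<close>, so the graph rises by at most \<open>4 * K * s\<close>,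
    while the height of the point drops by at most \<open>2 * s\<close>. Hence the lift
    \<open>h = (4 * K + 2) * s\<close> below. The two bounds on \<open>s\<close> ensure
    \<open>s + h = (4 * K + 3) * s \<le> r\<close>, and that the path, of length at most
    \<open>2 * h + 2 * s = (8 * K + 6) * s\<close>, costs at most \<open>e\<close>.\<close>
  define s where "s = min (r / (4 * K + 3)) (e / ((L + 1) * (8 * K + 6)))"
  have s: "s > 0" "s \<le> r / (4 * K + 3)" "s \<le> e / ((L + 1) * (8 * K + 6))"
    using r e L K by (auto simp: s_def)
  define h where "h = (4 * K + 2) * s"
  have h: "h > 0" "s + h \<le> r"
  proof -
    show "h > 0" using s(1) K by (simp add: h_def)
    show "s + h \<le> r" using s(2) K by (simp add: h_def field_simps add_nonneg_pos)
  qed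
  \<comment> \<open>Moving along \<open>\<nu>\<close> fixes the projection and increases the height,
    so the point stays above the graph.\<close>
  have up: "closed_segment x (x + h *\<^sub>R \<nu>) \<subseteq> \<Omega>" if x: "x \<in> \<Omega>" "x \<in> ball p s" for x
  proof
    fix z assume "z \<in> closed_segment x (x + h *\<^sub>R \<nu>)"
    then obtain \<theta> where \<theta>: "0 \<le> \<theta>" "\<theta> \<le> 1" "z = (1 - \<theta>) *\<^sub>R x + \<theta> *\<^sub>R (x + h *\<^sub>R \<nu>)"
      by (auto simp: closed_segment_def)
    then have z: "z = x + (\<theta> * h) *\<^sub>R \<nu>" by (simp add: algebra_simps)
    have \<theta>h: "0 \<le> \<theta> * h" "\<theta> * h \<le> h" using \<theta> h(1) by (auto simp: mult_left_le_one_le)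
    have "dist x z = \<theta> * h" using \<theta>h \<nu> by (simp add: z dist_norm)
    then have "dist p z < s + h" using dist_triangle[of p z x] x(2) \<theta>h(2) by simp
    then have zb: "z \<in> ball p r" using h(2) by simp
    have "x \<in> ball p r" using x(2) h by simp
    then have "\<gamma> (P x) < x \<bullet> \<nu>" using x(1) graph unfolding P_def by blast
    then have "\<gamma> (P z) < z \<bullet> \<nu>" using \<theta>h(1) by (simp add: z P_shift inner_add_left \<nu>\<nu>)
    then show "z \<in> \<Omega>" by (rule in\<Omega>[OF zb])
  qed
  have across: "closed_segment (x + h *\<^sub>R \<nu>) (y + h *\<^sub>R \<nu>) \<subseteq> \<Omega>"
    if x: "x \<in> \<Omega>" "x \<in> ball p s" and y: "y \<in> ball p s" for x y
  proof
    fix z assume "z \<in> closed_segment (x + h *\<^sub>R \<nu>) (y + h *\<^sub>R \<nu>)"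
    then obtain \<theta> where \<theta>: "0 \<le> \<theta>" "\<theta> \<le> 1" "z = (1 - \<theta>) *\<^sub>R (x + h *\<^sub>R \<nu>) + \<theta> *\<^sub>R (y + h *\<^sub>R \<nu>)"
      by (auto simp: closed_segment_def)
    define q where "q = (1 - \<theta>) *\<^sub>R x + \<theta> *\<^sub>R y"
    have z: "z = q + h *\<^sub>R \<nu>" using \<theta>(3) by (simp add: q_def algebra_simps)
    have q: "q \<in> ball p s"
      using convexD[OF convex_ball x(2) y, of "1 - \<theta>" \<theta>] \<theta> by (simp add: q_def)
    have "dist q z = h" using h(1) \<nu> by (simp add: z dist_norm)
    then have "dist p z < s + h" using dist_triangle[of p z q] q by simp
    then have zb: "z \<in> ball p r" using h(2) by simp
    have qx: "norm (q - x) \<le> 2 * s"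
      using q x(2) dist_triangle2[of q x p] by (simp add: dist_norm norm_minus_commute)
    have "x \<in> ball p r" using x(2) h by simp
    then have *: "\<gamma> (P x) < x \<bullet> \<nu>" using x(1) graph unfolding P_def by blast
    have "dist (\<gamma> (P q)) (\<gamma> (P x)) \<le> K * dist (P q) (P x)"
      using P_orth by (intro lipschitz_onD[OF \<gamma>]) auto
    also have "\<dots> \<le> K * (4 * s)"
      using P_diff[of q x] qx K by (intro mult_left_mono) (auto simp: dist_norm)
    finally have "\<gamma> (P q) \<le> \<gamma> (P x) + 4 * K * s" by (simp add: dist_real_def)
    moreover have "x \<bullet> \<nu> - 2 * s \<le> q \<bullet> \<nu>"
    proof -
      have "\<bar>(q - x) \<bullet> \<nu>\<bar> \<le> norm (q - x)" using Cauchy_Schwarz_ineq2[of "q - x" \<nu>] \<nu> by simp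
      then show ?thesis using qx by (simp add: inner_diff_left)
    qed
    moreover have "z \<bullet> \<nu> = q \<bullet> \<nu> + 4 * K * s + 2 * s"
      by (simp add: z inner_add_left \<nu>\<nu> h_def algebra_simps)
    ultimately have "\<gamma> (P z) < z \<bullet> \<nu>" using * unfolding z P_shift by linarith
    then show "z \<in> \<Omega>" by (rule in\<Omega>[OF zb])
  qed
  have "\<bar>w x - w y\<bar> \<le> e" if x: "x \<in> \<Omega> \<inter> ball p s" and y: "y \<in> \<Omega> \<inter> ball p s" and w: "segment_lipschitz \<Omega> L w" for x y w
  proof -
    have hn: "norm (z - (z + h *\<^sub>R \<nu>)) = h" for z using h(1) \<nu> by simp
    have "\<bar>w x - w (x + h *\<^sub>R \<nu>)\<bar> \<le> L * h" "\<bar>w y - w (y + h *\<^sub>R \<nu>)\<bar> \<le> L * h"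
      using segment_lipschitzD[OF w up, of x] segment_lipschitzD[OF w up, of y] x y hn by auto
    moreover have "\<bar>w (x + h *\<^sub>R \<nu>) - w (y + h *\<^sub>R \<nu>)\<bar> \<le> L * norm (x - y)"
      using segment_lipschitzD[OF w across, of x y] x y by simp
    moreover have "L * norm (x - y) \<le> L * (2 * s)"
      using x y dist_triangle2[of x y p] L by (intro mult_left_mono) (auto simp: dist_norm norm_minus_commute)
    ultimately have "\<bar>w x - w y\<bar> \<le> L * h + L * (2 * s) + L * h" by linarith
    also have "\<dots> = L * ((8 * K + 6) * s)" by (simp add: h_def algebra_simps)
    also have "\<dots> \<le> (L + 1) * ((8 * K + 6) * s)" using K s(1) by (intro mult_right_mono) auto
    also have "\<dots> \<le> e"
    proof -
      have "(L + 1) * (8 * K + 6) > 0" using L K by simp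
      then show ?thesis using s(3) by (simp add: pos_le_divide_eq mult_ac)
    qed
    finally show ?thesis .
  qed
  then show ?thesis using s(1) by blast
qed

text \<open>One finite net serves all functions with the same \<open>L\<close>. Compactness is that
  of the closure, so centres may lie on the boundary; sample points in \<open>\<Omega>\<close>
  replace them because the functions live there.\<close>

lemma lipschitz_boundary_net:
  fixes \<Omega> :: "'a::euclidean_space set"
  assumes \<Omega>: "bounded \<Omega>" "open \<Omega>" "lipschitz_boundary \<Omega>" and L: "L \<ge> 0" and e: "e > 0"
  obtains S where "finite S" "S \<subseteq> \<Omega>"
    "\<And>x. x \<in> \<Omega> \<Longrightarrow> \<exists>s\<in>S. \<forall>w. segment_lipschitz \<Omega> L w \<longrightarrow> \<bar>w x - w s\<bar> \<le> e"
proof -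
  obtain \<rho> where \<rho>: "\<And>p. p \<in> closure \<Omega> \<Longrightarrow> \<rho> p > 0 \<and>
    (\<forall>x\<in>\<Omega> \<inter> ball p (\<rho> p). \<forall>y\<in>\<Omega> \<inter> ball p (\<rho> p). \<forall>w. segment_lipschitz \<Omega> L w \<longrightarrow> \<bar>w x - w y\<bar> \<le> e)"
    using lipschitz_boundary_local_oscillation[OF \<Omega>(2,3) _ L e] by metis
  have "compact (closure \<Omega>)" using \<Omega>(1) by (simp add: compact_closure)
  moreover have "closure \<Omega> \<subseteq> (\<Union>p\<in>closure \<Omega>. ball p (\<rho> p))" using \<rho> by force
  ultimately obtain C where C: "C \<subseteq> closure \<Omega>" "finite C" "closure \<Omega> \<subseteq> (\<Union>p\<in>C. ball p (\<rho> p))"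
    using compactE_image[of "closure \<Omega>" "closure \<Omega>" "\<lambda>p. ball p (\<rho> p)"] by auto
  let ?C = "{p \<in> C. \<Omega> \<inter> ball p (\<rho> p) \<noteq> {}}"
  define \<sigma> where "\<sigma> p = (SOME x. x \<in> \<Omega> \<inter> ball p (\<rho> p))" for p
  have \<sigma>: "\<sigma> p \<in> \<Omega> \<inter> ball p (\<rho> p)" if "p \<in> ?C" for p
    unfolding \<sigma>_def using that by (intro some_in_eq[THEN iffD2]) auto
  show thesis
  proof
    show "finite (\<sigma> ` ?C)" using C(2) by simp
    show "\<sigma> ` ?C \<subseteq> \<Omega>" using \<sigma> by blast
    fix x assume x: "x \<in> \<Omega>"
    then obtain p where p: "p \<in> C" "x \<in> ball p (\<rho> p)" using C(3) closure_subset by blast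
    then have pC: "p \<in> ?C" using x by blast
    then have "\<forall>w. segment_lipschitz \<Omega> L w \<longrightarrow> \<bar>w x - w (\<sigma> p)\<bar> \<le> e"
      using \<rho>[of p] C(1) \<sigma>[OF pC] x p by blast
    then show "\<exists>s\<in>\<sigma> ` ?C. \<forall>w. segment_lipschitz \<Omega> L w \<longrightarrow> \<bar>w x - w s\<bar> \<le> e" using pC by blast
  qed
qed

text \<open>On a straight segment the polygonal sums telescope. This turns the upper bound on the
  pseudo-distance into a Lipschitz bound along segments.\<close>

lemma geodetic_dist_le_segment:
  fixes x y :: "'a::euclidean_space"
  assumes "closed_segment x y \<subseteq> \<Omega>"
  shows "geodetic_dist \<Omega> x y \<le> ereal (norm (x - y))"
proof -
  let ?c = "linepath x y"
  have c_diff: "?c s - ?c t = (s - t) *\<^sub>R (y - x)" for s t by (simp add: linepath_def algebra_simps)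
  have "(norm (x - y))-lipschitz_on {0..1} ?c"
    by (rule lipschitz_onI) (auto simp: dist_norm c_diff norm_minus_commute)
  moreover have "?c ` {0..1} \<subseteq> \<Omega>" using assms by (simp add: linepath_image_01)
  ultimately have "geodetic_dist \<Omega> x y \<le> curve_length ?c"
    unfolding geodetic_dist_def by (intro INF_lower) (auto simp: linepath_0' linepath_1')
  also have "\<dots> \<le> ereal (norm (x - y))"
    unfolding curve_length_def
  proof (rule SUP_least, clarsimp)
    fix n :: nat and t :: "nat \<Rightarrow> real"
    assume t: "mono_on {..n} t" "t ` {..n} \<subseteq> {0..1}"
    have "norm (?c (t (Suc i)) - ?c (t i)) = (t (Suc i) - t i) * norm (y - x)" if "i < n" for i
      using monotone_onD[OF t(1), of i "Suc i"] that by (simp add: c_diff)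
    then have "(\<Sum>i<n. norm (?c (t (Suc i)) - ?c (t i))) = (\<Sum>i<n. t (Suc i) - t i) * norm (y - x)"
      by (simp add: sum_distrib_right)
    also have "\<dots> = (t n - t 0) * norm (y - x)" by (simp add: sum_lessThan_telescope)
    also have "\<dots> \<le> 1 * norm (y - x)"
    proof (rule mult_right_mono)
      have "t n \<in> {0..1}" "t 0 \<in> {0..1}" using t(2) by auto
      then show "t n - t 0 \<le> 1" by simp
    qed simp
    finally show "(\<Sum>i<n. norm (?c (t (Suc i)) - ?c (t i))) \<le> norm (x - y)"
      by (simp add: norm_minus_commute)
  qed
  finally show ?thesis .
qed

text \<open>The lower bound acts twice: \<open>d\<close> is nonnegative, so clearing the denominator
  keeps the inequality, and \<open>d x y = 0\<close> forces \<open>x = y\<close>, so the pairs left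
  out of the supremum impose nothing. The value \<open>\<infinity>\<close> of \<open>d\<close> is
  covered as well.\<close>

lemma diff_quotient_le_1_iff:
  fixes d :: "'a::euclidean_space \<Rightarrow> 'a \<Rightarrow> ereal"
  assumes "\<alpha> > 0" "\<And>x y. x \<in> \<Omega> \<Longrightarrow> y \<in> \<Omega> \<Longrightarrow> ereal (\<alpha> * norm (x - y)) \<le> d x y"
  shows "diff_quotient \<Omega> d u \<le> 1 \<longleftrightarrow> (\<forall>x\<in>\<Omega>. \<forall>y\<in>\<Omega>. ereal (u x - u y) \<le> d x y)"
proof -
  have key: "ereal a / c \<le> 1 \<longleftrightarrow> ereal a \<le> c" if "c > 0" for a :: real and c :: ereal
    using that by (cases c) (auto simp: one_ereal_def)
  have pos: "d x y > 0" if "x \<in> \<Omega>" "y \<in> \<Omega>" "d x y \<noteq> 0" for x y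
  proof -
    have "0 \<le> ereal (\<alpha> * norm (x - y))" using assms(1) by simp
    also have "\<dots> \<le> d x y" using assms(2) that by blast
    finally show ?thesis using that(3) by simp
  qed
  have zero: "x = y" if "x \<in> \<Omega>" "y \<in> \<Omega>" "d x y = 0" for x y
    using assms(2)[OF that(1,2)] that(3) assms(1) by (auto simp: mult_le_0_iff)
  have "diff_quotient \<Omega> d u \<le> 1 \<longleftrightarrow> (\<forall>x\<in>\<Omega>. \<forall>y\<in>\<Omega>. d x y \<noteq> 0 \<longrightarrow> ereal (u x - u y) / d x y \<le> 1)"
    unfolding diff_quotient_def SUP_le_iff by auto
  also have "\<dots> \<longleftrightarrow> (\<forall>x\<in>\<Omega>. \<forall>y\<in>\<Omega>. ereal (u x - u y) \<le> d x y)"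
  proof (intro ball_cong refl)
    fix x y assume xy: "x \<in> \<Omega>" "y \<in> \<Omega>"
    show "(d x y \<noteq> 0 \<longrightarrow> ereal (u x - u y) / d x y \<le> 1) = (ereal (u x - u y) \<le> d x y)"
    proof (cases "d x y = 0")
      case True
      then show ?thesis using zero[OF xy] by (simp add: zero_ereal_def[symmetric])
    next
      case False
      then show ?thesis using key[OF pos[OF xy]] by simp
    qed
  qed
  finally show ?thesis .
qed


subsection \<open>Relaxation of the supremal functional\<close>

locale supremal_functional =
  fixes \<Omega> :: "'a::euclidean_space set"
    and f :: "'a \<times> 'a \<Rightarrow> ereal"
    and F :: "('a \<Rightarrow> real) \<Rightarrow> ereal"
  assumes bounded: "bounded \<Omega>" and open_domain: "open \<Omega>" and boundary: "lipschitz_boundary \<Omega>"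
    and integrand: "f \<in> borel_measurable (restrict_space borel (\<Omega> \<times> UNIV))"
    and F_eq: "\<And>u. u \<in> W1inf \<Omega> \<Longrightarrow>
           F u = esssup (lebesgue_on \<Omega>) (\<lambda>x. f (x, weak_gradient \<Omega> u x))"
    and comparable: "\<And>l::real. (INF u\<in>W1inf \<Omega>. F u) < ereal l \<Longrightarrow>
           \<exists>\<alpha>>0. \<exists>\<beta>>0. \<forall>x\<in>\<Omega>. \<forall>y\<in>\<Omega>.
             ereal (\<alpha> * norm (x - y)) \<le> pseudo_dist \<Omega> F l x y \<and>
             pseudo_dist \<Omega> F l x y \<le> ereal \<beta> * geodetic_dist \<Omega> x y"
begin

definition inf_F :: ereal where "inf_F = (INF u\<in>W1inf \<Omega>. F u)"

definition sublevel :: "real \<Rightarrow> ('a \<Rightarrow> real) set" where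
  "sublevel l = {u \<in> W1inf \<Omega>. F u \<le> ereal l}"

text \<open>For levels above \<open>inf_F\<close> this is the set of \<open>u\<close> whose
  difference quotient is at most 1 (\<open>unit_ball_eq_diff_quotient\<close>), in a form without
  division that shows it to be closed and convex.\<close>

definition unit_ball :: "real \<Rightarrow> ('a \<Rightarrow> real) set" where
  "unit_ball l = diff_bounded \<Omega> (pseudo_dist \<Omega> F l)"

lemma inf_F_le: "u \<in> W1inf \<Omega> \<Longrightarrow> inf_F \<le> F u"
  unfolding inf_F_def by (rule INF_lower)

lemma unit_ball_W1inf: "unit_ball l \<subseteq> W1inf \<Omega>"
  by (auto simp: unit_ball_def diff_bounded_def)

lemma sublevel_subset_unit_ball: "sublevel l \<subseteq> unit_ball l"
  by (auto simp: sublevel_def unit_ball_def diff_bounded_def pseudo_dist_def intro!: SUP_upper)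

lemma pseudo_dist_mono: "l \<le> l' \<Longrightarrow> pseudo_dist \<Omega> F l x y \<le> pseudo_dist \<Omega> F l' x y"
  unfolding pseudo_dist_def by (rule SUP_subset_mono) (auto elim: order_trans)

lemma unit_ball_mono: "l \<le> l' \<Longrightarrow> unit_ball l \<subseteq> unit_ball l'"
  using pseudo_dist_mono order_trans unfolding unit_ball_def diff_bounded_def by blast

text \<open>One constant serves the whole level; the finite nets and the weak* convergence of
  gradients both depend on this uniformity.\<close>

lemma unit_ball_segment_lipschitz:
  assumes "inf_F < ereal l"
  obtains L where "L \<ge> 0" "\<And>u. u \<in> unit_ball l \<Longrightarrow> segment_lipschitz \<Omega> L u"
proof -
  obtain \<beta> where \<beta>: "\<beta> > 0"
    "\<And>x y. x \<in> \<Omega> \<Longrightarrow> y \<in> \<Omega> \<Longrightarrow> pseudo_dist \<Omega> F l x y \<le> ereal \<beta> * geodetic_dist \<Omega> x y"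
    using comparable[of l] assms unfolding inf_F_def by blast
  have one: "u x - u y \<le> \<beta> * norm (x - y)" if u: "u \<in> unit_ball l" and xy: "closed_segment x y \<subseteq> \<Omega>" for u x y
  proof -
    have x: "x \<in> \<Omega>" "y \<in> \<Omega>" using xy by auto
    have "ereal (u x - u y) \<le> pseudo_dist \<Omega> F l x y"
      using u x by (simp add: unit_ball_def diff_bounded_def)
    also have "\<dots> \<le> ereal \<beta> * geodetic_dist \<Omega> x y" by (rule \<beta>(2)[OF x])
    also have "\<dots> \<le> ereal \<beta> * ereal (norm (x - y))"
      using geodetic_dist_le_segment[OF xy] \<beta>(1) by (intro ereal_mult_left_mono) auto
    finally show ?thesis by simp
  qed
  have "segment_lipschitz \<Omega> \<beta> u" if u: "u \<in> unit_ball l" for u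
    unfolding segment_lipschitz_def
  proof (intro allI impI)
    fix x y assume xy: "closed_segment x y \<subseteq> \<Omega>"
    then have "closed_segment y x \<subseteq> \<Omega>" by (simp add: closed_segment_commute)
    then show "\<bar>u x - u y\<bar> \<le> \<beta> * norm (x - y)"
      using one[OF u xy] one[OF u, of y x] by (simp add: norm_minus_commute abs_le_iff)
  qed
  then show thesis using that[of \<beta>] \<beta>(1) by auto
qed

text \<open>The order of composition matters: a Borel function after a Lebesgue measurable one is
  Lebesgue measurable. Measurability is what lets an almost everywhere bound control the essential
  supremum.\<close>

lemma borel_measurable_integrand_compose:
  assumes "g \<in> borel_measurable (lebesgue_on \<Omega>)"
  shows "(\<lambda>x. f (x, g x)) \<in> borel_measurable (lebesgue_on \<Omega>)"
proof (rule measurable_compose[OF _ integrand])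
  have "(\<lambda>x. x) \<in> borel_measurable (lebesgue_on \<Omega>)"
    by (intro measurable_restrict_space1 measurable_completion) simp
  then have "(\<lambda>x. (x, g x)) \<in> borel_measurable (lebesgue_on \<Omega>)"
    using assms by (rule borel_measurable_Pair)
  then show "(\<lambda>x. (x, g x)) \<in> lebesgue_on \<Omega> \<rightarrow>\<^sub>M restrict_space borel (\<Omega> \<times> UNIV)"
    by (intro measurable_restrict_space2) (auto simp: space_restrict_space)
qed

text \<open>The supremal form of \<open>F\<close> enters here: a sublevel set is a pointwise
  condition on the gradient, hence inherited by any function whose gradient is almost everywhere
  copied from its members.\<close>

lemma F_le_iff:
  assumes "u \<in> W1inf \<Omega>"
  shows "F u \<le> c \<longleftrightarrow> (AE x in lebesgue_on \<Omega>. f (x, weak_gradient \<Omega> u x) \<le> c)"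
proof
  assume *: "F u \<le> c"
  have "AE x in lebesgue_on \<Omega>. f (x, weak_gradient \<Omega> u x) \<le> F u"
    unfolding F_eq[OF assms] by (rule esssup_AE)
  then show "AE x in lebesgue_on \<Omega>. f (x, weak_gradient \<Omega> u x) \<le> c"
    by eventually_elim (rule order_trans[OF _ *])
next
  assume *: "AE x in lebesgue_on \<Omega>. f (x, weak_gradient \<Omega> u x) \<le> c"
  show "F u \<le> c"
    unfolding F_eq[OF assms] using weak_gradient(1)[OF assms] *
    by (intro esssup_I borel_measurable_integrand_compose) (auto simp: Linf_def)
qed

section \<open>Lattice structure of the sublevel sets\<close>

lemma sublevel_add_const:
  assumes "u \<in> sublevel l"
  shows "(\<lambda>x. if x \<in> \<Omega> then u x + c else 0) \<in> sublevel l"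
proof -
  have u: "u \<in> W1inf \<Omega>" "F u \<le> ereal l" using assms by (auto simp: sublevel_def)
  note w = W1inf_add_const[OF open_domain bounded u(1), of c]
  have "AE x in lebesgue_on \<Omega>. f (x, weak_gradient \<Omega> u x) \<le> ereal l" using u F_le_iff by blast
  with w(2) have "AE x in lebesgue_on \<Omega>.
      f (x, weak_gradient \<Omega> (\<lambda>x. if x \<in> \<Omega> then u x + c else 0) x) \<le> ereal l"
    by eventually_elim simp
  then show ?thesis using w(1) F_le_iff by (simp add: sublevel_def)
qed

text \<open>Treats maximum and minimum together. The condition \<open>lip\<close>, evident for both,
  gives the segment bound for \<open>m\<close> and thereby access to its weak gradient.\<close>

lemma sublevel_glue:
  assumes l: "inf_F < ereal l" and uv: "u \<in> sublevel l" "v \<in> sublevel l"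
    and A: "A \<in> sets lebesgue"
    and m: "\<And>x. m x = (if x \<in> A then u x else v x)"
    and lip: "\<And>x y. \<bar>m x - m y\<bar> \<le> max \<bar>u x - u y\<bar> \<bar>v x - v y\<bar>"
  shows "m \<in> sublevel l"
proof -
  obtain L where L: "L \<ge> 0" "\<And>u. u \<in> unit_ball l \<Longrightarrow> segment_lipschitz \<Omega> L u"
    using unit_ball_segment_lipschitz[OF l] by blast
  have u: "u \<in> W1inf \<Omega>" "F u \<le> ereal l" and v: "v \<in> W1inf \<Omega>" "F v \<le> ereal l"
    using uv by (auto simp: sublevel_def)
  have Lu: "segment_lipschitz \<Omega> L u" "segment_lipschitz \<Omega> L v"
    using uv sublevel_subset_unit_ball L(2) by blast+
  have m0: "m x = 0" if "x \<notin> \<Omega>" for x using that u(1) v(1) by (simp add: m W1inf_def)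
  have Lm: "segment_lipschitz \<Omega> L m"
    unfolding segment_lipschitz_def
  proof (intro allI impI)
    fix x y assume "closed_segment x y \<subseteq> \<Omega>"
    then show "\<bar>m x - m y\<bar> \<le> L * norm (x - y)"
      using lip[of x y] segment_lipschitzD[OF Lu(1), of x y] segment_lipschitzD[OF Lu(2), of x y] by linarith
  qed
  note glue = segment_lipschitz_glue[OF open_domain bounded u(1) Lu(1) v(1) Lu(2) A m0 _ _ Lm L(1)]
  have mW: "m \<in> W1inf \<Omega>" by (rule glue(1)) (simp_all add: m)
  have g: "AE x in lebesgue_on \<Omega>. weak_gradient \<Omega> m x =
      (if x \<in> A then weak_gradient \<Omega> u x else weak_gradient \<Omega> v x)"
    by (rule glue(2)) (simp_all add: m)
  have "AE x in lebesgue_on \<Omega>. f (x, weak_gradient \<Omega> u x) \<le> ereal l"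
    "AE x in lebesgue_on \<Omega>. f (x, weak_gradient \<Omega> v x) \<le> ereal l"
    using u v F_le_iff by blast+
  with g have "AE x in lebesgue_on \<Omega>. f (x, weak_gradient \<Omega> m x) \<le> ereal l"
    by eventually_elim simp
  then show ?thesis using mW F_le_iff by (simp add: sublevel_def)
qed

lemma sublevel_superlevel_measurable:
  assumes "u \<in> sublevel l" "v \<in> sublevel l"
  shows "{x. v x \<le> u x} \<in> sets lebesgue"
proof -
  have "u \<in> borel_measurable lebesgue" "v \<in> borel_measurable lebesgue"
    using W1inf_measurable[OF open_domain] assms by (auto simp: sublevel_def)
  then have "{x \<in> space lebesgue. v x \<le> u x} \<in> sets lebesgue" by (intro borel_measurable_le)
  then show ?thesis by simp
qed

lemma sublevel_max:
  assumes "inf_F < ereal l" "u \<in> sublevel l" "v \<in> sublevel l"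
  shows "(\<lambda>x. max (u x) (v x)) \<in> sublevel l"
  by (rule sublevel_glue[OF assms sublevel_superlevel_measurable[OF assms(2,3)]]) auto

lemma sublevel_min:
  assumes "inf_F < ereal l" "u \<in> sublevel l" "v \<in> sublevel l"
  shows "(\<lambda>x. min (u x) (v x)) \<in> sublevel l"
  by (rule sublevel_glue[OF assms sublevel_superlevel_measurable[OF assms(3,2)]]) auto

lemma sublevel_Max:
  assumes "inf_F < ereal l" "finite I" "I \<noteq> {}" "\<And>i. i \<in> I \<Longrightarrow> w i \<in> sublevel l"
  shows "(\<lambda>x. Max ((\<lambda>i. w i x) ` I)) \<in> sublevel l"
  using assms(2-)
proof (induction rule: finite_ne_induct)
  case (insert i I)
  then show ?case using sublevel_max[OF assms(1), of "w i" "\<lambda>x. Max ((\<lambda>i. w i x) ` I)"] by simp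
qed simp

lemma sublevel_Min:
  assumes "inf_F < ereal l" "finite I" "I \<noteq> {}" "\<And>i. i \<in> I \<Longrightarrow> w i \<in> sublevel l"
  shows "(\<lambda>x. Min ((\<lambda>i. w i x) ` I)) \<in> sublevel l"
  using assms(2-)
proof (induction rule: finite_ne_induct)
  case (insert i I)
  then show ?case using sublevel_min[OF assms(1), of "w i" "\<lambda>x. Min ((\<lambda>i. w i x) ` I)"] by simp
qed simp

lemma sublevel_nonempty:
  assumes "inf_F < ereal l"
  shows "sublevel l \<noteq> {}"
proof -
  obtain u where "u \<in> W1inf \<Omega>" "F u < ereal l"
    using assms unfolding inf_F_def INF_less_iff by blast
  then show ?thesis by (auto simp: sublevel_def intro: less_imp_le)
qed

text \<open>The lattice argument of the Stone--Weierstrass theorem: the supremum defining the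
  pseudo-distance provides functions that are good at a pair of net points, and
  sublevel sets are stable under finite maxima and minima.\<close>

lemma unit_ball_approximation:
  assumes l: "inf_F < ereal l" and u: "u \<in> unit_ball l" and e: "e > 0"
  obtains w where "w \<in> sublevel l" "\<And>x. \<bar>w x - u x\<bar> \<le> e"
proof (cases "\<Omega> = {}")
  \<comment> \<open>Maxima and minima over the net need it to be nonempty, so the empty domain is
    treated apart.\<close>
  case True
  obtain w where w: "w \<in> sublevel l" using sublevel_nonempty[OF l] by blast
  have "w \<in> W1inf \<Omega>" "u \<in> W1inf \<Omega>"
    using w u unit_ball_W1inf by (auto simp: sublevel_def)
  then have "w x = 0" "u x = 0" for x using True by (auto simp: W1inf_def)
  then show thesis using that[OF w] e by simp
next
  case False
  obtain L where L: "L \<ge> 0" "\<And>u. u \<in> unit_ball l \<Longrightarrow> segment_lipschitz \<Omega> L u"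
    using unit_ball_segment_lipschitz[OF l] by blast
  \<comment> \<open>Three errors of size \<open>\<delta>\<close> occur: moving from \<open>x\<close>
    to a net point for \<open>u\<close>, the same for an approximant, and the defect in the supremum
    defining the pseudo-distance.\<close>
  define \<delta> where "\<delta> = e / 3"
  have \<delta>: "\<delta> > 0" using e by (simp add: \<delta>_def)
  obtain S where S: "finite S" "S \<subseteq> \<Omega>"
    "\<And>x. x \<in> \<Omega> \<Longrightarrow> \<exists>s\<in>S. \<forall>w. segment_lipschitz \<Omega> L w \<longrightarrow> \<bar>w x - w s\<bar> \<le> \<delta>"
    using lipschitz_boundary_net[OF bounded open_domain boundary L(1) \<delta>] by blast
  have S_ne: "S \<noteq> {}" using S(3) False by blast
  have "\<exists>v\<in>sublevel l. u s - u t - \<delta> < v s - v t" if "s \<in> S" "t \<in> S" for s t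
  proof -
    have "ereal (u s - u t - \<delta>) < ereal (u s - u t)" using \<delta> by simp
    also have "\<dots> \<le> pseudo_dist \<Omega> F l s t"
      using u that S(2) by (auto simp: unit_ball_def diff_bounded_def)
    finally show ?thesis unfolding pseudo_dist_def less_SUP_iff by (auto simp: sublevel_def)
  qed
  then obtain v where v: "\<And>s t. s \<in> S \<Longrightarrow> t \<in> S \<Longrightarrow> v s t \<in> sublevel l \<and> u s - u t - \<delta> < v s t s - v s t t"
    by metis
  \<comment> \<open>The constant makes \<open>w s t\<close> equal to \<open>u\<close> at
    \<open>t\<close> and larger than \<open>u s - \<delta>\<close> at \<open>s\<close>.
    One-sidedness at \<open>s\<close> is enough: the maximum over \<open>s\<close> yields the lower
    bound everywhere, and the minimum over \<open>t\<close> then yields the upper one.\<close>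
  define w where "w s t x = (if x \<in> \<Omega> then v s t x + (u t - v s t t) else 0)" for s t x
  have w: "w s t \<in> sublevel l" if "s \<in> S" "t \<in> S" for s t
    unfolding w_def[abs_def] using v[OF that] by (intro sublevel_add_const) blast
  have w_lip: "segment_lipschitz \<Omega> L (w s t)" if "s \<in> S" "t \<in> S" for s t
    using w[OF that] sublevel_subset_unit_ball L(2) by blast
  define g where "g t x = Max ((\<lambda>s. w s t x) ` S)" for t x
  define k where "k x = Min ((\<lambda>t. g t x) ` S)" for x
  have g: "g t \<in> sublevel l" if "t \<in> S" for t
    unfolding g_def[abs_def] using w that by (intro sublevel_Max[OF l S(1) S_ne])
  have kS: "k \<in> sublevel l"
    unfolding k_def[abs_def] using g by (intro sublevel_Min[OF l S(1) S_ne])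
  have u_lip: "segment_lipschitz \<Omega> L u" using u L(2) by blast
  have "\<bar>k x - u x\<bar> \<le> e" for x
  proof (cases "x \<in> \<Omega>")
    case False
    have "k \<in> W1inf \<Omega>" "u \<in> W1inf \<Omega>"
      using kS u unit_ball_W1inf by (auto simp: sublevel_def)
    then show ?thesis using False e by (simp add: W1inf_def)
  next
    case True
    then obtain r where r: "r \<in> S" "\<And>w. segment_lipschitz \<Omega> L w \<Longrightarrow> \<bar>w x - w r\<bar> \<le> \<delta>"
      using S(3) by blast
    have r\<Omega>: "r \<in> \<Omega>" using r(1) S(2) by blast
    have ur: "\<bar>u x - u r\<bar> \<le> \<delta>" using r(2)[OF u_lip] .
    have lower: "u x - 3 * \<delta> \<le> g t x" if t: "t \<in> S" for t
    proof -
      have "u r - \<delta> < w r t r" using v[OF r(1) t] r\<Omega> by (simp add: w_def)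
      moreover have "\<bar>w r t x - w r t r\<bar> \<le> \<delta>" using r(2)[OF w_lip[OF r(1) t]] .
      moreover have "w r t x \<le> g t x" unfolding g_def using S(1) r(1) by (intro Max_ge) auto
      ultimately show ?thesis using ur by linarith
    qed
    have "u x - 3 * \<delta> \<le> k x"
      unfolding k_def using S(1) S_ne lower by (subst Min_ge_iff) auto
    \<comment> \<open>In the minimum it suffices to take \<open>t = r\<close>, the net point of
      \<open>x\<close>: every \<open>w s r\<close> equals \<open>u\<close> at \<open>r\<close>, so
      no defect of the supremum enters and \<open>2 * \<delta>\<close> would do.\<close>
    moreover have "k x \<le> u x + 3 * \<delta>"
    proof -
      have "w s r x \<le> u x + 3 * \<delta>" if s: "s \<in> S" for s
      proof -
        have "w s r r = u r" using r\<Omega> by (simp add: w_def)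
        then show ?thesis using r(2)[OF w_lip[OF s r(1)]] ur \<delta> by linarith
      qed
      then have "g r x \<le> u x + 3 * \<delta>"
        unfolding g_def using S(1) S_ne by (subst Max_le_iff) auto
      moreover have "k x \<le> g r x" unfolding k_def using S(1) r(1) by (intro Min_le) auto
      ultimately show ?thesis by linarith
    qed
    ultimately show ?thesis by (simp add: \<delta>_def abs_le_iff)
  qed
  then show thesis using that[OF kS] by blast
qed

section \<open>The relaxed functional\<close>

definition relaxation :: "('a \<Rightarrow> real) \<Rightarrow> ereal" where
  "relaxation u = Inf {ereal l | l. inf_F < ereal l \<and> u \<in> unit_ball l}"

text \<open>The infimum need not be attained, hence the strict \<open>l' > l\<close>; this is the
  origin of the intersection over larger levels in the theorem. All these \<open>l'\<close> exceed
  \<open>inf_F\<close>, where the comparison with the geodetic distance is available, even if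
  \<open>l\<close> equals \<open>inf_F\<close>.\<close>

lemma relaxation_le_iff:
  assumes l: "inf_F \<le> ereal l"
  shows "relaxation u \<le> ereal l \<longleftrightarrow> (\<forall>l'>l. u \<in> unit_ball l')"
proof
  assume *: "relaxation u \<le> ereal l"
  show "\<forall>l'>l. u \<in> unit_ball l'"
  proof (intro allI impI)
    fix l' assume "l' > l"
    then have "relaxation u < ereal l'" using * by (simp add: le_less_trans)
    then obtain k where "ereal k < ereal l'" "u \<in> unit_ball k"
      unfolding relaxation_def Inf_less_iff by blast
    then show "u \<in> unit_ball l'" using unit_ball_mono[of k l'] by auto
  qed
next
  assume *: "\<forall>l'>l. u \<in> unit_ball l'"
  show "relaxation u \<le> ereal l"
  proof (rule dense_ge)
    fix z assume "ereal l < z"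
    then obtain k where k: "ereal l < ereal k" "ereal k < z" using ereal_dense2 by blast
    have "inf_F < ereal k" using l k(1) by (rule le_less_trans)
    then have "relaxation u \<le> ereal k"
      unfolding relaxation_def using * k(1) by (intro Inf_lower) auto
    then show "relaxation u \<le> z" using k(2) by simp
  qed
qed

lemma inf_F_le_relaxation: "inf_F \<le> relaxation u"
  unfolding relaxation_def by (rule Inf_greatest) (auto intro: less_imp_le)

text \<open>Real levels strictly above \<open>F u\<close> are used because \<open>F u\<close> itself
  may be infinite or equal to \<open>inf_F\<close>, and is then not admissible in the
  infimum.\<close>

lemma relaxation_le_F:
  assumes u: "u \<in> W1inf \<Omega>"
  shows "relaxation u \<le> F u"
proof (rule dense_ge)
  fix z assume "F u < z"
  then obtain k where k: "F u < ereal k" "ereal k < z" using ereal_dense2 by blast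
  have "inf_F < ereal k" using inf_F_le[OF u] k(1) by (rule le_less_trans)
  moreover have "u \<in> sublevel k" using u k(1) by (simp add: sublevel_def less_imp_le)
  ultimately have "relaxation u \<le> ereal k"
    unfolding relaxation_def using sublevel_subset_unit_ball by (intro Inf_lower) auto
  then show "relaxation u \<le> z" using k(2) by simp
qed

lemma relaxation_sublevel:
  assumes l: "inf_F \<le> ereal l"
  shows "{u \<in> W1inf \<Omega>. relaxation u \<le> ereal l} = (\<Inter>l'\<in>{l<..}. unit_ball l')"
proof -
  have "u \<in> W1inf \<Omega>" if "\<forall>l'>l. u \<in> unit_ball l'" for u
    using that gt_ex[of l] unit_ball_W1inf by blast
  then show ?thesis using relaxation_le_iff[OF l] by auto
qed

lemma level_convex_relaxation: "level_convex \<Omega> relaxation"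
  unfolding level_convex_def
proof (intro allI ballI)
  fix l :: real and u v and t :: real
  assume u: "u \<in> {u \<in> W1inf \<Omega>. relaxation u \<le> ereal l}"
    and v: "v \<in> {u \<in> W1inf \<Omega>. relaxation u \<le> ereal l}" and t: "t \<in> {0..1}"
  let ?w = "\<lambda>x. (1 - t) * u x + t * v x"
  have l: "inf_F \<le> ereal l" using inf_F_le_relaxation[of u] u by auto
  have w: "?w \<in> W1inf \<Omega>" using u v by (intro W1inf_lincomb open_domain bounded) auto
  have "?w \<in> unit_ball l'" if l': "l' > l" for l'
  proof -
    have uv: "u \<in> unit_ball l'" "v \<in> unit_ball l'" using u v l' relaxation_le_iff[OF l] by auto
    have "ereal (?w x - ?w y) \<le> pseudo_dist \<Omega> F l' x y" if xy: "x \<in> \<Omega>" "y \<in> \<Omega>" for x y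
    proof -
      \<comment> \<open>Going through the larger of the two differences avoids convex combinations
        in the extended reals, where the pseudo-distance takes its values.\<close>
      let ?m = "max (u x - u y) (v x - v y)"
      have "?w x - ?w y = (1 - t) * (u x - u y) + t * (v x - v y)" by (simp add: algebra_simps)
      also have "\<dots> \<le> (1 - t) * ?m + t * ?m"
        using t by (intro add_mono mult_left_mono) auto
      also have "\<dots> = ?m" by (simp add: algebra_simps)
      finally have "ereal (?w x - ?w y) \<le> ereal ?m" by (simp only: ereal_less_eq)
      also have "\<dots> \<le> pseudo_dist \<Omega> F l' x y"
        using uv xy by (simp add: unit_ball_def diff_bounded_def max_def)
      finally show ?thesis .
    qed
    then show ?thesis using w by (simp add: unit_ball_def diff_bounded_def)
  qed
  then show "?w \<in> {u \<in> W1inf \<Omega>. relaxation u \<le> ereal l}"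
    using w relaxation_le_iff[OF l] by blast
qed

text \<open>The three topologies enter only through two properties: the sets \<open>unit_ball l\<close> are closed,
  and closed sets contain the uniform limits of their equi-Lipschitz sequences.\<close>

lemma lsc_envelope_eq_relaxation:
  assumes top: "topspace \<tau> = W1inf \<Omega>"
    and closed: "\<And>l. inf_F < ereal l \<Longrightarrow> closedin \<tau> (unit_ball l)"
    and limit: "\<And>C w u L d. closedin \<tau> C \<Longrightarrow> (\<And>n :: nat. w n \<in> C) \<Longrightarrow> u \<in> W1inf \<Omega> \<Longrightarrow>
      (\<And>n. segment_lipschitz \<Omega> L (w n)) \<Longrightarrow> segment_lipschitz \<Omega> L u \<Longrightarrow> L \<ge> 0 \<Longrightarrow>
      (\<And>n x. \<bar>w n x - u x\<bar> \<le> d n) \<Longrightarrow> d \<longlonglongrightarrow> (0::real) \<Longrightarrow> u \<in> C"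
    and u: "u \<in> W1inf \<Omega>"
  shows "lsc_envelope \<tau> F u = relaxation u"
proof (rule antisym)
  have "lsc_wrt \<tau> relaxation"
    unfolding lsc_wrt_def top
  proof
    fix l :: real
    show "closedin \<tau> {u \<in> W1inf \<Omega>. relaxation u \<le> ereal l}"
    proof (cases "inf_F \<le> ereal l")
      case True
      have "inf_F < ereal l'" if "l' > l" for l' using True that by (simp add: le_less_trans)
      then have "closedin \<tau> (\<Inter>l'\<in>{l<..}. unit_ball l')"
        using closed by (intro closedin_INT) (auto intro: gt_ex)
      then show ?thesis using relaxation_sublevel[OF True] by simp
    next
      case False
      then have "{u \<in> W1inf \<Omega>. relaxation u \<le> ereal l} = {}"
        using inf_F_le_relaxation order_trans by blast
      then show ?thesis by (simp only: closedin_empty)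
    qed
  qed
  then show "relaxation u \<le> lsc_envelope \<tau> F u"
    unfolding lsc_envelope_def top using relaxation_le_F by (intro SUP_upper) auto
  show "lsc_envelope \<tau> F u \<le> relaxation u"
    unfolding lsc_envelope_def
  proof (rule SUP_least)
    fix G assume "G \<in> {G. lsc_wrt \<tau> G \<and> (\<forall>v\<in>topspace \<tau>. G v \<le> F v)}"
    then have G: "\<And>l::real. closedin \<tau> {u \<in> W1inf \<Omega>. G u \<le> ereal l}" "\<And>v. v \<in> W1inf \<Omega> \<Longrightarrow> G v \<le> F v"
      by (auto simp: lsc_wrt_def top)
    show "G u \<le> relaxation u"
      unfolding relaxation_def
    proof (rule Inf_greatest)
      fix z assume "z \<in> {ereal l | l. inf_F < ereal l \<and> u \<in> unit_ball l}"
      then obtain l where z: "z = ereal l" and l: "inf_F < ereal l" and ul: "u \<in> unit_ball l" by blast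
      obtain L where L: "L \<ge> 0" "\<And>u. u \<in> unit_ball l \<Longrightarrow> segment_lipschitz \<Omega> L u"
        using unit_ball_segment_lipschitz[OF l] by blast
      have "\<exists>w\<in>sublevel l. \<forall>x. \<bar>w x - u x\<bar> \<le> 1 / real (Suc n)" for n
        using unit_ball_approximation[OF l ul, of "1 / real (Suc n)"] by auto
      then obtain w where w: "\<And>n. w n \<in> sublevel l" "\<And>n x. \<bar>w n x - u x\<bar> \<le> 1 / real (Suc n)"
        by metis
      \<comment> \<open>\<open>G \<le> F\<close> places the approximants in this closed set, so
        closedness carries the bound over to \<open>u\<close> with no loss in the level.\<close>
      have "u \<in> {u \<in> W1inf \<Omega>. G u \<le> ereal l}"
      proof (rule limit[OF G(1) _ u _ L(2)[OF ul] L(1) w(2) LIMSEQ_Suc[OF lim_1_over_n]])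
        show "w n \<in> {u \<in> W1inf \<Omega>. G u \<le> ereal l}" for n
          using w(1)[of n] G(2)[of "w n"] by (auto simp: sublevel_def)
        show "segment_lipschitz \<Omega> L (w n)" for n
          using w(1)[of n] sublevel_subset_unit_ball L(2) by blast
      qed
      then show "G u \<le> z" by (simp add: z)
    qed
  qed
qed

section \<open>The three topologies\<close>

lemma lsc_envelope_tau_inf:
  assumes u: "u \<in> W1inf \<Omega>"
  shows "lsc_envelope (tau_inf \<Omega>) F u = relaxation u"
proof -
  interpret M: Metric_space "W1inf \<Omega>" "Linf_dist \<Omega>" by (rule Metric_space_Linf_dist[OF open_domain])
  show ?thesis
  proof (rule lsc_envelope_eq_relaxation[OF _ _ _ u])
    show "topspace (tau_inf \<Omega>) = W1inf \<Omega>" by (simp add: tau_inf_def)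
    show "closedin (tau_inf \<Omega>) (unit_ball l)" for l
      unfolding unit_ball_def by (rule closedin_tau_inf_diff_bounded[OF open_domain])
    fix C w v and L :: real and d
    assume C: "closedin (tau_inf \<Omega>) C" and w: "\<And>n :: nat. w n \<in> C" and v: "v \<in> W1inf \<Omega>"
      and conv: "\<And>n x. \<bar>w n x - v x\<bar> \<le> d n" "d \<longlonglongrightarrow> (0::real)"
    have wW: "w n \<in> W1inf \<Omega>" for n
      using w closedin_subset[OF C] by (auto simp: tau_inf_def)
    have "limitin M.mtopology w v sequentially"
      unfolding M.limitin_metric
    proof (intro conjI allI impI v)
      fix e :: real assume e: "e > 0"
      have "\<forall>\<^sub>F n in sequentially. d n < e" using conv(2) e by (rule order_tendstoD(2))
      then show "\<forall>\<^sub>F n in sequentially. w n \<in> W1inf \<Omega> \<and> Linf_dist \<Omega> (w n) v < e"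
      proof eventually_elim
        case (elim n)
        have "Linf_dist \<Omega> (w n) v \<le> d n"
        proof (cases "\<Omega> = {}")
          case True
          then have "w n = v" using wW[of n] v by (auto simp: W1inf_def fun_eq_iff)
          then have "Linf_dist \<Omega> (w n) v = 0" using v by simp
          \<comment> \<open>Nonnegativity of \<open>d n\<close> is read off from the estimate at an
            arbitrary point.\<close>
          then show ?thesis using conv(1)[of n 0] abs_ge_zero order_trans by metis
        next
          case False
          then show ?thesis using Linf_dist_le_iff[OF open_domain False wW v] conv(1) by blast
        qed
        then show ?case using elim wW by simp
      qed
    qed
    then show "v \<in> C"
      using limitin_closedin[of M.mtopology w v sequentially C] C w by (simp add: tau_inf_def)
  qed
qed

lemma closedin_wstar_unit_ball:
  assumes "inf_F < ereal l"
  shows "closedin (wstar \<Omega>) (unit_ball l)"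
proof -
  obtain L where L: "L \<ge> 0" "\<And>u. u \<in> unit_ball l \<Longrightarrow> segment_lipschitz \<Omega> L u"
    using unit_ball_segment_lipschitz[OF assms] by blast
  show ?thesis
    unfolding unit_ball_def
    by (rule closedin_wstar_diff_bounded[OF open_domain L(1)]) (use L(2) in \<open>simp add: unit_ball_def\<close>)
qed

lemma lsc_envelope_wstar:
  assumes u: "u \<in> W1inf \<Omega>"
  shows "lsc_envelope (wstar \<Omega>) F u = relaxation u"
proof (rule lsc_envelope_eq_relaxation[OF _ closedin_wstar_unit_ball _ u])
  fix C w v and L :: real and d
  assume C: "closedin (wstar \<Omega>) C" and w: "\<And>n :: nat. w n \<in> C" and v: "v \<in> W1inf \<Omega>"
    and lip: "\<And>n. segment_lipschitz \<Omega> L (w n)" "segment_lipschitz \<Omega> L v" "L \<ge> 0"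
    and conv: "\<And>n x. \<bar>w n x - v x\<bar> \<le> d n" "d \<longlonglongrightarrow> (0::real)"
  have "w n \<in> W1inf \<Omega>" for n using w closedin_subset[OF C] by auto
  from limitin_wstar[OF open_domain bounded this lip(1) v lip(2,3) conv]
  show "v \<in> C" using limitin_closedin[of "wstar \<Omega>" w v sequentially C] C w by simp
qed simp

text \<open>Closed sets are sequentially closed in any topology, which settles the constraints; and
  closed sets of \<open>wstar_seq\<close> contain the weak* limits of their sequences by
  construction.\<close>

lemma lsc_envelope_wstar_seq:
  assumes u: "u \<in> W1inf \<Omega>"
  shows "lsc_envelope (wstar_seq \<Omega>) F u = relaxation u"
proof (rule lsc_envelope_eq_relaxation[OF _ _ _ u])
  fix l assume "inf_F < ereal l"
  then have C: "closedin (wstar \<Omega>) (unit_ball l)" by (rule closedin_wstar_unit_ball)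
  show "closedin (wstar_seq \<Omega>) (unit_ball l)"
    unfolding wstar_seq_def closedin_seq_topology seq_closedin_def
    using closedin_subset[OF C] limitin_closedin[OF _ C _ trivial_limit_sequentially]
    by (auto intro: always_eventually)
next
  fix C w v and L :: real and d
  assume C: "closedin (wstar_seq \<Omega>) C" and w: "\<And>n :: nat. w n \<in> C" and v: "v \<in> W1inf \<Omega>"
    and lip: "\<And>n. segment_lipschitz \<Omega> L (w n)" "segment_lipschitz \<Omega> L v" "L \<ge> 0"
    and conv: "\<And>n x. \<bar>w n x - v x\<bar> \<le> d n" "d \<longlonglongrightarrow> (0::real)"
  have "w n \<in> W1inf \<Omega>" for n using w closedin_subset[OF C] by auto
  from limitin_wstar[OF open_domain bounded this lip(1) v lip(2,3) conv]
  show "v \<in> C" using C w unfolding wstar_seq_def closedin_seq_topology seq_closedin_def by blast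
qed simp

lemma unit_ball_eq_diff_quotient:
  assumes l: "inf_F < ereal l"
  shows "unit_ball l = {u \<in> W1inf \<Omega>. diff_quotient \<Omega> (pseudo_dist \<Omega> F l) u \<le> 1}"
proof -
  obtain \<alpha> where \<alpha>: "\<alpha> > 0"
    "\<And>x y. x \<in> \<Omega> \<Longrightarrow> y \<in> \<Omega> \<Longrightarrow> ereal (\<alpha> * norm (x - y)) \<le> pseudo_dist \<Omega> F l x y"
    using comparable[of l] l unfolding inf_F_def by blast
  show ?thesis
    unfolding unit_ball_def diff_bounded_def using diff_quotient_le_1_iff[OF \<alpha>] by simp
qed

text \<open>The new pseudo-distance lies between \<open>pseudo_dist \<Omega> F l\<close> and
  \<open>pseudo_dist \<Omega> F k\<close> for every \<open>k > l\<close>. The left inequality passes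
  on the lower bound that allows division; the right one leads from the constraints back to
  \<open>unit_ball k\<close>.\<close>

lemma relaxation_sublevel_eq_diff_quotient:
  assumes l: "inf_F < ereal l"
  shows "{u \<in> W1inf \<Omega>. relaxation u \<le> ereal l} =
    {u \<in> W1inf \<Omega>. diff_quotient \<Omega> (pseudo_dist \<Omega> relaxation l) u \<le> 1}"
proof -
  obtain \<alpha> where \<alpha>: "\<alpha> > 0"
    "\<And>x y. x \<in> \<Omega> \<Longrightarrow> y \<in> \<Omega> \<Longrightarrow> ereal (\<alpha> * norm (x - y)) \<le> pseudo_dist \<Omega> F l x y"
    using comparable[of l] l unfolding inf_F_def by blast
  note l' = less_imp_le[OF l]
  have "pseudo_dist \<Omega> F l x y \<le> pseudo_dist \<Omega> relaxation l x y" for x y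
    unfolding pseudo_dist_def using relaxation_le_F by (intro SUP_subset_mono) (auto intro: order_trans)
  then have \<alpha>': "ereal (\<alpha> * norm (x - y)) \<le> pseudo_dist \<Omega> relaxation l x y" if "x \<in> \<Omega>" "y \<in> \<Omega>" for x y
    using \<alpha>(2)[OF that] order_trans by blast
  have le: "pseudo_dist \<Omega> relaxation l x y \<le> pseudo_dist \<Omega> F k x y" if "x \<in> \<Omega>" "y \<in> \<Omega>" "k > l" for k x y
    unfolding pseudo_dist_def[of \<Omega> relaxation]
  proof (rule SUP_least)
    fix u assume "u \<in> {u \<in> W1inf \<Omega>. relaxation u \<le> ereal l}"
    then have "u \<in> unit_ball k" using relaxation_le_iff[OF l'] that(3) by blast
    then show "ereal (u x - u y) \<le> pseudo_dist \<Omega> F k x y"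
      using that by (simp add: unit_ball_def diff_bounded_def)
  qed
  have "relaxation u \<le> ereal l \<longleftrightarrow> (\<forall>x\<in>\<Omega>. \<forall>y\<in>\<Omega>. ereal (u x - u y) \<le> pseudo_dist \<Omega> relaxation l x y)"
    if u: "u \<in> W1inf \<Omega>" for u
  proof
    assume "relaxation u \<le> ereal l"
    then show "\<forall>x\<in>\<Omega>. \<forall>y\<in>\<Omega>. ereal (u x - u y) \<le> pseudo_dist \<Omega> relaxation l x y"
      using u unfolding pseudo_dist_def by (auto intro: SUP_upper)
  next
    assume *: "\<forall>x\<in>\<Omega>. \<forall>y\<in>\<Omega>. ereal (u x - u y) \<le> pseudo_dist \<Omega> relaxation l x y"
    have "u \<in> unit_ball k" if "k > l" for k
      using u * le[OF _ _ that] order_trans unfolding unit_ball_def diff_bounded_def by blast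
    then show "relaxation u \<le> ereal l" using relaxation_le_iff[OF l'] by blast
  qed
  then show ?thesis using diff_quotient_le_1_iff[OF \<alpha>(1) \<alpha>'] by blast
qed

end

theorem theorem3p1:
  fixes \<Omega> :: "'a::euclidean_space set"
    and f :: "'a \<times> 'a \<Rightarrow> ereal"
    and F :: "('a \<Rightarrow> real) \<Rightarrow> ereal"
  assumes "bounded \<Omega>" and "connected \<Omega>" and "open \<Omega>" and "lipschitz_boundary \<Omega>"
    and "f \<in> borel_measurable (restrict_space borel (\<Omega> \<times> UNIV))"
    and "\<And>u. u \<in> W1inf \<Omega> \<Longrightarrow>
           F u = esssup (lebesgue_on \<Omega>) (\<lambda>x. f (x, weak_gradient \<Omega> u x))"
    and "\<And>l::real. (INF u\<in>W1inf \<Omega>. F u) < ereal l \<Longrightarrow>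
           \<exists>\<alpha>>0. \<exists>\<beta>>0. \<forall>x\<in>\<Omega>. \<forall>y\<in>\<Omega>.
             ereal (\<alpha> * norm (x - y)) \<le> pseudo_dist \<Omega> F l x y \<and>
             pseudo_dist \<Omega> F l x y \<le> ereal \<beta> * geodetic_dist \<Omega> x y"
  shows "(\<forall>u\<in>W1inf \<Omega>.
            lsc_envelope (tau_inf \<Omega>) F u = lsc_envelope (wstar \<Omega>) F u \<and>
            lsc_envelope (wstar \<Omega>) F u = lsc_envelope (wstar_seq \<Omega>) F u) \<and>
         (\<forall>\<tau>\<in>{tau_inf \<Omega>, wstar \<Omega>, wstar_seq \<Omega>}.
            (\<forall>l::real. (INF u\<in>W1inf \<Omega>. F u) < ereal l \<longrightarrow>
               {u \<in> W1inf \<Omega>. lsc_envelope \<tau> F u \<le> ereal l} =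
                 {u \<in> W1inf \<Omega>. diff_quotient \<Omega> (pseudo_dist \<Omega> (lsc_envelope \<tau> F) l) u \<le> 1} \<and>
               {u \<in> W1inf \<Omega>. diff_quotient \<Omega> (pseudo_dist \<Omega> (lsc_envelope \<tau> F) l) u \<le> 1} =
                 (\<Inter>l'\<in>{l<..}. {u \<in> W1inf \<Omega>. diff_quotient \<Omega> (pseudo_dist \<Omega> F l') u \<le> 1})) \<and>
            level_convex \<Omega> (lsc_envelope \<tau> F))"
proof -
  interpret supremal_functional \<Omega> f F
    by unfold_locales (fact assms)+
  have env: "lsc_envelope \<tau> F u = relaxation u"
    if "\<tau> \<in> {tau_inf \<Omega>, wstar \<Omega>, wstar_seq \<Omega>}" "u \<in> W1inf \<Omega>" for \<tau> u
    using that lsc_envelope_tau_inf lsc_envelope_wstar lsc_envelope_wstar_seq by blast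
  have main: "{u \<in> W1inf \<Omega>. lsc_envelope \<tau> F u \<le> ereal l} =
        {u \<in> W1inf \<Omega>. diff_quotient \<Omega> (pseudo_dist \<Omega> (lsc_envelope \<tau> F) l) u \<le> 1}"
      "{u \<in> W1inf \<Omega>. diff_quotient \<Omega> (pseudo_dist \<Omega> (lsc_envelope \<tau> F) l) u \<le> 1} =
        (\<Inter>l'\<in>{l<..}. {u \<in> W1inf \<Omega>. diff_quotient \<Omega> (pseudo_dist \<Omega> F l') u \<le> 1})"
    if \<tau>: "\<tau> \<in> {tau_inf \<Omega>, wstar \<Omega>, wstar_seq \<Omega>}" and l: "inf_F < ereal l" for \<tau> l
  proof -
    have S: "{u \<in> W1inf \<Omega>. lsc_envelope \<tau> F u \<le> ereal l} = {u \<in> W1inf \<Omega>. relaxation u \<le> ereal l}"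
      using env[OF \<tau>] by auto
    \<comment> \<open>Agreement on \<open>W1inf\<close> suffices: the pseudo-distance sees a
      functional through its sublevel sets there.\<close>
    then have P: "pseudo_dist \<Omega> (lsc_envelope \<tau> F) l = pseudo_dist \<Omega> relaxation l"
      by (simp add: pseudo_dist_def fun_eq_iff)
    have ball: "unit_ball l' = {u \<in> W1inf \<Omega>. diff_quotient \<Omega> (pseudo_dist \<Omega> F l') u \<le> 1}" if "l' > l" for l'
      using unit_ball_eq_diff_quotient less_trans[OF l, of "ereal l'"] that by simp
    show "{u \<in> W1inf \<Omega>. lsc_envelope \<tau> F u \<le> ereal l} =
        {u \<in> W1inf \<Omega>. diff_quotient \<Omega> (pseudo_dist \<Omega> (lsc_envelope \<tau> F) l) u \<le> 1}"
      unfolding S P by (rule relaxation_sublevel_eq_diff_quotient[OF l])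
    show "{u \<in> W1inf \<Omega>. diff_quotient \<Omega> (pseudo_dist \<Omega> (lsc_envelope \<tau> F) l) u \<le> 1} =
        (\<Inter>l'\<in>{l<..}. {u \<in> W1inf \<Omega>. diff_quotient \<Omega> (pseudo_dist \<Omega> F l') u \<le> 1})"
      unfolding P relaxation_sublevel_eq_diff_quotient[OF l, symmetric]
        relaxation_sublevel[OF less_imp_le[OF l]]
      by (rule INF_cong) (simp_all add: ball)
  qed
  have convex: "level_convex \<Omega> (lsc_envelope \<tau> F)" if \<tau>: "\<tau> \<in> {tau_inf \<Omega>, wstar \<Omega>, wstar_seq \<Omega>}" for \<tau>
  proof -
    have "{u \<in> W1inf \<Omega>. lsc_envelope \<tau> F u \<le> ereal l} = {u \<in> W1inf \<Omega>. relaxation u \<le> ereal l}" for l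
      using env[OF \<tau>] by auto
    then show ?thesis using level_convex_relaxation by (simp only: level_convex_def)
  qed
  show ?thesis
  proof (intro conjI ballI allI impI)
    fix u assume u: "u \<in> W1inf \<Omega>"
    show "lsc_envelope (tau_inf \<Omega>) F u = lsc_envelope (wstar \<Omega>) F u"
      "lsc_envelope (wstar \<Omega>) F u = lsc_envelope (wstar_seq \<Omega>) F u"
      using env[OF _ u] by simp_all
  next
    fix \<tau> and l :: real
    assume \<tau>: "\<tau> \<in> {tau_inf \<Omega>, wstar \<Omega>, wstar_seq \<Omega>}" and "(INF u\<in>W1inf \<Omega>. F u) < ereal l"
    then have l: "inf_F < ereal l" by (simp only: inf_F_def)
    show "{u \<in> W1inf \<Omega>. lsc_envelope \<tau> F u \<le> ereal l} =
        {u \<in> W1inf \<Omega>. diff_quotient \<Omega> (pseudo_dist \<Omega> (lsc_envelope \<tau> F) l) u \<le> 1}"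
      by (rule main(1)[OF \<tau> l])
    show "{u \<in> W1inf \<Omega>. diff_quotient \<Omega> (pseudo_dist \<Omega> (lsc_envelope \<tau> F) l) u \<le> 1} =
        (\<Inter>l'\<in>{l<..}. {u \<in> W1inf \<Omega>. diff_quotient \<Omega> (pseudo_dist \<Omega> F l') u \<le> 1})"
      by (rule main(2)[OF \<tau> l])
  qed (rule convex)
qed

end
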